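(* Let $\bar x\in\mathbb{R}^d\setminus\{0\}$, let $a_1,\dots,a_m$ be independent realizations of a random vector $a\in\mathbb{R}^d$, let $b_i=\langle a_i,\bar x\rangle^2$, and let $f_S(x)=\frac1m\sum_{i=1}^m|\langle a_i,x\rangle^2-b_i|$. Suppose that: (1) there exist constants $\kappa_{\mathrm{st}}^*,p_0>0$ such that $\mathbb{P}(|\langle a,v\rangle\langle a,u\rangle|\ge\kappa_{\mathrm{st}}^* )\ge p_0$ for all unit vectors $u,v\in\mathbb{S}^{d-1}$; (2) $a$ is $\sigma^2$-sub-Gaussian; (3) $a$ is isotropic. Then there exists a numerical constant $c<\infty$, and constants $\tilde c,\hat c$ depending only on $\sigma$, such that the following is true. Whenever $$\frac{c}{p_0^2}\le\frac{m}{d}\le d,$$ and the Polyak subgradient method for $f_S$ is initialized at a point $x_0$ satisfying $$\min\left\{\frac{\|x_0-\bar x\|}{\|\bar x\|},\frac{\|x_0+\bar x\|}{\|\bar x\|}\right\}\le\frac{\kappa_{\mathrm{st}}^*p_0}{16\sigma^2},$$ then with probability at least $$1-6\exp\left(-m\cdot\min\left\{\tfrac{p_0^2}{32},c^{-1},\tilde c\right\}\right)$$ the produced iterates $\{x_k\}$ converge to $\{\pm\bar x\}$ at the linear rate $$\mathrm{dist}^2(x_{k+1};\bar x)\le\left(1-\left(\frac{p_0\kappa_{\mathrm{st}}^*}{\sqrt{32}\left(1+\hat c\left(\sqrt{\frac{p_0^2}{c}}+\frac{p_0^2}{c}\right)\right)\left(1+\frac{\kappa_{\mathrm{st}}^*p_0}{16\sigma^2}\right)}\right)^2\right)\mathrm{dist}^2(x_k;\bar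 x).$$
   Context: Notation: $\mathrm{dist}(x;\bar x):=\min\{\|x-\bar x\|,\|x+\bar x\|\}$, with $\|\cdot\|$ the Euclidean norm. A random vector $a\in\mathbb{R}^d$ is $\sigma^2$-sub-Gaussian if $\mathbb{E}[\exp(\langle a,v\rangle^2/\sigma^2)]\le e$ for all unit vectors $v$. It is isotropic if $\mathbb{E}[aa^T]=I_d$. Limiting subdifferential: the Fréchet subdifferential $\hat\partial f(x)$ of $f\colon\mathbb{R}^d\to\mathbb{R}$ is the set of $v$ with $f(y)\ge f(x)+\langle v,y-x\rangle+o(\|y-x\|)$ as $y\to x$; the limiting subdifferential $\partial f(x)$ is the set of limits of vectors $v_i\in\hat\partial f(x_i)$ with $x_i\to x$, $f(x_i)\to f(x)$. Polyak subgradient method for $f_S$: given $x_0$, at step $k\ge0$ choose any $\zeta_k\in\partial f_S(x_k)$; if $\zeta_k\ne0$ set $x_{k+1}=x_k-\frac{f_S(x_k)-\min f_S}{\|\zeta_k\|^2}\zeta_k$, and otherwise exit. (The rate inequality is asserted for every $k$ for which $x_{k+1}$ is generated.) *)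

theory Defs
  imports "HOL-Probability.Probability"
begin

text \<open>
  The constants of the theorem must not depend on the dimension d, so d has to be quantified
  inside the statement and cannot be a type. A vector of d-dimensional Euclidean space is an
  extensional function on the index set \<open>{..<d}\<close>; this makes the space equal to the carrier of
  the product Borel space over \<open>{..<d}\<close>.
\<close>

definition evec :: "nat \<Rightarrow> (nat \<Rightarrow> real) set" where
  "evec d = {..<d} \<rightarrow>\<^sub>E UNIV"

definition evec_borel :: "nat \<Rightarrow> (nat \<Rightarrow> real) measure" where
  "evec_borel d = PiM {..<d} (\<lambda>_. borel)"

definition evec_zero :: "nat \<Rightarrow> nat \<Rightarrow> real" where
  "evec_zero d = (\<lambda>i\<in>{..<d}. 0)"

definition evec_add :: "nat \<Rightarrow> (nat \<Rightarrow> real) \<Rightarrow> (nat \<Rightarrow> real) \<Rightarrow> nat \<Rightarrow> real" where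
  "evec_add d x y = (\<lambda>i\<in>{..<d}. x i + y i)"

definition evec_diff :: "nat \<Rightarrow> (nat \<Rightarrow> real) \<Rightarrow> (nat \<Rightarrow> real) \<Rightarrow> nat \<Rightarrow> real" where
  "evec_diff d x y = (\<lambda>i\<in>{..<d}. x i - y i)"

definition evec_scale :: "nat \<Rightarrow> real \<Rightarrow> (nat \<Rightarrow> real) \<Rightarrow> nat \<Rightarrow> real" where
  "evec_scale d t x = (\<lambda>i\<in>{..<d}. t * x i)"

definition evec_inner :: "nat \<Rightarrow> (nat \<Rightarrow> real) \<Rightarrow> (nat \<Rightarrow> real) \<Rightarrow> real" where
  "evec_inner d x y = (\<Sum>i<d. x i * y i)"

definition evec_norm :: "nat \<Rightarrow> (nat \<Rightarrow> real) \<Rightarrow> real" where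
  "evec_norm d x = L2_set x {..<d}"

definition evec_sphere :: "nat \<Rightarrow> (nat \<Rightarrow> real) set" where
  "evec_sphere d = {x \<in> evec d. evec_norm d x = 1}"

definition sign_dist :: "nat \<Rightarrow> (nat \<Rightarrow> real) \<Rightarrow> (nat \<Rightarrow> real) \<Rightarrow> real" where
  "sign_dist d x xbar = min (evec_norm d (evec_diff d x xbar)) (evec_norm d (evec_add d x xbar))"

text \<open>Random vectors enter through their law P, a probability measure on \<^term>\<open>evec_borel d\<close>.\<close>

definition vector_law :: "nat \<Rightarrow> (nat \<Rightarrow> real) measure \<Rightarrow> bool" where
  "vector_law d P \<longleftrightarrow> prob_space P \<and> sets P = sets (evec_borel d)"

text \<open>The nonnegative integral is used because the Bochner integral of a non-integrable
  function is 0, which would satisfy the bound vacuously.\<close>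

definition sub_gaussian :: "nat \<Rightarrow> real \<Rightarrow> (nat \<Rightarrow> real) measure \<Rightarrow> bool" where
  "sub_gaussian d \<sigma> P \<longleftrightarrow>
    (\<forall>v\<in>evec_sphere d. (\<integral>\<^sup>+a. ennreal (exp ((evec_inner d a v)\<^sup>2 / \<sigma>\<^sup>2)) \<partial>P) \<le> ennreal (exp 1))"

definition isotropic :: "nat \<Rightarrow> (nat \<Rightarrow> real) measure \<Rightarrow> bool" where
  "isotropic d P \<longleftrightarrow>
    (\<forall>i<d. \<forall>j<d. integrable P (\<lambda>a. a i * a j) \<and>
      (\<integral>a. a i * a j \<partial>P) = (if i = j then 1 else 0))"

text \<open>The \<open>\<epsilon>\<close>-\<open>\<delta>\<close> condition spells out
  \<open>f y \<ge> f x + \<langle>v, y - x\<rangle> + o(\<parallel>y - x\<parallel>)\<close> as y tends to x.\<close>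

definition frechet_subdiff ::
    "nat \<Rightarrow> ((nat \<Rightarrow> real) \<Rightarrow> real) \<Rightarrow> (nat \<Rightarrow> real) \<Rightarrow> (nat \<Rightarrow> real) set" where
  "frechet_subdiff d f x = {v \<in> evec d.
    \<forall>\<epsilon>>0. \<exists>\<delta>>0. \<forall>y\<in>evec d. evec_norm d (evec_diff d y x) < \<delta> \<longrightarrow>
      f y \<ge> f x + evec_inner d v (evec_diff d y x) - \<epsilon> * evec_norm d (evec_diff d y x)}"

definition limiting_subdiff ::
    "nat \<Rightarrow> ((nat \<Rightarrow> real) \<Rightarrow> real) \<Rightarrow> (nat \<Rightarrow> real) \<Rightarrow> (nat \<Rightarrow> real) set" where
  "limiting_subdiff d f x = {v \<in> evec d. \<exists>xs vs.
    (\<forall>n. xs n \<in> evec d \<and> vs n \<in> frechet_subdiff d f (xs n)) \<and>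
    (\<lambda>n. evec_norm d (evec_diff d (xs n) x)) \<longlonglongrightarrow> 0 \<and>
    (\<lambda>n. f (xs n)) \<longlonglongrightarrow> f x \<and>
    (\<lambda>n. evec_norm d (evec_diff d (vs n) v)) \<longlonglongrightarrow> 0}"

text \<open>
  \<open>polyak_iterates d f x0 N x\<close>: the points \<open>x k\<close> with \<open>k \<le> N\<close> are generated by the Polyak
  subgradient method for f from x0, for some choice of subgradients. The number N of steps
  performed so far is finite or infinite; values of x beyond N are irrelevant. A zero
  subgradient makes the method exit, so every performed step has a nonzero one.
\<close>

definition polyak_iterates ::
    "nat \<Rightarrow> ((nat \<Rightarrow> real) \<Rightarrow> real) \<Rightarrow> (nat \<Rightarrow> real) \<Rightarrow> enat \<Rightarrow> (nat \<Rightarrow> nat \<Rightarrow> real) \<Rightarrow> bool" where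
  "polyak_iterates d f x0 N x \<longleftrightarrow> x 0 = x0 \<and>
    (\<forall>k. enat k < N \<longrightarrow> (\<exists>\<zeta>\<in>limiting_subdiff d f (x k). \<zeta> \<noteq> evec_zero d \<and>
      x (Suc k) = evec_diff d (x k)
        (evec_scale d ((f (x k) - (INF y\<in>evec d. f y)) / (evec_norm d \<zeta>)\<^sup>2) \<zeta>)))"

definition phase_loss ::
    "nat \<Rightarrow> nat \<Rightarrow> (nat \<Rightarrow> nat \<Rightarrow> real) \<Rightarrow> (nat \<Rightarrow> real) \<Rightarrow> (nat \<Rightarrow> real) \<Rightarrow> real" where
  "phase_loss d m a b x = 1 / real m * (\<Sum>i<m. \<bar>(evec_inner d (a i) x)\<^sup>2 - b i\<bar>)"

end

theory Submission
  imports Defs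
begin

text \<open>
  Since \<open>|s\<^sup>2 - t\<^sup>2| = |s - t| |s + t|\<close>, the loss at x is the empirical mean of
  \<open>|\<langle>a, x - xbar\<rangle> \<langle>a, x + xbar\<rangle>|\<close>. If this mean dominates
  \<open>(3/8) \<kappa> p0 \<parallel>u\<parallel> \<parallel>v\<parallel>\<close> for all u, v (sharpness) and the empirical second moment matrix has
  largest eigenvalue at most \<open>2 \<sigma>\<^sup>2\<close> (weak convexity) and at most \<open>1 + O(\<sigma>\<^sup>2 p0)\<close> (subgradient bound),
  one Polyak step contracts the distance to the nearer of \<open>\<plusminus>xbar\<close> by the asserted factor.
  Isotropy forces \<open>\<sigma> \<ge> 1\<close> and \<open>\<kappa> p0 \<le> 1\<close>, so the initial relative error is at most 1/16 and never grows.

  The second moment bounds follow from exponential moments and a net of the ball made of lattice points.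
  Sharpness must hold once \<open>m \<ge> c d / p0\<^sup>2\<close> with c independent of \<open>\<sigma>\<close> and \<open>\<kappa>\<close>, which excludes
  nets for u and v. It suffices that, simultaneously for all u and v, at least \<open>p0 m / 2\<close> sample points
  satisfy \<open>|\<langle>a, u\<rangle> \<langle>a, v\<rangle>| \<ge> (3/4) \<kappa> \<parallel>u\<parallel> \<parallel>v\<parallel>\<close>. A ghost sample and random exchanges reduce this to
  counting the sets of sample points picked out by such inequalities, up to a small
  symmetric difference. This count is bounded by linear algebra: choose for each pair (u, v) a threshold with
  few sample points in its vicinity, normalize it to 1, and consider for a set S the polynomial
  \<open>\<Prod>j\<in>S. (\<langle>a\<^sub>j, u\<rangle> \<langle>a\<^sub>j, v\<rangle>)^M\<close>. At a pair which picks out T it is much smaller than the polynomial of T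
  whenever S and T differ substantially, so separated sets give linearly independent polynomials, and their
  number is at most the dimension of the space of polynomials of that degree.
\<close>

section \<open>Counting approximate sign patterns\<close>

text \<open>A net for (u, v) would need a radius at which the product <a, u> <a, v> is stable at
  scale \<kappa>, so its cardinality would carry both \<sigma> and \<kappa> into c. A count of
  patterns does not see the distribution at all.

  Write r = m / d. The exponent M is about 2 r, so the polynomials have degree of order r m in d
  variables, and the logarithm of the dimension is O(d log r). This is relaxed to 5 d sqrt r and
  doubled because there are two vectors. The exchange argument gains exp(- p0 m / 160), and p0 m =
  (p0 sqrt r) (d sqrt r) is at least 10^4 d sqrt r exactly when r is at least 10^8 / p0^2. This is
  where the square of p0 and the constant c come from. The exchange step must therefore have an
  exponent linear in p0: one of order p0^2 m would not beat the bound on the count.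

  The same condition serves diagonal dominance. The gap around the threshold has relative width of
  order p0 and the separation is of order p0 m, so the off-diagonal entries are at most exp(- r p0^2
  m / 3280), which is far below the inverse of the squared dimension.\<close>

lemma homogeneous_system_nontrivial:
  fixes A :: "'i \<Rightarrow> 'j \<Rightarrow> real"
  assumes "finite J" "finite I" "card J < card I"
  shows "\<exists>w. (\<exists>i\<in>I. w i \<noteq> 0) \<and> (\<forall>j\<in>J. (\<Sum>i\<in>I. w i * A i j) = 0)"
  using assms
proof (induction J arbitrary: I A rule: finite_induct)
  case empty
  then have "I \<noteq> {}" by auto
  then show ?case by (intro exI[of _ "\<lambda>_. 1"]) auto
next
  case (insert j J)
  show ?case
  proof (cases "\<forall>i\<in>I. A i j = 0")
    case True
    have "card J < card I" using insert by simp
    from insert.IH[OF insert.prems(1) this, of A] True show ?thesis by auto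
  next
    case False
    \<comment> \<open>Gaussian elimination: equation \<open>j\<close> is solved for the unknown at
      the pivot \<open>p\<close>, and the induction hypothesis is applied to the other equations
      with that unknown substituted.\<close>
    then obtain p where p: "p \<in> I" "A p j \<noteq> 0" by auto
    let ?I = "I - {p}"
    have "card J < card ?I" using insert p by simp
    from insert.IH[OF _ this, of "\<lambda>i k. A i k - A i j / A p j * A p k"] insert.prems(1)
    obtain w where w: "\<exists>i\<in>?I. w i \<noteq> 0"
      "\<forall>k\<in>J. (\<Sum>i\<in>?I. w i * (A i k - A i j / A p j * A p k)) = 0" by auto
    define s where "s = (\<Sum>i\<in>?I. w i * A i j / A p j)"
    define w' where "w' = w(p := - s)"
    have split: "(\<Sum>i\<in>I. w' i * A i k) = (\<Sum>i\<in>?I. w i * A i k) - s * A p k" for k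
      using insert.prems(1) p(1) by (subst sum.remove[of _ p]) (auto simp: w'_def intro!: sum.cong)
    have "(\<Sum>i\<in>I. w' i * A i k) = 0" if "k \<in> insert j J" for k
    proof (cases "k = j")
      case True
      then show ?thesis unfolding split s_def using p(2)
        by (simp add: sum_distrib_right)
    next
      case False
      with that w(2) have "(\<Sum>i\<in>?I. w i * (A i k - A i j / A p j * A p k)) = 0" by auto
      moreover have "s * A p k = (\<Sum>i\<in>?I. w i * (A i j / A p j * A p k))"
        unfolding s_def by (simp add: sum_distrib_right mult.assoc)
      ultimately show ?thesis unfolding split
        by (simp only: right_diff_distrib sum_subtractf)
    qed
    moreover have "\<exists>i\<in>I. w' i \<noteq> 0" using w(1) unfolding w'_def by auto
    ultimately show ?thesis by blast
  qed
qed

text \<open>The product matrix has rank at most \<open>card J\<close>, whereas one row more would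
  make it strictly diagonally dominant, hence nonsingular. Dominance is tested at the column
  belonging to the largest coefficient of a linear relation between the rows.\<close>

lemma card_le_of_dominant_factorization:
  fixes A :: "'i \<Rightarrow> 'j \<Rightarrow> real"
  assumes fin: "finite I" "finite J"
    and diag: "\<And>k. k \<in> I \<Longrightarrow> (\<Sum>j\<in>J. A k j * B j k) = 1"
    and off: "\<And>i k. i \<in> I \<Longrightarrow> k \<in> I \<Longrightarrow> i \<noteq> k \<Longrightarrow> \<bar>\<Sum>j\<in>J. A i j * B j k\<bar> \<le> \<delta>"
    and small: "real (card J) * \<delta> < 1"
  shows "card I \<le> card J"
proof (rule ccontr)
  assume "\<not> card I \<le> card J"
  \<comment> \<open>One index more than \<open>card J\<close> already forces a relation, and then
    each column has just \<open>card J\<close> off-diagonal entries. Hence \<open>small\<close>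
    involves \<open>card J\<close> and not the unknown \<open>card I\<close>.\<close>
  then obtain I' where I': "I' \<subseteq> I" "card I' = Suc (card J)"
    by (metis Suc_leI not_le obtain_subset_with_card_n)
  then have finI': "finite I'" using fin finite_subset by blast
  from homogeneous_system_nontrivial[OF fin(2) finI', of A] I' obtain w where
    w: "\<exists>i\<in>I'. w i \<noteq> 0" "\<forall>j\<in>J. (\<Sum>i\<in>I'. w i * A i j) = 0" by auto
  have ne: "I' \<noteq> {}" using w by auto
  have "Max ((\<lambda>i. \<bar>w i\<bar>) ` I') \<in> (\<lambda>i. \<bar>w i\<bar>) ` I'" using finI' ne by (intro Max_in) auto
  then obtain k where k: "k \<in> I'" "\<bar>w k\<bar> = Max ((\<lambda>i. \<bar>w i\<bar>) ` I')" by auto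
  have max: "\<bar>w i\<bar> \<le> \<bar>w k\<bar>" if "i \<in> I'" for i
    unfolding k(2) using that finI' by (intro Max_ge) auto
  have pos: "\<bar>w k\<bar> > 0" using w(1) max by fastforce
  let ?N = "\<lambda>i. \<Sum>j\<in>J. A i j * B j k"
  have "(\<Sum>i\<in>I'. w i * ?N i) = (\<Sum>j\<in>J. (\<Sum>i\<in>I'. w i * A i j) * B j k)"
    by (simp add: sum_distrib_left sum_distrib_right mult.assoc) (rule sum.swap)
  also have "\<dots> = 0" using w(2) by simp
  finally have "w k * ?N k + (\<Sum>i\<in>I'-{k}. w i * ?N i) = 0"
    using sum.remove[OF finI' k(1)] by metis
  then have eq: "w k = - (\<Sum>i\<in>I'-{k}. w i * ?N i)" using diag k I' by auto
  have "\<bar>w k\<bar> \<le> (\<Sum>i\<in>I'-{k}. \<bar>w i * ?N i\<bar>)"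
    unfolding eq by (simp add: sum_abs)
  also have "\<dots> \<le> (\<Sum>i\<in>I'-{k}. \<bar>w k\<bar> * \<delta>)"
  proof (intro sum_mono)
    fix i assume "i \<in> I' - {k}"
    then show "\<bar>w i * ?N i\<bar> \<le> \<bar>w k\<bar> * \<delta>"
      unfolding abs_mult using max off[of i k] I' k by (intro mult_mono) auto
  qed
  also have "\<dots> = \<bar>w k\<bar> * (real (card J) * \<delta>)" using I' k finI' by simp
  also have "\<dots> < \<bar>w k\<bar> * 1" using pos small by (intro mult_strict_left_mono) auto
  finally show False by simp
qed

section \<open>Polynomials of bounded degree and the number of their monomials\<close>

definition exponents :: "nat \<Rightarrow> nat \<Rightarrow> (nat \<Rightarrow> nat) set" where
  "exponents d D = {e. (\<forall>i\<ge>d. e i = 0) \<and> (\<Sum>i<d. e i) \<le> D}"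

text \<open>A polynomial is kept as a function with some coefficient family, since only the number
  of available monomials is ever used.\<close>

definition is_poly :: "nat \<Rightarrow> nat \<Rightarrow> ((nat \<Rightarrow> real) \<Rightarrow> real) \<Rightarrow> bool" where
  "is_poly d D f \<longleftrightarrow> (\<exists>c. \<forall>u. f u = (\<Sum>e\<in>exponents d D. c e * (\<Prod>i<d. u i ^ e i)))"

lemma restrict_exponents:
  "inj_on (\<lambda>e. restrict e {..<d}) (exponents d D)"
  "(\<lambda>e. restrict e {..<d}) ` exponents d D \<subseteq> {..<d} \<rightarrow>\<^sub>E {..D}"
proof -
  show "inj_on (\<lambda>e. restrict e {..<d}) (exponents d D)"
  proof (rule inj_onI, rule ext)
    fix e e' i assume e: "e \<in> exponents d D" "e' \<in> exponents d D"
      and eq: "restrict e {..<d} = restrict e' {..<d}"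
    have "i < d \<Longrightarrow> e i = e' i" using fun_cong[OF eq, of i] by simp
    then show "e i = e' i" using e by (cases "i < d") (auto simp: exponents_def)
  qed
  show "(\<lambda>e. restrict e {..<d}) ` exponents d D \<subseteq> {..<d} \<rightarrow>\<^sub>E {..D}"
  proof (rule image_subsetI)
    fix e assume e: "e \<in> exponents d D"
    have "e i \<le> D" if i: "i < d" for i
    proof -
      have "e i \<le> (\<Sum>i<d. e i)" using i by (intro member_le_sum) auto
      also have "\<dots> \<le> D" using e by (simp add: exponents_def)
      finally show ?thesis .
    qed
    then show "restrict e {..<d} \<in> {..<d} \<rightarrow>\<^sub>E {..D}" by auto
  qed
qed

lemma finite_exponents [simp]: "finite (exponents d D)"
  using restrict_exponents[of d D] by (meson finite_PiE finite_atMost finite_imageD finite_lessThan finite_subset)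

text \<open>Generating function bound: every exponent vector has weight at least q^D, and the total
  weight factorizes into d geometric series, so the count is at most q^(-D) (1 - q)^(-d). The choice
  q = D / (D + d) minimizes this, and (1 + d / D)^D is at most e^d. For D = 0 this q degenerates,
  hence the case split.\<close>

lemma card_exponents_le:
  assumes "d > 0"
  shows "real (card (exponents d D)) \<le> (exp 1 * (1 + real D / real d)) ^ d"
proof (cases "D = 0")
  case True
  have "exponents d D \<subseteq> {\<lambda>_. 0}"
  proof
    fix e assume "e \<in> exponents d D"
    then have "e i = 0" for i using True by (cases "i < d") (auto simp: exponents_def)
    then show "e \<in> {\<lambda>_. 0}" by auto
  qed
  then have "card (exponents d D) \<le> card {\<lambda>_::nat. 0::nat}" by (intro card_mono) auto
  then have "real (card (exponents d D)) \<le> 1" by simp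
  also have "1 \<le> exp (1::real) ^ d" by (intro one_le_power) simp
  finally show ?thesis using True by simp
next
  case False
  define q where "q = real D / (real D + real d)"
  have q: "0 < q" "q < 1" using False assms by (auto simp: q_def)
  have inv: "1 / (1 - q) = 1 + real D / real d" using assms by (simp add: q_def field_simps)
  have "real (card (exponents d D)) * q ^ D = (\<Sum>e\<in>exponents d D. q ^ D)" by simp
  also have "\<dots> \<le> (\<Sum>e\<in>exponents d D. \<Prod>i<d. q ^ e i)"
  proof (rule sum_mono)
    fix e assume "e \<in> exponents d D"
    then have "(\<Sum>i<d. e i) \<le> D" by (simp add: exponents_def)
    then show "q ^ D \<le> (\<Prod>i<d. q ^ e i)" using q by (simp flip: power_sum add: power_decreasing)
  qed
  also have "\<dots> = (\<Sum>e\<in>(\<lambda>e. restrict e {..<d}) ` exponents d D. \<Prod>i<d. q ^ e i)"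
    by (subst sum.reindex[OF restrict_exponents(1)]) simp
  also have "\<dots> \<le> (\<Sum>e\<in>{..<d} \<rightarrow>\<^sub>E {..D}. \<Prod>i<d. q ^ e i)"
    using q by (intro sum_mono2 restrict_exponents(2) finite_PiE prod_nonneg) auto
  also have "\<dots> = (\<Prod>i<d. \<Sum>k\<le>D. q ^ k)"
    using prod_sum_PiE[of "{..<d}" "\<lambda>_. {..D}" "\<lambda>_ k. q ^ k"] by simp
  also have "\<dots> = (\<Sum>k\<le>D. q ^ k) ^ d" by simp
  also have "\<dots> \<le> (1 / (1 - q)) ^ d"
  proof (intro power_mono sum_nonneg)
    have "(\<Sum>k\<le>D. q ^ k) = (1 - q ^ Suc D) / (1 - q)" using q by (subst sum_gp0) auto
    also have "\<dots> \<le> 1 / (1 - q)" using q by (intro divide_right_mono) auto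
    finally show "(\<Sum>k\<le>D. q ^ k) \<le> 1 / (1 - q)" .
  qed (use q in auto)
  finally have "real (card (exponents d D)) * q ^ D \<le> (1 + real D / real d) ^ d" unfolding inv .
  then have "real (card (exponents d D)) \<le> (1 + real D / real d) ^ d * (1 / q) ^ D"
    using q by (simp add: field_simps)
  also have "\<dots> \<le> (1 + real D / real d) ^ d * exp 1 ^ d"
  proof (rule mult_left_mono)
    have "1 / q = 1 + real d / real D" using False assms by (simp add: q_def field_simps)
    then have "(1 / q) ^ D \<le> exp (real d / real D) ^ D"
      using q by (intro power_mono) auto
    also have "\<dots> = exp 1 ^ d" using False by (simp flip: exp_of_nat_mult)
    finally show "(1 / q) ^ D \<le> exp 1 ^ d" .
  qed simp
  finally show ?thesis by (simp add: power_mult_distrib mult.commute)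
qed

lemma is_poly_one: "is_poly d D (\<lambda>_. 1)"
  unfolding is_poly_def
proof (intro exI allI)
  fix u :: "nat \<Rightarrow> real"
  have z: "(\<lambda>_. 0) \<in> exponents d D" by (simp add: exponents_def)
  have "(\<Sum>e\<in>exponents d D. (if e = (\<lambda>_. 0) then 1 else 0) * (\<Prod>i<d. u i ^ e i))
     = (\<Sum>e\<in>exponents d D. if e = (\<lambda>_. 0) then 1 else 0)" by (intro sum.cong) auto
  also have "\<dots> = 1" using z by (subst sum.delta) auto
  finally show "1 = (\<Sum>e\<in>exponents d D. (if e = (\<lambda>_. 0) then 1 else 0) * (\<Prod>i<d. u i ^ e i))" by simp
qed

lemma is_poly_mult_coord:
  assumes "is_poly d D f" "k < d"
  shows "is_poly d (Suc D) (\<lambda>u. f u * u k)"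
proof -
  from assms obtain c where c: "\<And>u. f u = (\<Sum>e\<in>exponents d D. c e * (\<Prod>i<d. u i ^ e i))"
    unfolding is_poly_def by blast
  \<comment> \<open>Multiplication by \<open>u k\<close> raises the exponent at \<open>k\<close>.
    This map is injective, so the new coefficients are the old ones read through its
    inverse.\<close>
  define up where "up = (\<lambda>e::nat \<Rightarrow> nat. e(k := Suc (e k)))"
  have inj: "inj_on up X" for X
    by (rule inj_onI) (auto simp: up_def fun_eq_iff split: if_splits)
  have sum_up: "(\<Sum>i<d. up e i) = Suc (\<Sum>i<d. e i)" for e
    using assms(2) by (simp add: up_def sum.remove[of "{..<d}" k])
  have sub: "up ` exponents d D \<subseteq> exponents d (Suc D)"
    using sum_up assms(2) by (auto simp: exponents_def) (simp add: up_def)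
  have prod_up: "(\<Prod>i<d. u i ^ up e i) = (\<Prod>i<d. u i ^ e i) * u k" for e and u :: "nat \<Rightarrow> real"
    using assms(2) by (simp add: up_def prod.remove[of "{..<d}" k])
  define c' where "c' = (\<lambda>e. if e \<in> up ` exponents d D then c (the_inv_into (exponents d D) up e) else 0)"
  show ?thesis unfolding is_poly_def
  proof (intro exI allI)
    fix u
    have "(\<Sum>e\<in>exponents d (Suc D). c' e * (\<Prod>i<d. u i ^ e i)) =
        (\<Sum>e\<in>up ` exponents d D. c' e * (\<Prod>i<d. u i ^ e i))"
      using sub by (intro sum.mono_neutral_right) (auto simp: c'_def)
    also have "\<dots> = (\<Sum>e\<in>exponents d D. c e * (\<Prod>i<d. u i ^ e i) * u k)"
      by (subst sum.reindex[OF inj]) (auto simp: c'_def prod_up the_inv_into_f_f[OF inj] intro!: sum.cong)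
    also have "\<dots> = f u * u k" by (simp add: c sum_distrib_right)
    finally show "f u * u k = (\<Sum>e\<in>exponents d (Suc D). c' e * (\<Prod>i<d. u i ^ e i))" by simp
  qed
qed

lemma is_poly_sum:
  assumes "finite K" "\<And>k. k \<in> K \<Longrightarrow> is_poly d D (f k)"
  shows "is_poly d D (\<lambda>u. \<Sum>k\<in>K. f k u)"
proof -
  have "\<forall>k\<in>K. \<exists>c. \<forall>u. f k u = (\<Sum>e\<in>exponents d D. c e * (\<Prod>i<d. u i ^ e i))"
    using assms(2) unfolding is_poly_def by blast
  then obtain c where c: "\<forall>k\<in>K. \<forall>u. f k u = (\<Sum>e\<in>exponents d D. c k e * (\<Prod>i<d. u i ^ e i))"
    by metis
  show ?thesis unfolding is_poly_def
  proof (intro exI allI)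
    fix u
    have "(\<Sum>k\<in>K. f k u) = (\<Sum>k\<in>K. \<Sum>e\<in>exponents d D. c k e * (\<Prod>i<d. u i ^ e i))"
      using c by (intro sum.cong) auto
    also have "\<dots> = (\<Sum>e\<in>exponents d D. (\<Sum>k\<in>K. c k e) * (\<Prod>i<d. u i ^ e i))"
      by (subst sum.swap) (simp add: sum_distrib_right)
    finally show "(\<Sum>k\<in>K. f k u) = (\<Sum>e\<in>exponents d D. (\<Sum>k\<in>K. c k e) * (\<Prod>i<d. u i ^ e i))" .
  qed
qed

lemma is_poly_scale:
  assumes "is_poly d D f"
  shows "is_poly d D (\<lambda>u. t * f u)"
proof -
  from assms obtain c where c: "\<And>u. f u = (\<Sum>e\<in>exponents d D. c e * (\<Prod>i<d. u i ^ e i))"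
    unfolding is_poly_def by blast
  then show ?thesis unfolding is_poly_def
    by (intro exI[of _ "\<lambda>e. t * c e"]) (simp add: sum_distrib_left mult.assoc)
qed

lemma is_poly_mult_inner:
  assumes "is_poly d D f"
  shows "is_poly d (Suc D) (\<lambda>u. f u * evec_inner d b u)"
proof -
  have "is_poly d (Suc D) (\<lambda>u. \<Sum>k\<in>{..<d}. b k * (f u * u k))"
    by (intro is_poly_sum is_poly_scale is_poly_mult_coord assms) auto
  then show ?thesis by (simp add: evec_inner_def sum_distrib_left mult_ac)
qed

lemma is_poly_mono:
  assumes "is_poly d D f" "D \<le> D'"
  shows "is_poly d D' f"
proof -
  from assms obtain c where c: "\<And>u. f u = (\<Sum>e\<in>exponents d D. c e * (\<Prod>i<d. u i ^ e i))"
    unfolding is_poly_def by blast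
  have sub: "exponents d D \<subseteq> exponents d D'" using assms(2) by (auto simp: exponents_def)
  show ?thesis unfolding is_poly_def
  proof (intro exI allI)
    fix u
    have "(\<Sum>e\<in>exponents d D'. (if e \<in> exponents d D then c e else 0) * (\<Prod>i<d. u i ^ e i)) =
        (\<Sum>e\<in>exponents d D. (if e \<in> exponents d D then c e else 0) * (\<Prod>i<d. u i ^ e i))"
      using sub by (intro sum.mono_neutral_right) auto
    then show "f u = (\<Sum>e\<in>exponents d D'. (if e \<in> exponents d D then c e else 0) * (\<Prod>i<d. u i ^ e i))"
      using c by simp
  qed
qed

lemma is_poly_mult_inner_power:
  assumes "is_poly d D f"
  shows "is_poly d (D + M) (\<lambda>u. f u * evec_inner d b u ^ M)"
proof (induction M)
  case 0
  then show ?case using assms by simp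
next
  case (Suc M)
  from is_poly_mult_inner[OF Suc, of b] show ?case by (simp add: mult_ac)
qed

lemma is_poly_prod_inner_power:
  assumes "finite S"
  shows "is_poly d (M * card S) (\<lambda>u. \<Prod>j\<in>S. evec_inner d (b j) u ^ M)"
  using assms
proof induction
  case empty
  then show ?case by (simp add: is_poly_one)
next
  case (insert j S)
  from is_poly_mult_inner_power[OF insert.IH, of M "b j"] insert show ?case
    by (simp add: mult.commute add.commute)
qed

text \<open>Greedy packing: a set is either more than \<open>h\<close> away from all members chosen
  so far and joins them, or it is already covered.\<close>

lemma maximal_separated_subfamily:
  fixes P :: "'a set set" and h :: real
  assumes "finite P" "h \<ge> 0"
  shows "\<exists>F\<subseteq>P. (\<forall>S\<in>F. \<forall>T\<in>F. S \<noteq> T \<longrightarrow> real (card ((S - T) \<union> (T - S))) > h) \<and>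
    (\<forall>S\<in>P. \<exists>T\<in>F. real (card ((S - T) \<union> (T - S))) \<le> h)"
  using assms(1)
proof induction
  case empty
  then show ?case by auto
next
  case (insert S P)
  then obtain F where F: "F \<subseteq> P" "\<forall>S\<in>F. \<forall>T\<in>F. S \<noteq> T \<longrightarrow> real (card ((S - T) \<union> (T - S))) > h"
    "\<forall>S\<in>P. \<exists>T\<in>F. real (card ((S - T) \<union> (T - S))) \<le> h" by auto
  show ?case
  proof (cases "\<exists>T\<in>F. real (card ((S - T) \<union> (T - S))) \<le> h")
    case True
    then show ?thesis using F by (intro exI[of _ F]) auto
  next
    case False
    then have sep: "real (card (sym_diff S T)) > h" "real (card (sym_diff T S)) > h" if "T \<in> F" for T
      using that by (auto simp: Un_commute not_le)
    show ?thesis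
    proof (intro exI[of _ "insert S F"] conjI ballI)
      fix U assume "U \<in> insert S P"
      then show "\<exists>T\<in>insert S F. real (card (sym_diff U T)) \<le> h" using F(3) assms(2) by auto
    qed (use F(1,2) sep in auto)
  qed
qed

text \<open>This replaces Warren's bound for sign patterns. The gap around 1 is small, but raised to the power
  \<open>M\<close> and multiplied over the \<open>h / 2\<close> indices outside the gap it makes the matrix of the products,
  evaluated at the representatives, diagonally dominant.\<close>

lemma card_separated_patterns_le:
  fixes b :: "'j \<Rightarrow> nat \<Rightarrow> real" and u v :: "'j set \<Rightarrow> nat \<Rightarrow> real" and h \<gamma> :: real and d :: nat
  defines "p \<equiv> \<lambda>T j. \<bar>evec_inner d (b j) (u T) * evec_inner d (b j) (v T)\<bar>"
  assumes fin: "finite J" "finite F" and M: "even M" and \<gamma>: "0 < \<gamma>" "\<gamma> < 1"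
    and pat: "\<And>T. T \<in> F \<Longrightarrow> T = {j \<in> J. p T j \<ge> 1}"
    and gap: "\<And>T. T \<in> F \<Longrightarrow> real (card {j \<in> J. \<gamma> < p T j \<and> p T j < 1 / \<gamma>}) \<le> h / 2"
    and sep: "\<And>S T. S \<in> F \<Longrightarrow> T \<in> F \<Longrightarrow> S \<noteq> T \<Longrightarrow> real (card ((S - T) \<union> (T - S))) > h"
    and small: "(real (card (exponents d (M * card J))))\<^sup>2 * \<gamma> powr (real M * h / 2) < 1"
  shows "card F \<le> (card (exponents d (M * card J)))\<^sup>2"
proof -
  let ?E = "exponents d (M * card J)"
  define G where "G = (\<lambda>S T. \<Prod>j\<in>S. p T j ^ M)"
  have inT: "j \<in> T \<longleftrightarrow> j \<in> J \<and> p T j \<ge> 1" if "T \<in> F" for T j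
    using arg_cong[OF pat[OF that], of "\<lambda>X. j \<in> X"] by simp
  have FJ: "S \<subseteq> J" "finite S" if "S \<in> F" for S
  proof -
    show "S \<subseteq> J" using inT[OF that] by auto
    then show "finite S" using fin(1) finite_subset by blast
  qed
  have "\<exists>c. \<forall>w. (\<Prod>j\<in>S. evec_inner d (b j) w ^ M) = (\<Sum>e\<in>?E. c e * (\<Prod>i<d. w i ^ e i))"
    if S: "S \<in> F" for S
  proof -
    have "is_poly d (M * card S) (\<lambda>w. \<Prod>j\<in>S. evec_inner d (b j) w ^ M)"
      by (intro is_poly_prod_inner_power FJ[OF S])
    then have "is_poly d (M * card J) (\<lambda>w. \<Prod>j\<in>S. evec_inner d (b j) w ^ M)"
      by (rule is_poly_mono) (intro mult_le_mono2 card_mono fin(1) FJ[OF S])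
    then show ?thesis unfolding is_poly_def .
  qed
  then obtain c where c: "\<And>S w. S \<in> F \<Longrightarrow>
      (\<Prod>j\<in>S. evec_inner d (b j) w ^ M) = (\<Sum>e\<in>?E. c S e * (\<Prod>i<d. w i ^ e i))"
    by metis
  \<comment> \<open>The polynomial of \<open>S\<close> at the pair of \<open>T\<close> is a product
    of one polynomial in \<open>u T\<close> and one in \<open>v T\<close>. Expanding both factors
    the matrix through pairs of monomials; dividing by \<open>G T T\<close> puts ones on the
    diagonal.\<close>
  define A where "A = (\<lambda>S (e, e'). c S e * c S e')"
  define B where "B = (\<lambda>(e, e') T. (\<Prod>i<d. u T i ^ e i) * (\<Prod>i<d. v T i ^ e' i) / G T T)"
  have AB: "(\<Sum>j\<in>?E \<times> ?E. A S j * B j T) = G S T / G T T" if S: "S \<in> F" for S T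
  proof -
    have "G S T = (\<Prod>j\<in>S. evec_inner d (b j) (u T) ^ M * evec_inner d (b j) (v T) ^ M)"
      using M by (simp add: G_def p_def power_even_abs power_mult_distrib)
    also have "\<dots> = (\<Sum>e\<in>?E. c S e * (\<Prod>i<d. u T i ^ e i)) * (\<Sum>e\<in>?E. c S e * (\<Prod>i<d. v T i ^ e i))"
      by (simp add: prod.distrib c[OF S])
    also have "\<dots> = (\<Sum>(e, e')\<in>?E \<times> ?E. (c S e * (\<Prod>i<d. u T i ^ e i)) * (c S e' * (\<Prod>i<d. v T i ^ e' i)))"
      by (simp add: sum_product sum.cartesian_product)
    finally have "G S T / G T T =
       (\<Sum>(e, e')\<in>?E \<times> ?E. (c S e * (\<Prod>i<d. u T i ^ e i)) * (c S e' * (\<Prod>i<d. v T i ^ e' i)) / G T T)"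
      by (simp add: sum_divide_distrib case_prod_unfold)
    also have "\<dots> = (\<Sum>j\<in>?E \<times> ?E. A S j * B j T)"
      by (intro sum.cong) (auto simp: A_def B_def)
    finally show ?thesis by simp
  qed
  have Gpos: "G T T > 0" if "T \<in> F" for T
    unfolding G_def using inT[OF that] by (intro prod_pos zero_less_power) force
  have p0: "p T j \<ge> 0" for T j by (simp add: p_def)
  have ratio: "\<bar>G S T / G T T\<bar> \<le> \<gamma> powr (real M * h / 2)" if ST: "S \<in> F" "T \<in> F" "S \<noteq> T" for S T
  proof -
    define D where "D = (S - T) \<union> (T - S)"
    define C where "C = {j \<in> J. \<gamma> < p T j \<and> p T j < 1 / \<gamma>}"
    \<comment> \<open>The common indices cancel from the quotient. Indices in \<open>S - T\<close>
      contribute a factor below 1, those in \<open>T - S\<close> the inverse of a factor at least 1;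
      so all of \<open>D\<close> helps, and outside the gap \<open>C\<close> each index contributes
      at most \<open>\<gamma> ^ M\<close>.\<close>
    define g where "g = (\<lambda>j. if j \<in> T then 1 / p T j else p T j)"
    have finD: "finite D" using FJ ST by (auto simp: D_def)
    have "G S T = (\<Prod>j\<in>S - T. p T j ^ M) * (\<Prod>j\<in>S \<inter> T. p T j ^ M)"
      unfolding G_def using FJ[OF ST(1)] by (subst prod.Int_Diff[of _ _ T]) (auto simp: mult.commute)
    moreover have "G T T = (\<Prod>j\<in>T - S. p T j ^ M) * (\<Prod>j\<in>S \<inter> T. p T j ^ M)"
      unfolding G_def using FJ[OF ST(2)] by (subst prod.Int_Diff[of _ _ S]) (auto simp: mult.commute Int_commute)
    moreover have "(\<Prod>j\<in>S \<inter> T. p T j ^ M) \<noteq> 0"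
      using Gpos[OF ST(2)] calculation(2) by auto
    ultimately have "G S T / G T T = (\<Prod>j\<in>S - T. p T j ^ M) / (\<Prod>j\<in>T - S. p T j ^ M)"
      by simp
    also have "\<dots> = (\<Prod>j\<in>S - T. g j ^ M) * (\<Prod>j\<in>T - S. g j ^ M)"
      by (simp add: g_def power_divide prod_dividef)
    also have "\<dots> = (\<Prod>j\<in>D. g j ^ M)"
      unfolding D_def using FJ ST by (intro prod.union_disjoint[symmetric]) auto
    also have "\<dots> = (\<Prod>j\<in>D - C. g j ^ M) * (\<Prod>j\<in>D \<inter> C. g j ^ M)"
      using finD by (subst prod.Int_Diff[of _ _ C]) (auto simp: mult.commute)
    finally have eq: "G S T / G T T = (\<Prod>j\<in>D - C. g j ^ M) * (\<Prod>j\<in>D \<inter> C. g j ^ M)" .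
    have g0: "0 \<le> g j" for j using p0 by (auto simp: g_def)
    have g1: "g j \<le> 1" if "j \<in> D" for j
    proof (cases "j \<in> T")
      case True
      then have "p T j \<ge> 1" using inT[OF ST(2)] by auto
      then show ?thesis using True by (simp add: g_def)
    next
      case False
      then have "j \<in> J" using that FJ(1)[OF ST(1)] by (auto simp: D_def)
      then have "p T j < 1" using inT[OF ST(2)] False by force
      then show ?thesis using False by (simp add: g_def)
    qed
    have g2: "g j \<le> \<gamma>" if "j \<in> D - C" for j
    proof (cases "j \<in> T")
      case True
      then have j: "p T j \<ge> 1" "j \<in> J" using inT[OF ST(2)] by auto
      then have "p T j \<ge> 1 / \<gamma>" using that \<gamma> by (force simp: C_def)
      then show ?thesis using True \<gamma> j by (simp add: g_def field_simps)
    next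
      case False
      then have j: "j \<in> J" using that FJ(1)[OF ST(1)] by (auto simp: D_def)
      then have "p T j < 1" using inT[OF ST(2)] False by force
      moreover have "1 < 1 / \<gamma>" using \<gamma> by simp
      ultimately have "p T j < 1 / \<gamma>" by linarith
      then show ?thesis using False that j by (auto simp: g_def C_def)
    qed
    have "G S T / G T T \<le> (\<Prod>j\<in>D - C. \<gamma> ^ M) * 1"
      unfolding eq using g0 g1 g2 \<gamma>
      by (intro mult_mono prod_mono prod_le_1 prod_nonneg) (auto intro!: power_mono power_le_one)
    also have "\<dots> = \<gamma> ^ (M * card (D - C))" by (simp add: power_mult)
    also have "\<dots> = \<gamma> powr real (M * card (D - C))" using \<gamma>(1) by (rule powr_realpow[symmetric])
    also have "\<dots> = \<gamma> powr (real M * real (card (D - C)))" by simp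
    also have "\<dots> \<le> \<gamma> powr (real M * h / 2)"
    proof (rule powr_mono')
      \<comment> \<open>More than \<open>h\<close> indices lie in \<open>D\<close> and at most
        \<open>h / 2\<close> of them in the gap, so at least \<open>h / 2\<close> give the full
        factor.\<close>
      have "card D \<le> card (D - C) + card C"
        using card_Un_le[of "D - C" "C"] card_mono[of "(D - C) \<union> C" D] finD fin(1) by (force simp: C_def)
      moreover have "real (card D) > h" using sep[OF ST] by (simp add: D_def)
      moreover have "real (card C) \<le> h / 2" using gap[OF ST(2)] by (simp add: C_def)
      ultimately have "h / 2 \<le> real (card (D - C))" by linarith
      then have "real M * (h / 2) \<le> real M * real (card (D - C))" by (intro mult_left_mono) auto
      then show "real M * h / 2 \<le> real M * real (card (D - C))" by simp
    qed (use \<gamma> in auto)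
    finally have "G S T / G T T \<le> \<gamma> powr (real M * h / 2)" .
    moreover have "G S T / G T T \<ge> 0"
      unfolding G_def using p0 by (intro divide_nonneg_nonneg prod_nonneg) auto
    ultimately show ?thesis by simp
  qed
  have "card F \<le> card (?E \<times> ?E)"
  proof (rule card_le_of_dominant_factorization[where A = A and B = B])
    show "(\<Sum>j\<in>?E \<times> ?E. A T j * B j T) = 1" if "T \<in> F" for T
      using AB[OF that] Gpos[OF that] by simp
    show "\<bar>\<Sum>j\<in>?E \<times> ?E. A S j * B j T\<bar> \<le> \<gamma> powr (real M * h / 2)"
      if "S \<in> F" "T \<in> F" "S \<noteq> T" for S T
      unfolding AB[OF that(1)] using ratio[OF that] .
    show "real (card (?E \<times> ?E)) * \<gamma> powr (real M * h / 2) < 1"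
      using small by (simp add: card_cartesian_product power2_eq_square)
  qed (use fin in auto)
  then show ?thesis by (simp add: card_cartesian_product power2_eq_square)
qed

text \<open>Pigeonhole: the interval from 3/4 to 1 splits into \<open>K\<close> disjoint open slabs
  of width 1 / (4 K), and one of them holds at most the average number of values. Its midpoint
  serves as \<theta>: since \<theta> is at most 1, a relative deviation from \<theta> smaller than
  half the width of a slab is also a small absolute one.\<close>

lemma exists_sparse_threshold:
  fixes f :: "'j \<Rightarrow> real" and K :: nat
  assumes "finite J" "K > 0"
  defines "\<gamma> \<equiv> 1 - 1 / (8 * real K)"
  shows "\<exists>\<theta>. 3 / 4 \<le> \<theta> \<and> \<theta> \<le> 1 \<and>
    real (card {j \<in> J. \<gamma> < f j / \<theta> \<and> f j / \<theta> < 1 / \<gamma>}) \<le> real (card J) / real K"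
proof -
  define x where "x = 1 / (8 * real K)"
  have x: "0 < x" "x \<le> 1 / 8" "real K * (8 * x) = 1"
    using assms(2) by (auto simp: x_def field_simps)
  define B where "B = (\<lambda>k::nat. {j \<in> J. 3 / 4 + real k * (2 * x) < f j \<and> f j < 3 / 4 + real (Suc k) * (2 * x)})"
  have disj_less: "B k \<inter> B l = {}" if "k < l" for k l
  proof -
    have "real (Suc k) * (2 * x) \<le> real l * (2 * x)" using that x(1) by (intro mult_right_mono) auto
    then show ?thesis unfolding B_def by auto
  qed
  have disj: "\<forall>k\<in>{..<K}. \<forall>l\<in>{..<K}. k \<noteq> l \<longrightarrow> B k \<inter> B l = {}"
    using disj_less by (metis Int_commute linorder_neqE_nat)
  have "(\<Sum>k<K. card (B k)) = card (\<Union>k<K. B k)"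
    using disj assms(1) by (intro card_UN_disjoint[symmetric]) (auto simp: B_def)
  also have "\<dots> \<le> card J" using assms(1) by (intro card_mono) (auto simp: B_def)
  finally have tot: "(\<Sum>k<K. card (B k)) \<le> card J" .
  have "\<exists>k<K. real (card (B k)) \<le> real (card J) / real K"
  proof (rule ccontr)
    assume "\<not> ?thesis"
    then have "(\<Sum>k<K. real (card J) / real K) < (\<Sum>k<K. real (card (B k)))"
      using assms(2) by (intro sum_strict_mono) (auto simp: not_le)
    then have "real (card J) < real (\<Sum>k<K. card (B k))" using assms(2) by simp
    then show False using tot by linarith
  qed
  then obtain k where k: "k < K" "real (card (B k)) \<le> real (card J) / real K" by auto
  define \<theta> where "\<theta> = 3 / 4 + real k * (2 * x) + x"
  have "real (Suc k) * (2 * x) \<le> real K * (2 * x)" using k x by (intro mult_right_mono) auto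
  then have \<theta>1: "\<theta> + x \<le> 1" using x(3) by (simp add: \<theta>_def algebra_simps)
  have \<theta>0: "3 / 4 \<le> \<theta>" using x by (simp add: \<theta>_def)
  have "{j \<in> J. \<gamma> < f j / \<theta> \<and> f j / \<theta> < 1 / \<gamma>} \<subseteq> B k"
  proof clarify
    fix j assume j: "j \<in> J" "\<gamma> < f j / \<theta>" "f j / \<theta> < 1 / \<gamma>"
    have \<gamma>: "\<gamma> = 1 - x" by (simp add: \<gamma>_def x_def)
    have "(1 - x) * \<theta> < f j" using j(2) \<theta>0 by (simp add: \<gamma> field_simps)
    moreover have "x * \<theta> \<le> x * 1" using \<theta>1 x by (intro mult_left_mono) auto
    ultimately have 1: "\<theta> - x < f j" by (simp add: algebra_simps)
    have "f j * (1 - x) < \<theta>" using j(3) \<theta>0 x by (simp add: \<gamma> field_simps)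
    also have "\<theta> \<le> (\<theta> + x) * (1 - x)"
    proof -
      have "x * (\<theta> + x) \<le> x * 1" using \<theta>1 x by (intro mult_left_mono) auto
      then show ?thesis by (simp add: algebra_simps)
    qed
    finally have 2: "f j < \<theta> + x" using x by simp
    show "j \<in> B k" using 1 2 j(1) by (simp add: B_def \<theta>_def algebra_simps)
  qed
  then have "card {j \<in> J. \<gamma> < f j / \<theta> \<and> f j / \<theta> < 1 / \<gamma>} \<le> card (B k)"
    using assms(1) by (intro card_mono) (auto simp: B_def)
  then show ?thesis using k(2) \<theta>0 \<theta>1 x by (intro exI[of _ \<theta>]) auto
qed

lemma bilinear_pattern_cover:
  fixes b :: "'j \<Rightarrow> nat \<Rightarrow> real" and h :: real and K :: nat
  assumes fin: "finite J" and M: "even M" and K: "K > 0" "real (card J) / real K \<le> h / 2"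
    and small: "(real (card (exponents d (M * card J))))\<^sup>2 * (1 - 1 / (8 * real K)) powr (real M * h / 2) < 1"
  shows "\<exists>F. F \<subseteq> Pow J \<and> card F \<le> (card (exponents d (M * card J)))\<^sup>2 \<and>
    (\<forall>u v. \<exists>T\<in>F. \<exists>S. {j \<in> J. \<bar>evec_inner d (b j) u * evec_inner d (b j) v\<bar> \<ge> 1} \<subseteq> S \<and>
      S \<subseteq> {j \<in> J. \<bar>evec_inner d (b j) u * evec_inner d (b j) v\<bar> \<ge> 3 / 4} \<and>
      real (card ((S - T) \<union> (T - S))) \<le> h)"
proof -
  let ?p = "\<lambda>u v j. \<bar>evec_inner d (b j) u * evec_inner d (b j) v\<bar>"
  define \<gamma> where "\<gamma> = 1 - 1 / (8 * real K)"
  have "1 / (8 * real K) \<le> 1 / 8" using K(1) by (simp add: field_simps)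
  moreover have "0 < 1 / (8 * real K)" using K(1) by simp
  ultimately have \<gamma>: "0 < \<gamma>" "\<gamma> < 1" unfolding \<gamma>_def by linarith+
  define good where "good = (\<lambda>u v. real (card {j \<in> J. \<gamma> < ?p u v j \<and> ?p u v j < 1 / \<gamma>}) \<le> h / 2)"
  define P where "P = {S. \<exists>u v. good u v \<and> S = {j \<in> J. ?p u v j \<ge> 1}}"
  have PJ: "P \<subseteq> Pow J" by (auto simp: P_def)
  then have "finite P" using fin finite_subset by auto
  moreover have h: "h \<ge> 0"
  proof -
    have "0 \<le> real (card J) / real K" by simp
    also have "\<dots> \<le> h / 2" by (rule K(2))
    finally show ?thesis by simp
  qed
  ultimately have "\<exists>F\<subseteq>P. (\<forall>S\<in>F. \<forall>T\<in>F. S \<noteq> T \<longrightarrow> real (card ((S - T) \<union> (T - S))) > h) \<and>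
    (\<forall>S\<in>P. \<exists>T\<in>F. real (card ((S - T) \<union> (T - S))) \<le> h)"
    by (rule maximal_separated_subfamily)
  then obtain F where F: "F \<subseteq> P"
    "\<forall>S\<in>F. \<forall>T\<in>F. S \<noteq> T \<longrightarrow> real (card ((S - T) \<union> (T - S))) > h"
    "\<forall>S\<in>P. \<exists>T\<in>F. real (card ((S - T) \<union> (T - S))) \<le> h"
    by blast
  have "\<forall>T\<in>F. \<exists>u v. good u v \<and> T = {j \<in> J. ?p u v j \<ge> 1}" using F(1) by (auto simp: P_def)
  then have "\<exists>u. \<forall>T\<in>F. \<exists>v. good (u T) v \<and> T = {j \<in> J. ?p (u T) v j \<ge> 1}"
    by (rule bchoice)
  then obtain u where "\<forall>T\<in>F. \<exists>v. good (u T) v \<and> T = {j \<in> J. ?p (u T) v j \<ge> 1}" ..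
  then have "\<exists>v. \<forall>T\<in>F. good (u T) (v T) \<and> T = {j \<in> J. ?p (u T) (v T) j \<ge> 1}"
    by (rule bchoice)
  then obtain v where uv: "\<forall>T\<in>F. good (u T) (v T) \<and> T = {j \<in> J. ?p (u T) (v T) j \<ge> 1}" ..
  have "card F \<le> (card (exponents d (M * card J)))\<^sup>2"
  proof (rule card_separated_patterns_le[where u = u and v = v and b = b and \<gamma> = \<gamma> and h = h])
    show "finite F" using F(1) \<open>finite P\<close> finite_subset by auto
    show "(real (card (exponents d (M * card J))))\<^sup>2 * \<gamma> powr (real M * h / 2) < 1"
      using small by (simp add: \<gamma>_def)
    show "T = {j \<in> J. ?p (u T) (v T) j \<ge> 1}" if "T \<in> F" for T by (rule bspec[OF uv that, THEN conjunct2])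
    show "real (card {j \<in> J. \<gamma> < ?p (u T) (v T) j \<and> ?p (u T) (v T) j < 1 / \<gamma>}) \<le> h / 2"
      if "T \<in> F" for T using bspec[OF uv that, THEN conjunct1] by (simp only: good_def)
  qed (use fin M \<gamma> F(2) in auto)
  moreover have "\<exists>T\<in>F. \<exists>S. {j \<in> J. ?p u v j \<ge> 1} \<subseteq> S \<and> S \<subseteq> {j \<in> J. ?p u v j \<ge> 3 / 4} \<and>
      real (card ((S - T) \<union> (T - S))) \<le> h" for u v
  proof -
    from exists_sparse_threshold[OF fin K(1), of "?p u v"] obtain \<theta> where
      \<theta>: "3 / 4 \<le> \<theta>" "\<theta> \<le> 1"
        "real (card {j \<in> J. \<gamma> < ?p u v j / \<theta> \<and> ?p u v j / \<theta> < 1 / \<gamma>}) \<le> real (card J) / real K"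
      unfolding \<gamma>_def by blast
    define u' where "u' = (\<lambda>i. u i / \<theta>)"
    have p': "?p u' v j = ?p u v j / \<theta>" for j
    proof -
      have "evec_inner d (b j) u' = evec_inner d (b j) u / \<theta>"
        by (simp add: evec_inner_def u'_def sum_divide_distrib)
      then show ?thesis using \<theta>(1) by (simp add: abs_mult)
    qed
    define S where "S = {j \<in> J. ?p u' v j \<ge> 1}"
    have "good u' v" unfolding good_def p' using \<theta>(3) K(2) by linarith
    then have "S \<in> P" unfolding P_def S_def by blast
    with F(3) obtain T where "T \<in> F" "real (card ((S - T) \<union> (T - S))) \<le> h" by auto
    moreover have "S = {j \<in> J. ?p u v j \<ge> \<theta>}" unfolding S_def p' using \<theta>(1) by simp
    then have "{j \<in> J. ?p u v j \<ge> 1} \<subseteq> S" "S \<subseteq> {j \<in> J. ?p u v j \<ge> 3 / 4}" using \<theta> by auto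
    ultimately show ?thesis by blast
  qed
  ultimately show ?thesis using F(1) PJ by (intro exI[of _ F]) auto
qed

section \<open>Symmetrization with a ghost sample\<close>

lemma exp_le_quadratic:
  fixes x :: real
  assumes "\<bar>x\<bar> \<le> 1"
  shows "exp x \<le> 1 + x + x\<^sup>2"
proof (cases "x \<ge> 0")
  case True
  then show ?thesis using exp_bound[of x] assms by auto
next
  case False
  define y where "y = - x"
  have y: "0 < y" "y \<le> 1" using False assms by (auto simp: y_def)
  have "1 \<le> (1 - y + y\<^sup>2) * (1 + y + y\<^sup>2 / 2)"
  proof -
    have "(1 - y + y\<^sup>2) * (1 + y + y\<^sup>2 / 2) = 1 + y\<^sup>2 / 2 + y ^ 3 / 2 + y ^ 4 / 2"
      by (simp add: field_simps power2_eq_square power3_eq_cube power4_eq_xxxx)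
    then show ?thesis using y by simp
  qed
  also have "\<dots> \<le> (1 - y + y\<^sup>2) * exp y"
    using exp_lower_Taylor_quadratic[of y] y by (intro mult_left_mono) auto
  finally have "exp (- y) \<le> 1 - y + y\<^sup>2" by (simp add: exp_minus field_simps)
  then show ?thesis by (simp add: y_def)
qed

text \<open>Markov's inequality for the exponential of the sum, which factorizes over the product
  measure. With nonnegative integrals the sub-Gaussian bound can be inserted without an
  integrability argument.\<close>

lemma measure_sum_ge_le_mgf:
  fixes g :: "'a \<Rightarrow> real"
  assumes P: "prob_space P" and [measurable]: "g \<in> borel_measurable P"
    and C: "C \<ge> 0" "(\<integral>\<^sup>+a. ennreal (exp (g a)) \<partial>P) \<le> ennreal C"
  shows "measure (PiM {..<m} (\<lambda>_. P)) {a \<in> space (PiM {..<m} (\<lambda>_. P)). T \<le> (\<Sum>i<m. g (a i))}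
    \<le> C ^ m * exp (- T)"
proof -
  interpret P: prob_space P by fact
  interpret product_sigma_finite "\<lambda>_::nat. P" by standard
  let ?M = "PiM {..<m} (\<lambda>_. P)"
  interpret M: prob_space ?M by (intro prob_space_PiM P)
  have [measurable]: "(\<lambda>a. g (a i)) \<in> borel_measurable ?M" if "i \<in> {..<m}" for i
    using that by measurable
  have "emeasure ?M {a \<in> space ?M. 1 \<le> ennreal (exp (- T)) * (\<Prod>i<m. ennreal (exp (g (a i))))}
     \<le> ennreal (exp (- T)) * (\<integral>\<^sup>+ a. (\<Prod>i<m. ennreal (exp (g (a i)))) * indicator (space ?M) a \<partial>?M)"
    by (rule nn_integral_Markov_inequality) auto
  also have "(\<integral>\<^sup>+ a. (\<Prod>i<m. ennreal (exp (g (a i)))) * indicator (space ?M) a \<partial>?M) =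
      (\<integral>\<^sup>+ a. (\<Prod>i<m. ennreal (exp (g (a i)))) \<partial>?M)"
    by (intro nn_integral_cong) auto
  also have "\<dots> = (\<Prod>i<m. \<integral>\<^sup>+ a. ennreal (exp (g a)) \<partial>P)"
    by (subst product_nn_integral_prod) auto
  also have "ennreal (exp (- T)) * (\<Prod>i<m. \<integral>\<^sup>+ a. ennreal (exp (g a)) \<partial>P) \<le> ennreal (exp (- T)) * (\<Prod>i<m. ennreal C)"
    using C by (intro mult_left_mono prod_mono_ennreal) auto
  also have "ennreal (exp (- T)) * (\<Prod>i<m. ennreal C) = ennreal (C ^ m * exp (- T))"
    using C by (simp add: ennreal_power mult.commute flip: ennreal_mult)
  also have "{a \<in> space ?M. 1 \<le> ennreal (exp (- T)) * (\<Prod>i<m. ennreal (exp (g (a i))))}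
     = {a \<in> space ?M. T \<le> (\<Sum>i<m. g (a i))}"
  proof (intro Collect_cong conj_cong refl)
    fix a
    have "ennreal (exp (- T)) * (\<Prod>i<m. ennreal (exp (g (a i)))) = ennreal (exp ((\<Sum>i<m. g (a i)) - T))"
      by (simp add: prod_ennreal prod_nonneg exp_sum diff_conv_add_uminus exp_add mult.commute
          flip: ennreal_mult del: add_uminus_conv_diff)
    then show "1 \<le> ennreal (exp (- T)) * (\<Prod>i<m. ennreal (exp (g (a i)))) \<longleftrightarrow> T \<le> (\<Sum>i<m. g (a i))"
      by simp
  qed
  finally show ?thesis
    using C by (simp add: M.emeasure_eq_measure)
qed

text \<open>Chernoff bound with parameter 1/10. The exponent is - (19/200) p m from the moments and
  + (18/200) p m from the threshold, in total - p m / 200, which is at most - 1. A probability of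
  1/2 is all that the ghost sample has to provide.\<close>

lemma count_lower_tail:
  fixes A :: "'a set"
  assumes P: "prob_space P" and [measurable]: "A \<in> sets P" and p: "measure P A \<ge> p" "p * real m \<ge> 200"
  shows "measure (PiM {..<m} (\<lambda>_. P))
    {a \<in> space (PiM {..<m} (\<lambda>_. P)). real (card {i. i < m \<and> a i \<in> A}) \<ge> 9 / 10 * p * real m} \<ge> 1 / 2"
proof -
  interpret P: prob_space P by fact
  let ?M = "PiM {..<m} (\<lambda>_. P)"
  interpret M: prob_space ?M by (intro prob_space_PiM P)
  define g where "g = (\<lambda>a. - (1 / 10) * indicator A a :: real)"
  define T where "T = - (9 / 100) * p * real m"
  have [measurable]: "g \<in> borel_measurable P" unfolding g_def by measurable
  have sumg: "(\<Sum>i<m. g (a i)) = - (1 / 10) * real (card {i. i < m \<and> a i \<in> A})" for a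
  proof -
    have "(\<Sum>i<m. indicator A (a i) :: real) = real (card ({..<m} \<inter> {i. a i \<in> A}))"
      by (simp add: indicator_def sum.If_cases)
    also have "{..<m} \<inter> {i. a i \<in> A} = {i. i < m \<and> a i \<in> A}" by auto
    finally show ?thesis unfolding g_def sum_distrib_left[symmetric] by simp
  qed
  have e: "exp (- (1 / 10)) \<le> (1 - 19 / 200 :: real)"
  proof -
    have "1 + 1 / 10 + (1 / 10)\<^sup>2 / 2 \<le> exp (1 / 10 :: real)" by (rule exp_lower_Taylor_quadratic) simp
    then show ?thesis by (simp add: exp_minus field_simps power2_eq_square)
  qed
  have "(\<integral>\<^sup>+a. ennreal (exp (g a)) \<partial>P) \<le> (\<integral>\<^sup>+a. ennreal (1 - 19 / 200 * indicator A a) \<partial>P)"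
    using e by (intro nn_integral_mono ennreal_leI) (auto simp: g_def indicator_def)
  also have "\<dots> = ennreal (\<integral>a. 1 - 19 / 200 * indicator A a \<partial>P)"
    by (intro nn_integral_eq_integral P.integrable_const_bound[where B = 2]) (auto simp: indicator_def)
  also have "(\<integral>a. 1 - 19 / 200 * indicator A a \<partial>P) = 1 - 19 / 200 * measure P A"
  proof (subst Bochner_Integration.integral_diff)
    show "integrable P (\<lambda>a. 19 / 200 * indicat_real A a)"
      by (intro integrable_mult_right integrable_real_indicator) (auto simp: P.emeasure_eq_measure)
  qed (auto simp: P.prob_space)
  also have "ennreal (1 - 19 / 200 * measure P A) \<le> ennreal (exp (- (19 / 200 * p)))"
    using p(1) exp_ge_add_one_self[of "- (19 / 200 * p)"] by (intro ennreal_leI) simp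
  finally have mgf: "(\<integral>\<^sup>+a. ennreal (exp (g a)) \<partial>P) \<le> ennreal (exp (- (19 / 200 * p)))" .
  have "measure ?M {a \<in> space ?M. T \<le> (\<Sum>i<m. g (a i))} \<le> exp (- (19 / 200 * p)) ^ m * exp (- T)"
    by (rule measure_sum_ge_le_mgf[OF P _ _ mgf]) auto
  also have "\<dots> = exp (- (p * real m / 200))"
    by (simp add: T_def field_simps flip: exp_of_nat_mult exp_add)
  also have "\<dots> \<le> exp (- 1)" using p(2) by simp
  also have "\<dots> \<le> (1 / 2 :: real)"
    using exp_ge_add_one_self[of "1::real"] by (simp add: exp_minus field_simps)
  finally have le: "measure ?M {a \<in> space ?M. T \<le> (\<Sum>i<m. g (a i))} \<le> 1 / 2" .
  have [measurable]: "(\<lambda>a. \<Sum>i<m. g (a i)) \<in> borel_measurable ?M" by measurable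
  have "1 - 1 / 2 \<le> measure ?M (space ?M - {a \<in> space ?M. T \<le> (\<Sum>i<m. g (a i))})"
    using le by (subst M.prob_compl) auto
  also have "\<dots> \<le> measure ?M {a \<in> space ?M. (\<Sum>i<m. g (a i)) \<le> T}"
    by (intro M.finite_measure_mono) auto
  also have "{a \<in> space ?M. (\<Sum>i<m. g (a i)) \<le> T} =
      {a \<in> space ?M. real (card {i. i < m \<and> a i \<in> A}) \<ge> 9 / 10 * p * real m}"
    unfolding sumg T_def by auto
  finally show ?thesis by simp
qed

text \<open>Exponential tilting over all exchanges: weight 1/14 on the difference of the two counts,
  and a penalty 1/180 on their sum. The penalty pays for the second order term, and it is charged
  only at indices where \<open>S\<close> is met at all. This makes the bound exponential in
  \<open>y\<close> instead of \<open>y\<close>^2 / \<open>card I\<close>.\<close>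

lemma card_unbalanced_swaps_le:
  fixes S :: "('i \<times> bool) set" and y :: real
  assumes I: "finite I" and y: "y \<ge> 0"
  shows "real (card {\<epsilon> \<in> Pow I. real (card {i \<in> I. (i, True \<noteq> (i \<in> \<epsilon>)) \<in> S}) \<ge> 8 * y \<and>
      real (card {i \<in> I. (i, False \<noteq> (i \<in> \<epsilon>)) \<in> S}) \<le> 6 * y})
    \<le> 2 ^ card I * exp (- (y / 16))"
proof -
  define t where "t = (\<lambda>(s::bool) (i::'i) (e::bool). of_bool ((i, s \<noteq> e) \<in> S) :: real)"
  define w where "w = (\<lambda>i e. exp ((1 / 14 - 1 / 180) * t True i e - (1 / 14 + 1 / 180) * t False i e))"
  define X where "X = (\<lambda>s \<epsilon>. real (card {i \<in> I. (i, s \<noteq> (i \<in> \<epsilon>)) \<in> S}))"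
  have X: "X s \<epsilon> = (\<Sum>i\<in>I. t s i (i \<in> \<epsilon>))" for s \<epsilon>
    using I by (simp add: X_def t_def of_bool_def sum.If_cases Int_def)
  have pair: "w i True + w i False \<le> 2" for i
  proof -
    \<comment> \<open>Only an index with exactly one of its two points in \<open>S\<close> is
      critical. There the quadratic bounds add up to 2 - 1/90 + 1/98 + 1/16200, which is below
      2.\<close>
    have a: "exp (1 / 14 - 1 / 180 :: real) + exp (- (1 / 14 + 1 / 180)) \<le> 2"
      using exp_le_quadratic[of "1 / 14 - 1 / 180"] exp_le_quadratic[of "- (1 / 14 + 1 / 180)"]
      by (simp add: power2_eq_square)
    show ?thesis unfolding w_def t_def using a by (auto simp: of_bool_def)
  qed
  let ?B = "{\<epsilon> \<in> Pow I. X True \<epsilon> \<ge> 8 * y \<and> X False \<epsilon> \<le> 6 * y}"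
  have "real (card ?B) * exp (y / 16) = (\<Sum>\<epsilon>\<in>?B. exp (y / 16))" by simp
  also have "\<dots> \<le> (\<Sum>\<epsilon>\<in>?B. \<Prod>i\<in>I. w i (i \<in> \<epsilon>))"
  proof (rule sum_mono)
    fix \<epsilon> assume "\<epsilon> \<in> ?B"
    \<comment> \<open>At the extreme values 8 y and 6 y the right side is 2 y / 14 - 14 y / 180 = 41
      y / 630, slightly more than y / 16.\<close>
    then have "y / 16 \<le> (1 / 14 - 1 / 180) * X True \<epsilon> - (1 / 14 + 1 / 180) * X False \<epsilon>"
      using y by simp
    then have "exp (y / 16) \<le> exp ((1 / 14 - 1 / 180) * X True \<epsilon> - (1 / 14 + 1 / 180) * X False \<epsilon>)"
      by simp
    also have "\<dots> = (\<Prod>i\<in>I. w i (i \<in> \<epsilon>))"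
      unfolding w_def X using I by (simp add: sum_distrib_left flip: exp_sum sum_subtractf)
    finally show "exp (y / 16) \<le> (\<Prod>i\<in>I. w i (i \<in> \<epsilon>))" .
  qed
  also have "\<dots> \<le> (\<Sum>\<epsilon>\<in>Pow I. \<Prod>i\<in>I. w i (i \<in> \<epsilon>))"
    using I by (intro sum_mono2) (auto simp: w_def prod_nonneg)
  also have "\<dots> = (\<Sum>\<epsilon>\<in>Pow I. (\<Prod>i\<in>\<epsilon>. w i True) * (\<Prod>i\<in>I - \<epsilon>. w i False))"
  proof (rule sum.cong[OF refl])
    fix \<epsilon> assume \<epsilon>: "\<epsilon> \<in> Pow I"
    then have "(\<Prod>i\<in>I. w i (i \<in> \<epsilon>)) = (\<Prod>i\<in>I - \<epsilon>. w i (i \<in> \<epsilon>)) * (\<Prod>i\<in>\<epsilon>. w i (i \<in> \<epsilon>))"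
      using I by (intro prod.subset_diff) auto
    then show "(\<Prod>i\<in>I. w i (i \<in> \<epsilon>)) = (\<Prod>i\<in>\<epsilon>. w i True) * (\<Prod>i\<in>I - \<epsilon>. w i False)"
      by (simp add: mult.commute)
  qed
  also have "\<dots> = (\<Prod>i\<in>I. w i True + w i False)" by (rule prod_add[OF I, symmetric])
  also have "\<dots> \<le> (\<Prod>i\<in>I. 2)" using pair by (intro prod_mono) (auto simp: w_def add_nonneg_nonneg)
  finally show ?thesis unfolding X_def by (simp add: exp_minus field_simps)
qed

lemma count_measurable:
  assumes "finite I" "\<And>i. i \<in> I \<Longrightarrow> Measurable.pred M (\<lambda>x. Q i x)"
  shows "(\<lambda>x. real (card {i \<in> I. Q i x})) \<in> borel_measurable M"
proof -
  have "(\<lambda>x. real (card {i \<in> I. Q i x})) = (\<lambda>x. \<Sum>i\<in>I. of_bool (Q i x))"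
    using assms(1) by (auto simp: of_bool_def sum.If_cases Int_def)
  moreover have "(\<lambda>x. \<Sum>i\<in>I. of_bool (Q i x) :: real) \<in> borel_measurable M"
    using assms(2) by (intro borel_measurable_sum) (auto simp: of_bool_def)
  ultimately show ?thesis by simp
qed

lemma sets_Collect_Bex_countable:
  assumes "countable Z" "\<And>z. z \<in> Z \<Longrightarrow> {x \<in> space M. Q z x} \<in> sets M"
  shows "{x \<in> space M. \<exists>z\<in>Z. Q z x} \<in> sets M"
proof -
  have "{x \<in> space M. \<exists>z\<in>Z. Q z x} = (\<Union>z\<in>Z. {x \<in> space M. Q z x})" by auto
  then show ?thesis using assms by (simp add: sets.countable_UN'')
qed

text \<open>The proof compares the sample with an independent ghost sample; the pair of them is a
  point \<open>b\<close> of the product over \<open>{..<m} \<times> UNIV\<close>, and exchanging the two samples at random on the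
  coordinates in \<open>\<epsilon>\<close> preserves its law.\<close>

lemma uniform_count_lower_bound:
  fixes h :: "'z \<Rightarrow> 'a \<Rightarrow> real" and p :: real
  assumes P: "prob_space P" and Z: "countable Z"
    and h: "\<And>z. z \<in> Z \<Longrightarrow> h z \<in> borel_measurable P"
    and p: "p > 0" "p * real m \<ge> 200"
    and small_ball: "\<And>z. z \<in> Z \<Longrightarrow> measure P {a \<in> space P. h z a \<ge> 1} \<ge> p"
    and cover: "\<And>b. b \<in> {..<m} \<times> UNIV \<rightarrow> space P \<Longrightarrow> \<exists>F. F \<subseteq> Pow ({..<m} \<times> (UNIV :: bool set)) \<and>
      real (card F) \<le> N \<and> (\<forall>z\<in>Z. \<exists>T\<in>F. \<exists>S. {j \<in> {..<m} \<times> UNIV. h z (b j) \<ge> 1} \<subseteq> S \<and>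
        S \<subseteq> {j \<in> {..<m} \<times> UNIV. h z (b j) \<ge> 3 / 4} \<and>
        real (card ((S - T) \<union> (T - S))) \<le> p * real m / 10)"
  defines "M \<equiv> PiM {..<m} (\<lambda>_. P)"
  defines "B \<equiv> {a \<in> space M. \<exists>z\<in>Z. real (card {i \<in> {..<m}. h z (a i) \<ge> 3 / 4}) < p * real m / 2}"
  shows "B \<in> sets M" "measure M B \<le> 2 * N * exp (- (p * real m / 160))"
proof -
  define y where "y = p * real m / 10"
  have y: "y \<ge> 0" using p by (simp add: y_def)
  interpret P: prob_space P by fact
  interpret M: prob_space M unfolding M_def by (intro prob_space_PiM P)
  note [measurable] = h
  have hm: "Measurable.pred (PiM K (\<lambda>_. P)) (\<lambda>b. t \<le> h z (b j))" if "j \<in> K" "z \<in> Z" for K :: "'k set" and j z t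
    using that by measurable
  have cm: "(\<lambda>b. real (card {i \<in> I. t \<le> h z (b (f i))})) \<in> borel_measurable (PiM K (\<lambda>_. P))"
    if "finite I" "f ` I \<subseteq> K" "z \<in> Z" for I :: "'i set" and K :: "'k set" and f z t
    using that by (intro count_measurable hm) auto
  define I where "I = {..<m}"
  define J where "J = I \<times> (UNIV :: bool set)"
  have fin: "finite I" "finite J" by (auto simp: I_def J_def)
  define Q where "Q = PiM J (\<lambda>_. P)"
  interpret Q: prob_space Q unfolding Q_def by (intro prob_space_PiM P)
  \<comment> \<open>In units of \<open>y\<close> the mean number of successes is at least 10: the
    sample has fewer than 5 at the lower level, the ghost sample at least 9 at the higher one.
    Replacing \<open>S\<close> by a covering \<open>T\<close> changes each count by at most 1, which
    leaves the imbalance of 8 against 6 needed for the exchange bound.\<close>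
  define bad where "bad = (\<lambda>z b. real (card {i \<in> I. 3 / 4 \<le> h z (b (i, False))}) < 5 * y)"
  define good where "good = (\<lambda>z b. 9 * y \<le> real (card {i \<in> I. 1 \<le> h z (b (i, True))}))"
  define BJ where "BJ = {b \<in> space Q. \<exists>z\<in>Z. bad z b \<and> good z b}"
  have B_eq: "B = {a \<in> space M. \<exists>z\<in>Z. real (card {i \<in> I. 3 / 4 \<le> h z (a i)}) < 5 * y}"
    by (simp add: B_def I_def y_def)
  have BJ: "BJ \<in> sets Q" unfolding BJ_def
  proof (intro sets_Collect_Bex_countable Z)
    fix z assume z: "z \<in> Z"
    have [measurable]: "(\<lambda>b. real (card {i \<in> I. t \<le> h z (b (i, s))})) \<in> borel_measurable Q" for t s
      unfolding Q_def using cm[of I "\<lambda>i. (i, s)" J z t] fin z by (auto simp: J_def)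
    show "{b \<in> space Q. bad z b \<and> good z b} \<in> sets Q"
      unfolding bad_def good_def by measurable
  qed
  show B: "B \<in> sets M" unfolding B_eq
  proof (intro sets_Collect_Bex_countable Z)
    fix z assume z: "z \<in> Z"
    have [measurable]: "(\<lambda>b. real (card {i \<in> I. 3 / 4 \<le> h z (b i)})) \<in> borel_measurable M"
      unfolding M_def using cm[of I "\<lambda>i. i" "{..<m}" z "3 / 4"] fin z by (auto simp: I_def)
    show "{a \<in> space M. real (card {i \<in> I. 3 / 4 \<le> h z (a i)}) < 5 * y} \<in> sets M"
      by measurable
  qed
  define C where "C = N * (2 ^ m * exp (- (y / 16)))"
  \<comment> \<open>Inequality of truth values is exclusive or: sample and ghost trade places
    precisely at the coordinates in \<epsilon>.\<close>
  define sw where "sw = (\<lambda>\<epsilon> b. \<lambda>j\<in>J. b (fst j, snd j \<noteq> (fst j \<in> \<epsilon>)) :: 'a)"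
  have sw_meas [measurable]: "sw \<epsilon> \<in> measurable Q Q" for \<epsilon>
    unfolding Q_def sw_def J_def by (intro measurable_restrict measurable_component_singleton) auto
  have sw_distr: "distr Q Q (sw \<epsilon>) = Q" for \<epsilon>
    unfolding Q_def sw_def
    by (intro distr_PiM_reindex[where f = "\<lambda>j. (fst j, snd j \<noteq> (fst j \<in> \<epsilon>))"] P)
      (auto simp: J_def inj_on_def)
  \<comment> \<open>With the points \<open>b\<close> frozen only the exchange varies, so the cover
    may depend on \<open>b\<close>, and a union bound over its members suffices.\<close>
  have swaps: "real (card {\<epsilon> \<in> Pow I. sw \<epsilon> b \<in> BJ}) \<le> C" if b: "b \<in> space Q" for b
  proof -
    have "b \<in> {..<m} \<times> UNIV \<rightarrow> space P"
      using b by (auto simp: Q_def J_def I_def space_PiM)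
    from cover[OF this] obtain F where F: "F \<subseteq> Pow J" "real (card F) \<le> N"
      "\<And>z. z \<in> Z \<Longrightarrow> \<exists>T\<in>F. \<exists>S. {j \<in> J. h z (b j) \<ge> 1} \<subseteq> S \<and>
        S \<subseteq> {j \<in> J. h z (b j) \<ge> 3 / 4} \<and> real (card ((S - T) \<union> (T - S))) \<le> y"
      unfolding J_def I_def y_def by blast
    have finF: "finite F" using F(1) fin finite_subset by auto
    define D where "D = (\<lambda>T. {\<epsilon> \<in> Pow I. real (card {i \<in> I. (i, True \<noteq> (i \<in> \<epsilon>)) \<in> T}) \<ge> 8 * y \<and>
      real (card {i \<in> I. (i, False \<noteq> (i \<in> \<epsilon>)) \<in> T}) \<le> 6 * y})"
    have "{\<epsilon> \<in> Pow I. sw \<epsilon> b \<in> BJ} \<subseteq> (\<Union>T\<in>F. D T)"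
    proof
      fix \<epsilon> assume "\<epsilon> \<in> {\<epsilon> \<in> Pow I. sw \<epsilon> b \<in> BJ}"
      then obtain z where \<epsilon>: "\<epsilon> \<in> Pow I" and z: "z \<in> Z" "bad z (sw \<epsilon> b)" "good z (sw \<epsilon> b)"
        by (auto simp: BJ_def)
      from F(3)[OF z(1)] obtain T S where T: "T \<in> F" and S: "{j \<in> J. h z (b j) \<ge> 1} \<subseteq> S"
        "S \<subseteq> {j \<in> J. h z (b j) \<ge> 3 / 4}" "real (card ((S - T) \<union> (T - S))) \<le> y" by blast
      define R where "R = (\<lambda>s U. {i \<in> I. (i, s \<noteq> (i \<in> \<epsilon>)) \<in> U})"
      have sw: "sw \<epsilon> b (i, s) = b (i, s \<noteq> (i \<in> \<epsilon>))" if "i \<in> I" for i s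
        using that by (simp add: sw_def J_def)
      have finR: "finite (R s U)" for s U using fin by (simp add: R_def)
      have TJ: "finite T" "finite S"
        using T F(1) S(2) fin(2) by (auto intro: finite_subset[of _ J])
      have "card (R s ((S - T) \<union> (T - S))) \<le> card ((S - T) \<union> (T - S))" for s
        using TJ by (intro card_inj_on_le[where f = "\<lambda>i. (i, s \<noteq> (i \<in> \<epsilon>))"])
          (auto simp: R_def inj_on_def)
      then have Rd: "real (card (R s ((S - T) \<union> (T - S)))) \<le> y" for s
        using S(3) by (meson of_nat_le_iff order_trans)
      have RU: "card (R s U) \<le> card (R s V) + card (R s ((S - T) \<union> (T - S)))"
        if "U \<subseteq> V \<union> ((S - T) \<union> (T - S))" for s U V
      proof -
        have "card (R s U) \<le> card (R s V \<union> R s ((S - T) \<union> (T - S)))"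
        proof (rule card_mono)
          show "R s U \<subseteq> R s V \<union> R s ((S - T) \<union> (T - S))" using that by (auto simp: R_def)
        qed (use finR in simp)
        also have "\<dots> \<le> card (R s V) + card (R s ((S - T) \<union> (T - S)))" by (rule card_Un_le)
        finally show ?thesis .
      qed
      have "9 * y \<le> real (card {i \<in> I. 1 \<le> h z (sw \<epsilon> b (i, True))})" using z(3) by (simp add: good_def)
      also have "card {i \<in> I. 1 \<le> h z (sw \<epsilon> b (i, True))} \<le> card (R True S)"
        using S(1) fin sw finR by (intro card_mono) (auto simp: R_def J_def)
      finally have "9 * y \<le> real (card (R True S))" by simp
      then have 1: "8 * y \<le> real (card (R True T))"
      proof -
        have "card (R True S) \<le> card (R True T) + card (R True ((S - T) \<union> (T - S)))" by (rule RU) auto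
        then show ?thesis using Rd[of True] \<open>9 * y \<le> real (card (R True S))\<close> by linarith
      qed
      have "card (R False S) \<le> card {i \<in> I. 3 / 4 \<le> h z (sw \<epsilon> b (i, False))}"
        using S(2) fin sw by (intro card_mono) (auto simp: R_def J_def)
      then have "real (card (R False S)) \<le> 5 * y" using z(2) by (simp add: bad_def)
      then have 2: "real (card (R False T)) \<le> 6 * y"
      proof -
        have "card (R False T) \<le> card (R False S) + card (R False ((S - T) \<union> (T - S)))" by (rule RU) auto
        then show ?thesis using Rd[of False] \<open>real (card (R False S)) \<le> 5 * y\<close> by linarith
      qed
      show "\<epsilon> \<in> (\<Union>T\<in>F. D T)" using \<epsilon> 1 2 T by (auto simp: D_def R_def)
    qed
    then have "card {\<epsilon> \<in> Pow I. sw \<epsilon> b \<in> BJ} \<le> card (\<Union>T\<in>F. D T)"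
    proof (rule card_mono[rotated])
      show "finite (\<Union>T\<in>F. D T)" using finF fin(1) by (simp add: D_def)
    qed
    also have "\<dots> \<le> (\<Sum>T\<in>F. card (D T))" by (rule card_UN_le[OF finF])
    finally have "real (card {\<epsilon> \<in> Pow I. sw \<epsilon> b \<in> BJ}) \<le> real (\<Sum>T\<in>F. card (D T))"
      by (rule of_nat_mono)
    also have "\<dots> = (\<Sum>T\<in>F. real (card (D T)))" by (rule of_nat_sum)
    also have "\<dots> \<le> (\<Sum>T\<in>F. 2 ^ m * exp (- (y / 16)))"
    proof (rule sum_mono)
      fix T
      have "card I = m" by (simp add: I_def)
      then show "real (card (D T)) \<le> 2 ^ m * exp (- (y / 16))"
        unfolding D_def using card_unbalanced_swaps_le[OF fin(1) y, of T] by (simp only:)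
    qed
    also have "\<dots> = real (card F) * (2 ^ m * exp (- (y / 16)))" by simp
    also have "\<dots> \<le> C" unfolding C_def using F(2) by (intro mult_right_mono) auto
    finally show ?thesis .
  qed
  \<comment> \<open>Each exchange preserves the law, so the probability is the average over all
    \<epsilon>. Moving the sum inside the integral turns it into the number of exchanges that lead
    to the bad event at a given \<open>b\<close>.\<close>
  have "2 ^ m * emeasure Q BJ = (\<Sum>\<epsilon>\<in>Pow I. emeasure Q BJ)"
    by (simp add: card_Pow fin I_def)
  also have "\<dots> = (\<Sum>\<epsilon>\<in>Pow I. emeasure (distr Q Q (sw \<epsilon>)) BJ)" by (simp add: sw_distr)
  also have "\<dots> = (\<Sum>\<epsilon>\<in>Pow I. emeasure Q (sw \<epsilon> -` BJ \<inter> space Q))"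
    using BJ by (intro sum.cong refl emeasure_distr) auto
  also have "\<dots> = (\<Sum>\<epsilon>\<in>Pow I. \<integral>\<^sup>+b. indicator (sw \<epsilon> -` BJ \<inter> space Q) b \<partial>Q)"
    using BJ by (intro sum.cong refl nn_integral_indicator[symmetric] measurable_sets) auto
  also have "\<dots> = (\<integral>\<^sup>+b. (\<Sum>\<epsilon>\<in>Pow I. indicator (sw \<epsilon> -` BJ \<inter> space Q) b) \<partial>Q)"
    using BJ by (intro nn_integral_sum[symmetric] borel_measurable_indicator measurable_sets) auto
  also have "\<dots> \<le> (\<integral>\<^sup>+b. ennreal C \<partial>Q)"
  proof (rule nn_integral_mono)
    fix b assume b: "b \<in> space Q"
    have "(\<Sum>\<epsilon>\<in>Pow I. indicator (sw \<epsilon> -` BJ \<inter> space Q) b :: ennreal) = of_nat (card {\<epsilon> \<in> Pow I. sw \<epsilon> b \<in> BJ})"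
      using b fin by (simp add: indicator_def sum.If_cases Int_def)
    also have "\<dots> = ennreal (real (card {\<epsilon> \<in> Pow I. sw \<epsilon> b \<in> BJ}))" by (simp add: ennreal_of_nat_eq_real_of_nat)
    also have "\<dots> \<le> ennreal C" using swaps[OF b] by (rule ennreal_leI)
    finally show "(\<Sum>\<epsilon>\<in>Pow I. indicator (sw \<epsilon> -` BJ \<inter> space Q) b) \<le> ennreal C" .
  qed
  also have "\<dots> = ennreal C" by (simp add: Q.emeasure_space_1)
  finally have sym: "2 ^ m * emeasure Q BJ \<le> ennreal C" .
  have "C \<ge> 0"
  proof -
    obtain b where "b \<in> space Q" using Q.not_empty by auto
    from swaps[OF this] show ?thesis by linarith
  qed
  have "2 ^ m * measure Q BJ \<le> C"
  proof -
    have "2 ^ m * emeasure Q BJ = ennreal (2 ^ m * measure Q BJ)"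
      by (simp add: Q.emeasure_eq_measure ennreal_mult ennreal_power flip: ennreal_numeral)
    with sym \<open>C \<ge> 0\<close> show ?thesis by simp
  qed
  then have QB: "measure Q BJ \<le> N * exp (- (y / 16))" by (simp add: C_def field_simps)

  \<comment> \<open>From the pair back to the sample alone: by Fubini it suffices that, above each
    bad sample, the ghost sample completes the event with probability at least 1/2. This is the
    source of the factor 2 in the conclusion.\<close>
  define half where "half = (\<lambda>s::bool. PiM (I \<times> {s}) (\<lambda>_. P))"
  interpret H: prob_space "half s" for s :: bool unfolding half_def by (intro prob_space_PiM P)
  define pr where "pr = (\<lambda>(s::bool) b. \<lambda>i\<in>I. b (i, s) :: 'a)"
  have pr_meas [measurable]: "pr s \<in> measurable (half s) M" for s :: bool
    unfolding pr_def half_def M_def I_def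
    by (intro measurable_restrict measurable_component_singleton) auto
  have pr_distr: "distr (half s) M (pr s) = M" for s :: bool
    unfolding half_def M_def pr_def I_def
    by (intro distr_PiM_reindex[where f = "\<lambda>i. (i, s)"] P) (auto simp: inj_on_def)
  interpret prod: product_sigma_finite "\<lambda>_::nat \<times> bool. P" by standard
  let ?H = "half False \<Otimes>\<^sub>M half True"
  have J: "J = I \<times> {False} \<union> I \<times> {True}" by (auto simp: J_def)
  let ?mg = "merge (I \<times> {False}) (I \<times> {True})"
  have mg_meas [measurable]: "?mg \<in> measurable ?H Q"
    unfolding half_def Q_def J by measurable
  have "distr ?H Q ?mg = Q"
    unfolding half_def Q_def J using fin by (intro prod.distr_merge) auto
  then have "emeasure Q BJ = emeasure (distr ?H Q ?mg) BJ" by simp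
  also have "\<dots> = emeasure ?H (?mg -` BJ \<inter> space ?H)" using BJ by (intro emeasure_distr) auto
  also have "\<dots> = (\<integral>\<^sup>+x. emeasure (half True) (Pair x -` (?mg -` BJ \<inter> space ?H)) \<partial>half False)"
    using BJ by (intro H.emeasure_pair_measure_alt measurable_sets[OF mg_meas])
  finally have QF: "emeasure Q BJ = \<dots>" .
  let ?B0 = "pr False -` B \<inter> space (half False)"
  have "ennreal (measure M B / 2) = ennreal (1 / 2) * emeasure (distr (half False) M (pr False)) B"
    unfolding pr_distr M.emeasure_eq_measure by (subst ennreal_mult[symmetric]) auto
  also have "\<dots> = ennreal (1 / 2) * emeasure (half False) ?B0"
    using B by (subst emeasure_distr) auto
  also have "\<dots> = (\<integral>\<^sup>+x. ennreal (1 / 2) * indicator ?B0 x \<partial>half False)"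
    using B by (intro nn_integral_cmult_indicator[symmetric] measurable_sets[OF pr_meas])
  also have "\<dots> \<le> emeasure Q BJ" unfolding QF
  proof (rule nn_integral_mono)
    fix x assume x: "x \<in> space (half False)"
    show "ennreal (1 / 2) * indicator ?B0 x \<le> emeasure (half True) (Pair x -` (?mg -` BJ \<inter> space ?H))"
    proof (cases "x \<in> ?B0")
      case False
      then show ?thesis by simp
    next
      case True
      \<comment> \<open>The witness may depend on \<open>x\<close> in any way: it only serves to
        bound the section at this one \<open>x\<close>, so no measurable selection is
        involved.\<close>
      then obtain z where z: "z \<in> Z" "real (card {i \<in> I. 3 / 4 \<le> h z (pr False x i)}) < 5 * y"
        by (auto simp: B_eq)
      define A where "A = {a \<in> space P. h z a \<ge> 1}"
      have A: "A \<in> sets P" using z(1) unfolding A_def by measurable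
      define G where "G = {a \<in> space M. real (card {i. i < m \<and> a i \<in> A}) \<ge> 9 / 10 * p * real m}"
      have "1 / 2 \<le> measure M G"
        unfolding G_def M_def
        by (rule count_lower_tail[OF P A small_ball[OF z(1), folded A_def] p(2)])
      have G: "G \<in> sets M"
      proof -
        have "(\<lambda>a. real (card {i \<in> {..<m}. a i \<in> A})) \<in> borel_measurable M"
          unfolding M_def
        proof (rule count_measurable)
          note [measurable] = A
          fix i assume [measurable]: "i \<in> {..<m}"
          show "Measurable.pred (Pi\<^sub>M {..<m} (\<lambda>_. P)) (\<lambda>a. a i \<in> A)" by measurable
        qed simp
        then have "(\<lambda>a. real (card {i. i < m \<and> a i \<in> A})) \<in> borel_measurable M" by (simp only: lessThan_iff)
        then show ?thesis unfolding G_def by measurable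
      qed
      have "ennreal (1 / 2) \<le> emeasure (distr (half True) M (pr True)) G"
        unfolding pr_distr M.emeasure_eq_measure using \<open>1 / 2 \<le> measure M G\<close> by (rule ennreal_leI)
      also have "\<dots> = emeasure (half True) (pr True -` G \<inter> space (half True))"
        using G by (intro emeasure_distr) auto
      also have "\<dots> \<le> emeasure (half True) (Pair x -` (?mg -` BJ \<inter> space ?H))"
      proof (rule emeasure_mono)
        show "Pair x -` (?mg -` BJ \<inter> space ?H) \<in> sets (half True)"
          by (rule sets_Pair1[OF measurable_sets[OF mg_meas BJ]])
        show "pr True -` G \<inter> space (half True) \<subseteq> Pair x -` (?mg -` BJ \<inter> space ?H)"
        proof
          fix w assume w: "w \<in> pr True -` G \<inter> space (half True)"
          have xw: "(x, w) \<in> space ?H" using x w by (auto simp: space_pair_measure)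
          have mg: "?mg (x, w) (i, False) = x (i, False)" "?mg (x, w) (i, True) = w (i, True)" if "i \<in> I" for i
            using that by (auto simp: merge_def)
          have "{i. i < m \<and> pr True w i \<in> A} = {i \<in> I. 1 \<le> h z (w (i, True))}"
            using w by (auto simp: A_def I_def pr_def half_def space_PiM)
          then have "good z (?mg (x, w))"
            using w mg by (simp add: good_def G_def y_def cong: conj_cong)
          moreover have "bad z (?mg (x, w))"
            using z(2) mg by (simp add: bad_def pr_def cong: conj_cong)
          ultimately have "?mg (x, w) \<in> BJ"
            using z(1) measurable_space[OF mg_meas xw] by (auto simp: BJ_def)
          then show "w \<in> Pair x -` (?mg -` BJ \<inter> space ?H)" using xw by auto
        qed
      qed
      finally show ?thesis using True by simp
    qed
  qed
  finally have "measure M B / 2 \<le> measure Q BJ"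
    by (simp add: Q.emeasure_eq_measure)
  with QB show "measure M B \<le> 2 * N * exp (- (p * real m / 160))"
    by (simp add: y_def)
qed

section \<open>Concentration of the second moment\<close>

lemma evec_inner_add_left: "evec_inner d (\<lambda>i. u i + v i) w = evec_inner d u w + evec_inner d v w"
  by (simp add: evec_inner_def distrib_right sum.distrib)

lemma evec_inner_scale_left: "evec_inner d (\<lambda>i. t * u i) w = t * evec_inner d u w"
  by (simp add: evec_inner_def sum_distrib_left mult.assoc)

lemma evec_inner_commute: "evec_inner d u v = evec_inner d v u"
  by (simp add: evec_inner_def mult.commute)

lemma evec_inner_add_right: "evec_inner d w (\<lambda>i. u i + v i) = evec_inner d w u + evec_inner d w v"
  using evec_inner_add_left[of d u v w] by (simp add: evec_inner_commute)

lemma evec_inner_scale_right: "evec_inner d w (\<lambda>i. t * u i) = t * evec_inner d w u"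
  using evec_inner_scale_left[of d t u w] by (simp add: evec_inner_commute)

lemma evec_inner_self_nonneg: "0 \<le> evec_inner d v v"
  by (simp add: evec_inner_def sum_nonneg)

lemma evec_inner_cauchy_schwarz: "(evec_inner d u v)\<^sup>2 \<le> evec_inner d u u * evec_inner d v v"
  using Cauchy_Schwarz_ineq_sum[of u v "{..<d}"] by (simp add: evec_inner_def power2_eq_square)

lemma evec_inner_self_add_le:
  assumes "t > 0"
  shows "evec_inner d (\<lambda>i. u i + v i) (\<lambda>i. u i + v i)
    \<le> (1 + t) * evec_inner d u u + (1 + 1 / t) * evec_inner d v v"
proof -
  have "(u i + v i) * (u i + v i) \<le> (1 + t) * (u i * u i) + (1 + 1 / t) * (v i * v i)" for i
  proof -
    have "0 \<le> (t * u i - v i)\<^sup>2 / t" using assms by simp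
    also have "\<dots> = t * (u i * u i) - 2 * (u i * v i) + (v i * v i) / t"
      using assms by (simp add: power2_eq_square field_simps)
    finally show ?thesis by (simp add: algebra_simps)
  qed
  then show ?thesis
    unfolding evec_inner_def sum_distrib_left sum.distrib[symmetric] by (intro sum_mono)
qed

text \<open>Rounding a unit vector to the grid of mesh \<open>1 / (5 sqrt d)\<close> moves it by at most 1/10. The result
  has squared norm at most 121/100, so that its integer coordinates have square sum at most \<open>(121/4) d\<close>.\<close>

definition lattice_ball :: "nat \<Rightarrow> (nat \<Rightarrow> int) set" where
  "lattice_ball d = {z. (\<forall>i\<ge>d. z i = 0) \<and> (\<Sum>i<d. (z i)\<^sup>2) \<le> 31 * int d}"

definition ball_net :: "nat \<Rightarrow> (nat \<Rightarrow> real) set" where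
  "ball_net d = {w \<in> (\<lambda>z i. real_of_int (z i) / (5 * sqrt (real d))) ` lattice_ball d.
    evec_inner d w w \<le> 121 / 100}"

lemma sum_half_power_abs_le:
  "(\<Sum>k\<in>{- int R..int R}. (1 / 2 :: real) ^ nat \<bar>k\<bar>) \<le> 3 - 2 * (1 / 2) ^ R"
proof (induction R)
  case 0
  then show ?case by simp
next
  case (Suc R)
  have "{- int (Suc R)..int (Suc R)} = insert (- int (Suc R)) (insert (int (Suc R)) {- int R..int R})"
    by auto
  then have "(\<Sum>k\<in>{- int (Suc R)..int (Suc R)}. (1 / 2 :: real) ^ nat \<bar>k\<bar>)
     = 2 * (1 / 2) ^ Suc R + (\<Sum>k\<in>{- int R..int R}. (1 / 2 :: real) ^ nat \<bar>k\<bar>)"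
    by (simp add: nat_add_distrib)
  then show ?case using Suc by simp
qed

lemma abs_le_square_int: "\<bar>k\<bar> \<le> (k::int)\<^sup>2"
  using self_le_power[of "\<bar>k\<bar>" 2] by (cases "k = 0") auto

text \<open>Again a weight that factorizes: exp(- |z|^2) is at least exp(- 31 d) on the ball, and
  its sum over one coordinate is at most 3, hence at most e^2. This gives the exponent 31 + 2. The
  box of half-width \<open>R\<close> is crude and only makes the sums finite.\<close>

lemma lattice_ball_finite_card:
  shows "finite (lattice_ball d)" "real (card (lattice_ball d)) \<le> exp (33 * real d)"
proof -
  define R where "R = 31 * d"
  let ?r = "\<lambda>z::nat \<Rightarrow> int. restrict z {..<d}"
  have inj: "inj_on ?r (lattice_ball d)"
  proof (rule inj_onI, rule ext)
    fix z z' i assume z: "z \<in> lattice_ball d" "z' \<in> lattice_ball d" and eq: "?r z = ?r z'"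
    have "i < d \<Longrightarrow> z i = z' i" using fun_cong[OF eq, of i] by simp
    then show "z i = z' i" using z by (cases "i < d") (auto simp: lattice_ball_def)
  qed
  let ?X = "{..<d} \<rightarrow>\<^sub>E {- int R..int R}"
  have sub: "?r ` lattice_ball d \<subseteq> ?X"
  proof (rule image_subsetI)
    fix z assume z: "z \<in> lattice_ball d"
    have "z i \<in> {- int R..int R}" if i: "i < d" for i
    proof -
      have "(z i)\<^sup>2 \<le> (\<Sum>i<d. (z i)\<^sup>2)" using i by (intro member_le_sum) auto
      also have "\<dots> \<le> int R" using z by (simp add: lattice_ball_def R_def)
      finally have "(z i)\<^sup>2 \<le> int R" .
      with abs_le_square_int[of "z i"] have "\<bar>z i\<bar> \<le> int R" by linarith
      then show ?thesis by auto
    qed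
    then show "?r z \<in> ?X" by auto
  qed
  have finX: "finite ?X" by (intro finite_PiE) auto
  then show "finite (lattice_ball d)" using inj sub finite_imageD finite_subset by blast
  let ?w = "\<lambda>z::nat \<Rightarrow> int. \<Prod>i<d. exp (- (real_of_int (z i))\<^sup>2)"
  have "real (card (lattice_ball d)) = (\<Sum>z\<in>lattice_ball d. 1)" by simp
  also have "\<dots> \<le> (\<Sum>z\<in>lattice_ball d. exp (31 * real d) * ?w z)"
  proof (rule sum_mono)
    fix z assume "z \<in> lattice_ball d"
    then have "(\<Sum>i<d. (z i)\<^sup>2) \<le> 31 * int d" by (simp add: lattice_ball_def)
    then have "real_of_int (\<Sum>i<d. (z i)\<^sup>2) \<le> real_of_int (31 * int d)" by (simp only: of_int_le_iff)
    then have "(\<Sum>i<d. (real_of_int (z i))\<^sup>2) \<le> 31 * real d" by simp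
    then show "1 \<le> exp (31 * real d) * ?w z" by (simp add: sum_negf flip: exp_sum exp_add)
  qed
  also have "\<dots> = (\<Sum>z\<in>?r ` lattice_ball d. exp (31 * real d) * ?w z)"
    by (subst sum.reindex[OF inj]) simp
  also have "\<dots> \<le> (\<Sum>z\<in>?X. exp (31 * real d) * ?w z)"
    by (intro sum_mono2 finX sub mult_nonneg_nonneg prod_nonneg) auto
  also have "\<dots> = exp (31 * real d) * (\<Prod>i<d. \<Sum>k\<in>{- int R..int R}. exp (- (real_of_int k)\<^sup>2))"
    by (subst prod_sum_PiE) (auto simp: sum_distrib_left)
  also have "\<dots> \<le> exp (31 * real d) * (\<Prod>i<d. exp 2)"
  proof (intro mult_left_mono prod_mono conjI sum_nonneg)
    have "(\<Sum>k\<in>{- int R..int R}. exp (- (real_of_int k)\<^sup>2)) \<le> (\<Sum>k\<in>{- int R..int R}. (1 / 2 :: real) ^ nat \<bar>k\<bar>)"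
    proof (rule sum_mono)
      fix k :: int
      have "exp (- (real_of_int k)\<^sup>2) = exp (- 1) ^ nat (k\<^sup>2)"
        by (simp flip: exp_of_nat_mult of_int_power)
      also have "\<dots> \<le> exp (- 1) ^ nat \<bar>k\<bar>"
      proof (rule power_decreasing)
        show "nat \<bar>k\<bar> \<le> nat (k\<^sup>2)" by (intro nat_mono abs_le_square_int)
      qed auto
      also have "\<dots> \<le> (1 / 2) ^ nat \<bar>k\<bar>"
        using exp_ge_add_one_self[of "1::real"] by (intro power_mono) (simp_all add: exp_minus field_simps)
      finally show "exp (- (real_of_int k)\<^sup>2) \<le> (1 / 2) ^ nat \<bar>k\<bar>" .
    qed
    also have "\<dots> \<le> 3 - 2 * (1 / 2) ^ R" by (rule sum_half_power_abs_le)
    also have "\<dots> \<le> 3" by simp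
    also have "\<dots> \<le> exp (2 :: real)" using exp_ge_add_one_self[of 2] by simp
    finally show "(\<Sum>k\<in>{- int R..int R}. exp (- (real_of_int k)\<^sup>2)) \<le> exp (2 :: real)" .
  qed auto
  also have "\<dots> = exp (33 * real d)" by (simp flip: exp_of_nat_mult exp_add)
  finally show "real (card (lattice_ball d)) \<le> exp (33 * real d)" .
qed

lemma ball_net_finite_card:
  shows "finite (ball_net d)" "real (card (ball_net d)) \<le> exp (33 * real d)"
proof -
  have sub: "ball_net d \<subseteq> (\<lambda>z i. real_of_int (z i) / (5 * sqrt (real d))) ` lattice_ball d"
    by (auto simp: ball_net_def)
  then show "finite (ball_net d)" using lattice_ball_finite_card finite_subset by blast
  have "card (ball_net d) \<le> card (lattice_ball d)"
    using sub lattice_ball_finite_card(1) by (meson card_image_le card_mono finite_imageI order_trans)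
  then show "real (card (ball_net d)) \<le> exp (33 * real d)"
    using lattice_ball_finite_card(2)[of d] by linarith
qed

lemma ball_net_approximates:
  assumes d: "d > 0" and v: "evec_inner d v v = 1"
  shows "\<exists>w\<in>ball_net d. evec_inner d (\<lambda>i. v i - w i) (\<lambda>i. v i - w i) \<le> 1 / 100"
proof -
  define s where "s = 1 / (5 * sqrt (real d))"
  have s: "s > 0" using d by (simp add: s_def)
  have s2: "s * s * real d = 1 / 25" using d by (simp add: s_def field_simps)
  define z where "z = (\<lambda>i. if i < d then round (v i / s) else 0)"
  define w where "w = (\<lambda>i. real_of_int (z i) / (5 * sqrt (real d)))"
  have w: "w i = s * real_of_int (z i)" for i by (simp add: w_def s_def)
  have diff: "\<bar>v i - w i\<bar> \<le> s / 2" if "i < d" for i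
  proof -
    have "\<bar>v i / s - real_of_int (round (v i / s))\<bar> \<le> 1 / 2"
      using of_int_round_abs_le[of "v i / s"] by (simp add: abs_minus_commute)
    then have "s * \<bar>v i / s - real_of_int (round (v i / s))\<bar> \<le> s * (1 / 2)"
      using s by (intro mult_left_mono) auto
    also have "s * \<bar>v i / s - real_of_int (round (v i / s))\<bar> = \<bar>s * (v i / s - real_of_int (round (v i / s)))\<bar>"
      using s by (simp add: abs_mult)
    also have "s * (v i / s - real_of_int (round (v i / s))) = v i - w i"
      using s that by (simp add: w z_def field_simps)
    finally show ?thesis by simp
  qed
  let ?e = "\<lambda>i. v i - w i"
  have "evec_inner d ?e ?e \<le> (\<Sum>i<d. s / 2 * (s / 2))"
    unfolding evec_inner_def
  proof (rule sum_mono)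
    fix i assume "i \<in> {..<d}"
    then have "\<bar>?e i\<bar> * \<bar>?e i\<bar> \<le> s / 2 * (s / 2)" using s diff[of i] by (intro mult_mono) auto
    then show "?e i * ?e i \<le> s / 2 * (s / 2)" by simp
  qed
  also have "\<dots> = s * s * real d / 4" by simp
  finally have e: "evec_inner d ?e ?e \<le> 1 / 100" using s2 by simp
  \<comment> \<open>With t = 1/10 the right side is 11/10 + 11/100, the square of 1 + 1/10, so
    nothing is lost against the triangle inequality.\<close>
  have "evec_inner d (\<lambda>i. v i + (- 1) * ?e i) (\<lambda>i. v i + (- 1) * ?e i)
     \<le> (1 + 1 / 10) * evec_inner d v v + (1 + 1 / (1 / 10)) * evec_inner d (\<lambda>i. (- 1) * ?e i) (\<lambda>i. (- 1) * ?e i)"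
    by (rule evec_inner_self_add_le) simp
  also have "\<dots> \<le> 121 / 100" using e v
    by (simp only: evec_inner_scale_left evec_inner_scale_right) simp
  finally have ww: "evec_inner d w w \<le> 121 / 100" by simp
  have "real_of_int (\<Sum>i<d. (z i)\<^sup>2) = evec_inner d w w / (s * s)"
    using s by (simp add: evec_inner_def w sum_divide_distrib power2_eq_square)
  also have "\<dots> \<le> (121 / 100) / (s * s)" using ww s by (intro divide_right_mono) auto
  also have "1 / (s * s) = 25 * real d" using s s2 by (simp add: field_simps)
  then have "(121 / 100) / (s * s) = 121 / 4 * real d" by (simp add: field_simps)
  also have "\<dots> \<le> real_of_int (31 * int d)" by simp
  finally have "(\<Sum>i<d. (z i)\<^sup>2) \<le> 31 * int d" by linarith
  then have "z \<in> lattice_ball d" by (auto simp: lattice_ball_def z_def)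
  then have "w \<in> ball_net d" using ww by (auto simp: ball_net_def w_def)
  then show ?thesis using e by blast
qed

text \<open>If w is a net point near the unit vector u, then B u u - B w w = B (u - w) (u + w),
  which is at most (1/10) (21/10) C. So any bound C improves to \<tau> + (21/100) C, and iteration
  drives it to the fixed point \<tau> / (79/100). The hypothesis \<open>bounded\<close> supplies the
  starting value, whose size leaves no trace in the result; no supremum over the sphere has to be
  attained.\<close>

lemma quadratic_form_bound_from_net:
  fixes B :: "(nat \<Rightarrow> real) \<Rightarrow> (nat \<Rightarrow> real) \<Rightarrow> real"
  assumes d: "d > 0"
    and add: "\<And>u v w. B (\<lambda>i. u i + v i) w = B u w + B v w"
    and scale: "\<And>t u w. B (\<lambda>i. t * u i) w = t * B u w"
    and sym: "\<And>u v. B u v = B v u"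
    and bounded: "\<And>v. \<bar>B v v\<bar> \<le> C * evec_inner d v v"
    and net: "\<And>w. w \<in> ball_net d \<Longrightarrow> \<bar>B w w\<bar> \<le> \<tau>"
  shows "\<bar>B v v\<bar> \<le> \<tau> / (79 / 100) * evec_inner d v v"
proof -
  have scale': "B w (\<lambda>i. t * u i) = t * B w u" for t u w
    using scale[of t u w] by (simp add: sym)
  have add': "B w (\<lambda>i. u i + v i) = B w u + B w v" for u v w
    using add[of u v w] by (simp add: sym)
  have step: "\<bar>B v v\<bar> \<le> (\<tau> + 21 / 100 * C) * evec_inner d v v"
    if C: "\<And>v. \<bar>B v v\<bar> \<le> C * evec_inner d v v" for C v
  proof (cases "evec_inner d v v = 0")
    case True
    then show ?thesis using C[of v] by simp
  next
    case False
    then have pos: "evec_inner d v v > 0" using evec_inner_self_nonneg[of d v] by simp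
    define t where "t = 1 / sqrt (evec_inner d v v)"
    have t2: "t * t * evec_inner d v v = 1" using pos by (simp add: t_def)
    define u where "u = (\<lambda>i. t * v i)"
    have u: "evec_inner d u u = 1"
      using t2 by (simp add: u_def evec_inner_scale_left evec_inner_scale_right mult.assoc)
    have C0: "C \<ge> 0" using C[of u] u by simp
    from ball_net_approximates[OF d u] obtain w where
      w: "w \<in> ball_net d" "evec_inner d (\<lambda>i. u i - w i) (\<lambda>i. u i - w i) \<le> 1 / 100" by blast
    define x where "x = (\<lambda>i. u i + (- 1) * w i)"
    define y where "y = (\<lambda>i. u i + w i)"
    have x: "evec_inner d x x \<le> 1 / 100" using w(2) by (simp add: x_def)
    \<comment> \<open>The norm of u + w is at most 2 + 1/10; the parameter 1/20 reproduces the
      square of this number exactly.\<close>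
    have y: "evec_inner d y y \<le> 441 / 100"
    proof -
      have y_eq: "y = (\<lambda>i. 2 * u i + (- 1) * x i)" by (auto simp: y_def x_def)
      have "evec_inner d y y \<le> (1 + 1 / 20) * evec_inner d (\<lambda>i. 2 * u i) (\<lambda>i. 2 * u i)
        + (1 + 1 / (1 / 20)) * evec_inner d (\<lambda>i. (- 1) * x i) (\<lambda>i. (- 1) * x i)"
        unfolding y_eq by (rule evec_inner_self_add_le) simp
      also have "\<dots> \<le> 441 / 100" using x u
        by (simp only: evec_inner_scale_left evec_inner_scale_right) simp
      finally show ?thesis .
    qed
    have "B x y = B u u - B w w"
      by (simp only: x_def y_def add add' scale scale') (simp add: sym)
    moreover have "\<bar>B x y\<bar> \<le> 21 / 100 * C"
    proof -
      \<comment> \<open>Polarization with weight 21 on \<open>x\<close>, because 21 / 10 is also the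
        bound for the norm of \<open>y\<close>. The balanced sum yields 17.64 / 84 = 21/100.\<close>
      let ?p = "\<lambda>i. 21 * x i + y i" and ?m = "\<lambda>i. 21 * x i + (- 1) * y i"
      have eq: "84 * B x y = B ?p ?p - B ?m ?m"
        by (simp only: add add' scale scale') (simp add: sym)
      have "84 * \<bar>B x y\<bar> \<le> \<bar>B ?p ?p\<bar> + \<bar>B ?m ?m\<bar>" using eq by linarith
      also have "\<dots> \<le> C * (evec_inner d ?p ?p + evec_inner d ?m ?m)"
        using C[of ?p] C[of ?m] by (simp add: distrib_left)
      also have "evec_inner d ?p ?p + evec_inner d ?m ?m = 882 * evec_inner d x x + 2 * evec_inner d y y"
        by (simp only: evec_inner_add_left evec_inner_add_right evec_inner_scale_left evec_inner_scale_right)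
      also have "C * \<dots> \<le> C * (1764 / 100)" using x y C0 by (intro mult_left_mono) auto
      finally show ?thesis by simp
    qed
    ultimately have "\<bar>B u u\<bar> \<le> \<tau> + 21 / 100 * C" using net[OF w(1)] by linarith
    moreover have "B u u = t * t * B v v" by (simp add: u_def scale scale' mult.assoc)
    ultimately have "t * t * \<bar>B v v\<bar> \<le> \<tau> + 21 / 100 * C" by (simp add: abs_mult)
    then have "evec_inner d v v * (t * t * \<bar>B v v\<bar>) \<le> evec_inner d v v * (\<tau> + 21 / 100 * C)"
      using pos by (intro mult_left_mono) auto
    also have "evec_inner d v v * (t * t * \<bar>B v v\<bar>) = (t * t * evec_inner d v v) * \<bar>B v v\<bar>"
      by (simp only: mult_ac)
    finally show ?thesis by (simp add: t2 mult.commute)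
  qed
  define L where "L = \<tau> / (79 / 100)"
  have iter: "\<bar>B v v\<bar> \<le> (L + (21 / 100) ^ n * (C - L)) * evec_inner d v v" for n v
  proof (induction n arbitrary: v)
    case 0
    then show ?case using bounded by simp
  next
    case (Suc n)
    have "\<tau> + 21 / 100 * (L + (21 / 100) ^ n * (C - L)) = L + (21 / 100) ^ Suc n * (C - L)"
      by (simp add: L_def field_simps)
    then show ?case using step[OF Suc, of v] by simp
  qed
  have "(\<lambda>n. (L + (21 / 100) ^ n * (C - L)) * evec_inner d v v) \<longlonglongrightarrow> (L + 0 * (C - L)) * evec_inner d v v"
    by (intro tendsto_intros LIMSEQ_realpow_zero) auto
  from LIMSEQ_le_const[OF this] show ?thesis using iter by (auto simp: L_def)
qed

section \<open>Tails of squared projections and their uniform version\<close>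

lemma exp_le_quadratic_exp: "exp z \<le> 1 + z + z\<^sup>2 * exp \<bar>z\<bar>" for z :: real
proof -
  consider "\<bar>z\<bar> \<le> 1" | "z > 1" | "z < - 1" by linarith
  then show ?thesis
  proof cases
    case 1
    have "z\<^sup>2 * 1 \<le> z\<^sup>2 * exp \<bar>z\<bar>" by (intro mult_left_mono) auto
    then show ?thesis using exp_le_quadratic[OF 1] by linarith
  next
    case 2
    then have "1 * exp z \<le> z\<^sup>2 * exp \<bar>z\<bar>" by (intro mult_mono) auto
    then show ?thesis using 2 by linarith
  next
    case 3
    have "\<bar>z\<bar> * 1 \<le> z\<^sup>2 * exp \<bar>z\<bar>"
    proof (intro mult_mono)
      show "\<bar>z\<bar> \<le> z\<^sup>2" using 3 self_le_power[of "\<bar>z\<bar>" 2] by simp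
    qed auto
    moreover have "exp z \<le> 1" using 3 by simp
    ultimately show ?thesis using 3 by linarith
  qed
qed

lemma square_le_exp_half: "D\<^sup>2 \<le> 8 * exp (D / 2)" if "D \<ge> 0" for D :: real
proof -
  have "1 + D / 2 + (D / 2)\<^sup>2 / 2 \<le> exp (D / 2)" using that by (intro exp_lower_Taylor_quadratic) simp
  then show ?thesis using that by (simp add: power_divide)
qed

text \<open>Since |s| is at most 1/2, the factor exp |s (Y - \<mu>)| in the second order remainder
  uses only half of the available exponential moment. The other half absorbs the square, through D^2
  \<le> 8 exp (D / 2). What remains is s^2 times 8 e exp Y, with mean at most 8 e^2 s^2, and 8 e^2
  is below 60.\<close>

lemma centered_mgf_le:
  fixes Y :: "'a \<Rightarrow> real"
  assumes P: "prob_space P" and Y: "integrable P Y" "\<And>a. Y a \<ge> 0"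
    and e: "(\<integral>\<^sup>+a. ennreal (exp (Y a)) \<partial>P) \<le> ennreal (exp 1)"
    and \<mu>: "(\<integral>a. Y a \<partial>P) = \<mu>" "\<mu> \<le> 1" and s: "\<bar>s\<bar> \<le> 1 / 2"
  shows "(\<integral>\<^sup>+a. ennreal (exp (s * (Y a - \<mu>))) \<partial>P) \<le> ennreal (exp (60 * s\<^sup>2))"
proof -
  interpret prob_space P by fact
  have \<mu>0: "0 \<le> \<mu>" unfolding \<mu>(1)[symmetric] using Y(2) by (rule Bochner_Integration.integral_nonneg)
  have [measurable]: "Y \<in> borel_measurable P" using Y(1) by simp
  have expY: "integrable P (\<lambda>a. exp (Y a))"
    using e by (intro integrableI_nonneg) (auto intro: le_less_trans)
  have expY_le: "(\<integral>a. exp (Y a) \<partial>P) \<le> exp 1"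
    using e by (subst (asm) nn_integral_eq_integral[OF expY]) auto
  have pt: "exp (s * (Y a - \<mu>)) \<le> 1 + s * (Y a - \<mu>) + s\<^sup>2 * (8 * exp 1) * exp (Y a)" for a
  proof -
    define D where "D = \<bar>Y a - \<mu>\<bar>"
    have D: "0 \<le> D" "D \<le> 1 + Y a" using \<mu>0 \<mu>(2) Y(2)[of a] by (auto simp: D_def)
    have "\<bar>s * (Y a - \<mu>)\<bar> \<le> 1 / 2 * D" unfolding D_def abs_mult using s by (intro mult_right_mono) auto
    then have e1: "exp \<bar>s * (Y a - \<mu>)\<bar> \<le> exp (D / 2)" by simp
    have "(s * (Y a - \<mu>))\<^sup>2 * exp \<bar>s * (Y a - \<mu>)\<bar> \<le> (s\<^sup>2 * D\<^sup>2) * exp (D / 2)"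
      using e1 by (intro mult_mono) (auto simp: D_def power_mult_distrib)
    also have "\<dots> \<le> (s\<^sup>2 * (8 * exp (D / 2))) * exp (D / 2)"
      using square_le_exp_half[OF D(1)] by (intro mult_right_mono mult_left_mono) auto
    also have "\<dots> = s\<^sup>2 * 8 * exp D" by (simp flip: exp_add)
    also have "\<dots> \<le> s\<^sup>2 * 8 * exp (1 + Y a)" using D(2) by (intro mult_left_mono) auto
    also have "\<dots> = s\<^sup>2 * (8 * exp 1) * exp (Y a)" by (simp add: exp_add)
    finally show ?thesis using exp_le_quadratic_exp[of "s * (Y a - \<mu>)"] by linarith
  qed
  let ?g = "\<lambda>a. 1 + s * (Y a - \<mu>) + s\<^sup>2 * (8 * exp 1) * exp (Y a)"
  have g: "integrable P ?g"
    by (intro Bochner_Integration.integrable_add integrable_mult_right Bochner_Integration.integrable_diff Y expY) auto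
  have "(\<integral>\<^sup>+a. ennreal (exp (s * (Y a - \<mu>))) \<partial>P) \<le> (\<integral>\<^sup>+a. ennreal (?g a) \<partial>P)"
    using pt by (intro nn_integral_mono ennreal_leI)
  also have "\<dots> = ennreal (\<integral>a. ?g a \<partial>P)"
    using pt by (intro nn_integral_eq_integral g) (auto intro: order_trans[OF exp_ge_zero])
  also have "(\<integral>a. ?g a \<partial>P) = 1 + s\<^sup>2 * (8 * exp 1) * (\<integral>a. exp (Y a) \<partial>P)"
    using Y(1) expY by (simp add: \<mu>(1) prob_space)
  also have "ennreal \<dots> \<le> ennreal (exp (60 * s\<^sup>2))"
  proof (rule ennreal_leI)
    have e272: "exp 1 \<le> (273 / 100 :: real)" using e_less_272 by simp
    have "exp 1 * exp 1 \<le> (273 / 100) * (273 / 100 :: real)" by (intro mult_mono e272) auto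
    then have ee: "8 * exp 1 * exp 1 \<le> (60 :: real)" by simp
    have "s\<^sup>2 * (8 * exp 1) * (\<integral>a. exp (Y a) \<partial>P) \<le> s\<^sup>2 * (8 * exp 1) * exp 1"
      using expY_le by (intro mult_left_mono) auto
    also have "\<dots> = s\<^sup>2 * (8 * exp 1 * exp 1)" by simp
    also have "\<dots> \<le> s\<^sup>2 * 60" using ee by (rule mult_left_mono) simp
    finally show "1 + s\<^sup>2 * (8 * exp 1) * (\<integral>a. exp (Y a) \<partial>P) \<le> exp (60 * s\<^sup>2)"
      using exp_ge_add_one_self[of "60 * s\<^sup>2"] by linarith
  qed
  finally show ?thesis .
qed

lemma evec_inner_measurable:
  assumes "vector_law d P"
  shows "(\<lambda>a. evec_inner d a w) \<in> borel_measurable P"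
proof -
  have "(\<lambda>a. evec_inner d a w) \<in> borel_measurable (PiM {..<d} (\<lambda>_. borel))"
    unfolding evec_inner_def by measurable
  moreover have "sets P = sets (PiM {..<d} (\<lambda>_. borel))"
    using assms by (simp add: vector_law_def evec_borel_def)
  ultimately show ?thesis using measurable_cong_sets[of P "PiM {..<d} (\<lambda>_. borel)" borel borel] by blast
qed

lemma isotropic_second_moment:
  assumes "isotropic d P"
  shows "integrable P (\<lambda>a. (evec_inner d a w)\<^sup>2)"
    and "(\<integral>a. (evec_inner d a w)\<^sup>2 \<partial>P) = evec_inner d w w"
proof -
  have eq: "(evec_inner d a w)\<^sup>2 = (\<Sum>k<d. \<Sum>l<d. (w k * w l) * (a k * a l))" for a
    by (simp add: evec_inner_def power2_eq_square sum_product mult_ac)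
  have int: "integrable P (\<lambda>a. (w k * w l) * (a k * a l))" if "k < d" "l < d" for k l
    using assms that by (auto simp: isotropic_def)
  show "integrable P (\<lambda>a. (evec_inner d a w)\<^sup>2)"
    unfolding eq by (intro Bochner_Integration.integrable_sum int) auto
  have "(\<integral>a. (evec_inner d a w)\<^sup>2 \<partial>P) = (\<Sum>k<d. \<Sum>l<d. \<integral>a. (w k * w l) * (a k * a l) \<partial>P)"
    unfolding eq using int by (subst Bochner_Integration.integral_sum; auto intro!: sum.cong Bochner_Integration.integral_sum)
  also have "\<dots> = (\<Sum>k<d. \<Sum>l<d. (w k * w l) * (if k = l then 1 else 0))"
    using assms by (intro sum.cong refl) (auto simp: isotropic_def)
  also have "\<dots> = evec_inner d w w" by (simp add: evec_inner_def if_distrib sum.delta cong: if_cong)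
  finally show "(\<integral>a. (evec_inner d a w)\<^sup>2 \<partial>P) = evec_inner d w w" .
qed

lemma unit_evec:
  assumes "evec_inner d w w > 0"
  defines "u \<equiv> \<lambda>i\<in>{..<d}. w i / sqrt (evec_inner d w w)"
  shows "u \<in> evec_sphere d" "evec_inner d a u = evec_inner d a w / sqrt (evec_inner d w w)"
proof -
  show inner: "evec_inner d a u = evec_inner d a w / sqrt (evec_inner d w w)" for a
    by (simp add: evec_inner_def u_def sum_divide_distrib)
  have "evec_inner d u u = 1"
    using assms(1) by (simp add: inner evec_inner_commute[of d u])
  then have "evec_norm d u = 1"
    by (simp add: evec_norm_def L2_set_def evec_inner_def power2_eq_square)
  then show "u \<in> evec_sphere d" by (auto simp: evec_sphere_def evec_def u_def)
qed

lemma sub_gaussian_scaled: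
  assumes "sub_gaussian d \<sigma> P" "evec_inner d w w > 0"
  shows "(\<integral>\<^sup>+a. ennreal (exp ((evec_inner d a w)\<^sup>2 / (\<sigma>\<^sup>2 * evec_inner d w w))) \<partial>P) \<le> ennreal (exp 1)"
proof -
  let ?u = "\<lambda>i\<in>{..<d}. w i / sqrt (evec_inner d w w)"
  have "(\<integral>\<^sup>+a. ennreal (exp ((evec_inner d a ?u)\<^sup>2 / \<sigma>\<^sup>2)) \<partial>P) \<le> ennreal (exp 1)"
    using assms unit_evec(1)[OF assms(2)] unfolding sub_gaussian_def by blast
  then show ?thesis
    using assms(2) by (simp add: unit_evec(2)[OF assms(2)] power_divide mult.commute)
qed

text \<open>Integrating e y \<le> exp y for y = <a, w>^2 / \<sigma>^2 and a unit vector w, where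
  isotropy makes the mean of y equal to 1 / \<sigma>^2, gives e / \<sigma>^2 \<le> e.\<close>

lemma sub_gaussian_isotropic_ge_one:
  assumes law: "vector_law d P" and sg: "sub_gaussian d \<sigma> P" and iso: "isotropic d P" and "\<sigma> > 0" "d > 0"
  shows "\<sigma>\<^sup>2 \<ge> 1"
proof -
  interpret prob_space P using law by (simp add: vector_law_def)
  define w where "w = (\<lambda>i::nat. if i = 0 then 1 else 0 :: real)"
  have w: "evec_inner d w w = 1"
    using \<open>d > 0\<close> by (simp add: evec_inner_def w_def if_distrib sum.delta cong: if_cong)
  note m = isotropic_second_moment[OF iso, of w]
  have "ennreal (exp 1 / \<sigma>\<^sup>2) = ennreal (\<integral>a. exp 1 * ((evec_inner d a w)\<^sup>2 / \<sigma>\<^sup>2) \<partial>P)"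
    by (simp add: m w)
  also have "\<dots> = (\<integral>\<^sup>+a. ennreal (exp 1 * ((evec_inner d a w)\<^sup>2 / \<sigma>\<^sup>2)) \<partial>P)"
    using m by (intro nn_integral_eq_integral[symmetric]) auto
  also have "\<dots> \<le> (\<integral>\<^sup>+a. ennreal (exp ((evec_inner d a w)\<^sup>2 / (\<sigma>\<^sup>2 * evec_inner d w w))) \<partial>P)"
  proof (intro nn_integral_mono ennreal_leI)
    fix a
    define y where "y = (evec_inner d a w)\<^sup>2 / \<sigma>\<^sup>2"
    have "exp 1 * y \<le> exp 1 * exp (y - 1)"
      using exp_ge_add_one_self[of "y - 1"] by (intro mult_left_mono) auto
    also have "\<dots> = exp y" by (simp flip: exp_add)
    finally show "exp 1 * ((evec_inner d a w)\<^sup>2 / \<sigma>\<^sup>2) \<le> exp ((evec_inner d a w)\<^sup>2 / (\<sigma>\<^sup>2 * evec_inner d w w))"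
      by (simp add: w y_def)
  qed
  also have "\<dots> \<le> ennreal (exp 1)" using sub_gaussian_scaled[OF sg, of w] w by simp
  finally have "exp 1 / \<sigma>\<^sup>2 \<le> exp (1::real)" by simp
  then show ?thesis using \<open>\<sigma> > 0\<close> by (simp add: field_simps)
qed

text \<open>The last bound loses the constant 1 in front of the second moment but does not depend on \<open>p\<close>;
  it controls the weak convexity of the loss.\<close>

lemma second_moment_tails:
  fixes m :: nat
  assumes law: "vector_law d P" and sg: "sub_gaussian d \<sigma> P" and iso: "isotropic d P"
    and \<sigma>: "\<sigma> > 0" and d: "d > 0" and p: "0 < p" "p \<le> 1" and W: "W = evec_inner d w w" "W > 0"
  defines "M \<equiv> PiM {..<m} (\<lambda>_. P)"
  defines "Y \<equiv> \<lambda>a. (evec_inner d a w)\<^sup>2 / (\<sigma>\<^sup>2 * W)"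
  shows "measure M {a \<in> space M. real m * (4 * p) \<le> (\<Sum>i<m. Y (a i) - 1 / \<sigma>\<^sup>2)} \<le> exp (- (real m * p\<^sup>2 / 15))"
    and "measure M {a \<in> space M. real m * (4 * p) \<le> (\<Sum>i<m. 1 / \<sigma>\<^sup>2 - Y (a i))} \<le> exp (- (real m * p\<^sup>2 / 15))"
    and "measure M {a \<in> space M. 11 / 10 * real m \<le> (\<Sum>i<m. Y (a i))} \<le> exp (- (real m / 10))"
proof -
  have P: "prob_space P" using law by (simp add: vector_law_def)
  have \<sigma>1: "\<sigma>\<^sup>2 \<ge> 1" by (rule sub_gaussian_isotropic_ge_one[OF law sg iso \<sigma> d])
  have Y: "integrable P Y" "(\<integral>a. Y a \<partial>P) = 1 / \<sigma>\<^sup>2"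
    using isotropic_second_moment[OF iso, of w] W by (auto simp: Y_def)
  have [measurable]: "Y \<in> borel_measurable P" using Y(1) by simp
  have Y0: "Y a \<ge> 0" for a using W by (simp add: Y_def)
  have eY: "(\<integral>\<^sup>+a. ennreal (exp (Y a)) \<partial>P) \<le> ennreal (exp 1)"
    using sub_gaussian_scaled[OF sg, of w] W by (simp add: Y_def)
  have \<mu>: "1 / \<sigma>\<^sup>2 \<le> 1" using frac_le[of 1 1 1 "\<sigma>\<^sup>2"] \<sigma>1 by simp
  \<comment> \<open>The parameter p / 30 is optimal for this moment bound: 60 (p / 30)^2 - (p / 30)
    (4 p) = p^2 / 15 - 2 p^2 / 15.\<close>
  have tail: "measure M {a \<in> space M. p / 30 * (real m * (4 * p)) \<le> (\<Sum>i<m. s * (Y (a i) - 1 / \<sigma>\<^sup>2))}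
     \<le> exp (- (real m * p\<^sup>2 / 15))" if s: "s = p / 30 \<or> s = - (p / 30)" for s
  proof -
    have s1: "\<bar>s\<bar> \<le> 1 / 2" and s2: "s\<^sup>2 = p\<^sup>2 / 900" using s p by (auto simp: power_divide)
    have "measure M {a \<in> space M. p / 30 * (real m * (4 * p)) \<le> (\<Sum>i<m. s * (Y (a i) - 1 / \<sigma>\<^sup>2))}
      \<le> exp (60 * s\<^sup>2) ^ m * exp (- (p / 30 * (real m * (4 * p))))"
      unfolding M_def
      by (rule measure_sum_ge_le_mgf[OF P _ _ centered_mgf_le[OF P Y(1) Y0 eY Y(2) \<mu> s1]]) auto
    also have "\<dots> = exp (- (real m * p\<^sup>2 / 15))"
      unfolding s2 by (simp add: power2_eq_square field_simps flip: exp_of_nat_mult exp_add)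
    finally show ?thesis .
  qed
  have pc: "p / 30 * x \<le> p / 30 * y \<longleftrightarrow> x \<le> y" for x y using p by simp
  show "measure M {a \<in> space M. real m * (4 * p) \<le> (\<Sum>i<m. Y (a i) - 1 / \<sigma>\<^sup>2)} \<le> exp (- (real m * p\<^sup>2 / 15))"
    using tail[of "p / 30"] unfolding sum_distrib_left[symmetric] pc by simp
  have "(\<Sum>i<m. - (p / 30) * (Y (a i) - 1 / \<sigma>\<^sup>2)) = p / 30 * (\<Sum>i<m. 1 / \<sigma>\<^sup>2 - Y (a i))" for a
    unfolding sum_distrib_left by (intro sum.cong) (auto simp: algebra_simps)
  with tail[of "- (p / 30)"]
  show "measure M {a \<in> space M. real m * (4 * p) \<le> (\<Sum>i<m. 1 / \<sigma>\<^sup>2 - Y (a i))} \<le> exp (- (real m * p\<^sup>2 / 15))"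
    by (simp only: pc simp_thms)
  have "measure M {a \<in> space M. 11 / 10 * real m \<le> (\<Sum>i<m. Y (a i))} \<le> exp 1 ^ m * exp (- (11 / 10 * real m))"
    unfolding M_def by (rule measure_sum_ge_le_mgf[OF P _ _ eY]) auto
  also have "\<dots> = exp (- (real m / 10))" by (simp flip: exp_of_nat_mult exp_add)
  finally show "measure M {a \<in> space M. 11 / 10 * real m \<le> (\<Sum>i<m. Y (a i))} \<le> exp (- (real m / 10))" .
qed

text \<open>A union bound over the net costs exp (33 d), and the fixed point argument for quadratic
  forms carries the estimate to all vectors. A single exceptional set serves both bounds; net points
  of norm zero are left out because \<open>Y\<close> divides by the squared norm.\<close>

lemma second_moment_uniform:
  fixes m :: nat
  assumes law: "vector_law d P" and sg: "sub_gaussian d \<sigma> P" and iso: "isotropic d P"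
    and \<sigma>: "\<sigma> > 0" and d: "d > 0" and p: "0 < p" "p \<le> 1" and m: "m > 0"
  defines "M \<equiv> PiM {..<m} (\<lambda>_. P)"
  shows "\<exists>A\<in>sets M. measure M A \<le> exp (33 * real d) * (2 * exp (- (real m * p\<^sup>2 / 15)) + exp (- (real m / 10))) \<and>
    (\<forall>a\<in>space M - A. \<forall>v.
      (\<Sum>i<m. (evec_inner d (a i) v)\<^sup>2) / real m \<le> (1 + 63 / 10 * \<sigma>\<^sup>2 * p) * evec_inner d v v \<and>
      (\<Sum>i<m. (evec_inner d (a i) v)\<^sup>2) / real m \<le> 2 * \<sigma>\<^sup>2 * evec_inner d v v)"
proof -
  have P: "prob_space P" using law by (simp add: vector_law_def)
  interpret M: prob_space M unfolding M_def by (intro prob_space_PiM P)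
  define Y where "Y = (\<lambda>w a. (evec_inner d a w)\<^sup>2 / (\<sigma>\<^sup>2 * evec_inner d w w))"
  define A1 where "A1 = (\<lambda>w. {a \<in> space M. real m * (4 * p) \<le> (\<Sum>i<m. Y w (a i) - 1 / \<sigma>\<^sup>2)})"
  define A2 where "A2 = (\<lambda>w. {a \<in> space M. real m * (4 * p) \<le> (\<Sum>i<m. 1 / \<sigma>\<^sup>2 - Y w (a i))})"
  define A3 where "A3 = (\<lambda>w. {a \<in> space M. 11 / 10 * real m \<le> (\<Sum>i<m. Y w (a i))})"
  let ?W = "{w \<in> ball_net d. evec_inner d w w > 0}"
  define A where "A = (\<Union>w\<in>?W. A1 w \<union> A2 w \<union> A3 w)"
  note [measurable] = evec_inner_measurable[OF law]
  have [measurable]: "Y w \<in> borel_measurable P" for w unfolding Y_def by measurable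
  have [measurable]: "(\<lambda>a. Y w (a i)) \<in> borel_measurable M" if "i \<in> {..<m}" for i w
    unfolding M_def using that by measurable
  have sets: "A1 w \<in> sets M" "A2 w \<in> sets M" "A3 w \<in> sets M" for w
    unfolding A1_def A2_def A3_def by measurable
  have finW: "finite ?W" using ball_net_finite_card(1) by simp
  have AM: "A \<in> sets M" unfolding A_def using finW sets by (intro sets.finite_UN sets.Un) auto
  let ?q = "2 * exp (- (real m * p\<^sup>2 / 15)) + exp (- (real m / 10))"
  have "measure M A \<le> (\<Sum>w\<in>?W. measure M (A1 w \<union> A2 w \<union> A3 w))"
    unfolding A_def using finW sets by (intro M.finite_measure_subadditive_finite) auto
  also have "\<dots> \<le> (\<Sum>w\<in>?W. ?q)"
  proof (rule sum_mono)
    fix w assume "w \<in> ?W"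
    then have W: "evec_inner d w w > 0" by simp
    note t = second_moment_tails[OF law sg iso \<sigma> d p refl W, of m, folded M_def]
    have "measure M (A1 w \<union> A2 w \<union> A3 w) \<le> measure M (A1 w \<union> A2 w) + measure M (A3 w)"
      using sets by (intro measure_Un_le) auto
    also have "measure M (A1 w \<union> A2 w) \<le> measure M (A1 w) + measure M (A2 w)"
      using sets by (intro measure_Un_le) auto
    finally show "measure M (A1 w \<union> A2 w \<union> A3 w) \<le> ?q"
      using t unfolding A1_def A2_def A3_def Y_def by linarith
  qed
  also have "\<dots> = real (card ?W) * ?q" by simp
  also have "\<dots> \<le> exp (33 * real d) * ?q"
  proof (rule mult_right_mono)
    have "real (card ?W) \<le> real (card (ball_net d))"
      using ball_net_finite_card(1) by (intro of_nat_mono card_mono) auto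
    then show "real (card ?W) \<le> exp (33 * real d)" using ball_net_finite_card(2)[of d] by linarith
  qed auto
  finally have le: "measure M A \<le> exp (33 * real d) * ?q" .
  have "(\<Sum>i<m. (evec_inner d (a i) v)\<^sup>2) / real m \<le> (1 + 63 / 10 * \<sigma>\<^sup>2 * p) * evec_inner d v v \<and>
      (\<Sum>i<m. (evec_inner d (a i) v)\<^sup>2) / real m \<le> 2 * \<sigma>\<^sup>2 * evec_inner d v v" if a: "a \<in> space M - A" for a v
  proof -
    \<comment> \<open>\<open>B 1\<close> is the deviation of the second moment form from the
      identity, \<open>B 0\<close> the form itself. \<open>C\<close> depends on the sample and only
      starts the iteration.\<close>
    define B where "B = (\<lambda>s u v. (\<Sum>i<m. evec_inner d (a i) u * evec_inner d (a i) v) / real m - s * evec_inner d u v)"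
    define C where "C = (\<lambda>s. (\<Sum>i<m. evec_inner d (a i) (a i)) / real m + \<bar>s\<bar>)"
    have Bvv: "B s v v = (\<Sum>i<m. (evec_inner d (a i) v)\<^sup>2) / real m - s * evec_inner d v v" for s v
      by (simp add: B_def power2_eq_square)
    have bound: "\<bar>B s v v\<bar> \<le> C s * evec_inner d v v" for s v
    proof -
      have "(\<Sum>i<m. (evec_inner d (a i) v)\<^sup>2) \<le> (\<Sum>i<m. evec_inner d (a i) (a i)) * evec_inner d v v"
        unfolding sum_distrib_right by (intro sum_mono evec_inner_cauchy_schwarz)
      then have "(\<Sum>i<m. (evec_inner d (a i) v)\<^sup>2) / real m \<le> (\<Sum>i<m. evec_inner d (a i) (a i)) * evec_inner d v v / real m"
        by (intro divide_right_mono) auto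
      moreover have "0 \<le> (\<Sum>i<m. (evec_inner d (a i) v)\<^sup>2) / real m" by (simp add: sum_nonneg)
      moreover have "\<bar>s * evec_inner d v v\<bar> = \<bar>s\<bar> * evec_inner d v v"
        using evec_inner_self_nonneg[of d v] by (simp add: abs_mult)
      ultimately show ?thesis unfolding Bvv C_def by (simp add: distrib_right)
    qed
    have main: "\<bar>B s v v\<bar> \<le> \<tau> / (79 / 100) * evec_inner d v v"
      if net: "\<And>w. w \<in> ball_net d \<Longrightarrow> evec_inner d w w > 0 \<Longrightarrow> \<bar>B s w w\<bar> \<le> \<tau>" and \<tau>: "\<tau> \<ge> 0" for s \<tau>
    proof (rule quadratic_form_bound_from_net[OF d, where B = "B s" and C = "C s"])
      show "B s (\<lambda>i. u i + v i) w = B s u w + B s v w" for u v w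
        by (simp add: B_def evec_inner_add_left evec_inner_add_right algebra_simps sum.distrib add_divide_distrib)
      show "B s (\<lambda>i. t * u i) w = t * B s u w" for t u w
        by (simp add: B_def evec_inner_scale_left evec_inner_scale_right algebra_simps sum_distrib_left)
      show "B s u v = B s v u" for u v by (simp add: B_def evec_inner_commute mult.commute)
      show "\<bar>B s v v\<bar> \<le> C s * evec_inner d v v" for v by (rule bound)
      show "\<bar>B s w w\<bar> \<le> \<tau>" if "w \<in> ball_net d" for w
        using net[OF that] bound[of s w] evec_inner_self_nonneg[of d w] \<tau> by (cases "evec_inner d w w = 0") auto
    qed
    have sumY: "(\<Sum>i<m. (evec_inner d (a i) w)\<^sup>2) = \<sigma>\<^sup>2 * evec_inner d w w * (\<Sum>i<m. Y w (a i))"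
      if "evec_inner d w w > 0" for w
      unfolding Y_def sum_distrib_left using that \<sigma> by (intro sum.cong) auto
    \<comment> \<open>Net points have squared norm up to 121/100, and passing to all vectors divides
      by 79/100. So 4 becomes 484/79 < 63/10 here, and 11/10 becomes 1331/790 < 2 for
      \<open>B 0\<close>.\<close>
    have "\<bar>B 1 v v\<bar> \<le> (121 / 100 * \<sigma>\<^sup>2 * (4 * p)) / (79 / 100) * evec_inner d v v"
    proof (rule main)
      fix w assume w: "w \<in> ball_net d" "evec_inner d w w > 0"
      then have "a \<notin> A1 w" "a \<notin> A2 w" using a by (auto simp: A_def)
      then have "\<bar>(\<Sum>i<m. Y w (a i)) - real m / \<sigma>\<^sup>2\<bar> \<le> real m * (4 * p)"
        using a by (auto simp: A1_def A2_def sum_subtractf)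
      then have "\<sigma>\<^sup>2 * evec_inner d w w / real m * \<bar>(\<Sum>i<m. Y w (a i)) - real m / \<sigma>\<^sup>2\<bar>
          \<le> \<sigma>\<^sup>2 * evec_inner d w w / real m * (real m * (4 * p))"
        using w by (intro mult_left_mono) auto
      moreover have "\<bar>B 1 w w\<bar> = \<sigma>\<^sup>2 * evec_inner d w w / real m * \<bar>(\<Sum>i<m. Y w (a i)) - real m / \<sigma>\<^sup>2\<bar>"
      proof -
        have "B 1 w w = \<sigma>\<^sup>2 * evec_inner d w w / real m * ((\<Sum>i<m. Y w (a i)) - real m / \<sigma>\<^sup>2)"
          unfolding Bvv sumY[OF w(2)] using m \<sigma> by (simp add: field_simps)
        then show ?thesis using w(2) by (simp add: abs_mult)
      qed
      ultimately have "\<bar>B 1 w w\<bar> \<le> evec_inner d w w * (\<sigma>\<^sup>2 * (4 * p))" using m by (simp add: mult_ac)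
      also have "\<dots> \<le> 121 / 100 * (\<sigma>\<^sup>2 * (4 * p))"
        using w(1) p by (intro mult_right_mono) (auto simp: ball_net_def)
      finally show "\<bar>B 1 w w\<bar> \<le> 121 / 100 * \<sigma>\<^sup>2 * (4 * p)" by simp
    qed (use p in simp)
    also have "\<dots> \<le> 63 / 10 * \<sigma>\<^sup>2 * p * evec_inner d v v"
      using p by (intro mult_right_mono evec_inner_self_nonneg) auto
    finally have 1: "\<bar>B 1 v v\<bar> \<le> 63 / 10 * \<sigma>\<^sup>2 * p * evec_inner d v v" .
    have "\<bar>B 0 v v\<bar> \<le> (121 / 100 * (11 / 10 * \<sigma>\<^sup>2)) / (79 / 100) * evec_inner d v v"
    proof (rule main)
      fix w assume w: "w \<in> ball_net d" "evec_inner d w w > 0"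
      then have "a \<notin> A3 w" using a by (auto simp: A_def)
      then have "(\<Sum>i<m. Y w (a i)) \<le> 11 / 10 * real m" using a by (auto simp: A3_def)
      then have "\<sigma>\<^sup>2 * evec_inner d w w / real m * (\<Sum>i<m. Y w (a i))
          \<le> \<sigma>\<^sup>2 * evec_inner d w w / real m * (11 / 10 * real m)"
        using w by (intro mult_left_mono) auto
      moreover have "\<bar>B 0 w w\<bar> = \<sigma>\<^sup>2 * evec_inner d w w / real m * (\<Sum>i<m. Y w (a i))"
        using sumY[OF w(2)] by (simp add: Bvv) (metis abs_of_nonneg sum_nonneg zero_le_power2)
      ultimately have "\<bar>B 0 w w\<bar> \<le> evec_inner d w w * (11 / 10 * \<sigma>\<^sup>2)" using m by (simp add: mult_ac)
      also have "\<dots> \<le> 121 / 100 * (11 / 10 * \<sigma>\<^sup>2)"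
        using w(1) by (intro mult_right_mono) (auto simp: ball_net_def)
      finally show "\<bar>B 0 w w\<bar> \<le> 121 / 100 * (11 / 10 * \<sigma>\<^sup>2)" .
    qed simp
    also have "\<dots> \<le> 2 * \<sigma>\<^sup>2 * evec_inner d v v"
      by (intro mult_right_mono evec_inner_self_nonneg) auto
    finally have 2: "\<bar>B 0 v v\<bar> \<le> 2 * \<sigma>\<^sup>2 * evec_inner d v v" .
    have "B 1 v v \<le> 63 / 10 * \<sigma>\<^sup>2 * p * evec_inner d v v" "B 0 v v \<le> 2 * \<sigma>\<^sup>2 * evec_inner d v v"
      using 1 2 by (auto simp only: abs_le_iff)
    then show ?thesis unfolding Bvv distrib_right by (intro conjI) linarith+
  qed
  with AM le show ?thesis by blast
qed

section \<open>Subgradients of the phase loss\<close>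

lemma evec_inner_diff [simp]:
  "evec_inner d a (evec_diff d x y) = evec_inner d a x - evec_inner d a y"
  "evec_inner d (evec_diff d x y) a = evec_inner d x a - evec_inner d y a"
  by (simp_all add: evec_inner_def evec_diff_def algebra_simps sum_subtractf)

lemma evec_inner_add [simp]:
  "evec_inner d a (evec_add d x y) = evec_inner d a x + evec_inner d a y"
  "evec_inner d (evec_add d x y) a = evec_inner d x a + evec_inner d y a"
  by (simp_all add: evec_inner_def evec_add_def algebra_simps sum.distrib)

lemma evec_inner_scale [simp]:
  "evec_inner d a (evec_scale d t x) = t * evec_inner d a x"
  "evec_inner d (evec_scale d t x) a = t * evec_inner d x a"
  by (simp_all add: evec_inner_def evec_scale_def sum_distrib_left mult_ac)

lemma evec_closed [simp]:
  "evec_diff d x y \<in> evec d" "evec_add d x y \<in> evec d" "evec_scale d t x \<in> evec d"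
  by (simp_all add: evec_def evec_diff_def evec_add_def evec_scale_def)

lemma evec_norm_eq_sqrt: "evec_norm d v = sqrt (evec_inner d v v)"
  by (simp add: evec_norm_def L2_set_def evec_inner_def power2_eq_square)

lemma evec_norm_nonneg [simp]: "0 \<le> evec_norm d v"
  by (simp add: evec_norm_eq_sqrt evec_inner_self_nonneg)

lemma evec_norm_square: "(evec_norm d v)\<^sup>2 = evec_inner d v v"
  by (simp add: evec_norm_eq_sqrt evec_inner_self_nonneg)

lemma abs_evec_inner_le: "\<bar>evec_inner d u v\<bar> \<le> evec_norm d u * evec_norm d v"
proof (rule power2_le_imp_le)
  show "\<bar>evec_inner d u v\<bar>\<^sup>2 \<le> (evec_norm d u * evec_norm d v)\<^sup>2"
    unfolding power_mult_distrib evec_norm_square power2_abs by (rule evec_inner_cauchy_schwarz)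
qed simp

lemma evec_norm_diff_commute: "evec_norm d (evec_diff d x y) = evec_norm d (evec_diff d y x)"
  by (simp add: evec_norm_eq_sqrt)

lemma evec_norm_le_add:
  assumes "\<And>a. evec_inner d a w = evec_inner d a u + evec_inner d a v"
  shows "evec_norm d w \<le> evec_norm d u + evec_norm d v"
proof (rule power2_le_imp_le)
  have left: "evec_inner d w a = evec_inner d u a + evec_inner d v a" for a
    using assms[of a] unfolding evec_inner_commute[of d w a] evec_inner_commute[of d u a] evec_inner_commute[of d v a] .
  have "evec_inner d w w = evec_inner d u u + 2 * evec_inner d u v + evec_inner d v v"
    unfolding assms left using evec_inner_commute[of d u v] by simp
  also have "evec_inner d u v \<le> evec_norm d u * evec_norm d v"
    using abs_evec_inner_le[of d u v] by simp
  finally show "(evec_norm d w)\<^sup>2 \<le> (evec_norm d u + evec_norm d v)\<^sup>2"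
    by (simp add: power2_sum evec_norm_square)
qed simp

lemma evec_norm_pos:
  assumes "v \<in> evec d" "v \<noteq> evec_zero d"
  shows "evec_norm d v > 0"
proof (rule ccontr)
  assume "\<not> ?thesis"
  then have "(\<Sum>i<d. v i * v i) = 0"
    using evec_norm_nonneg[of d v] evec_inner_self_nonneg[of d v]
    by (simp add: evec_norm_eq_sqrt evec_inner_def)
  then have "\<forall>i\<in>{..<d}. v i * v i = 0" by (subst (asm) sum_nonneg_eq_0_iff) auto
  then have "v = evec_zero d"
    using assms(1) by (auto simp: evec_def evec_zero_def PiE_def extensional_def restrict_def fun_eq_iff)
  then show False using assms(2) by simp
qed

lemma evec_norm_diff_tendsto_coord:
  assumes "(\<lambda>n. evec_norm d (evec_diff d (xs n) x)) \<longlonglongrightarrow> 0" "i < d"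
  shows "(\<lambda>n. xs n i) \<longlonglongrightarrow> x i"
proof -
  have "\<bar>xs n i - x i\<bar> \<le> evec_norm d (evec_diff d (xs n) x)" for n
    unfolding evec_norm_def using member_le_L2_set[of "{..<d}" i "\<lambda>i. \<bar>evec_diff d (xs n) x i\<bar>"] assms(2)
    by (simp add: evec_diff_def L2_set_def)
  then have "(\<lambda>n. xs n i - x i) \<longlonglongrightarrow> 0"
    by (intro tendsto_rabs_zero_cancel[OF tendsto_sandwich[OF _ _ tendsto_const assms(1)]]) auto
  then show ?thesis using LIM_zero_iff by blast
qed

lemma evec_inner_tendsto:
  assumes "\<And>i. i < d \<Longrightarrow> (\<lambda>n. u n i) \<longlonglongrightarrow> u' i" "\<And>i. i < d \<Longrightarrow> (\<lambda>n. v n i) \<longlonglongrightarrow> v' i"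
  shows "(\<lambda>n. evec_inner d (u n) (v n)) \<longlonglongrightarrow> evec_inner d u' v'"
  unfolding evec_inner_def using assms by (intro tendsto_sum tendsto_mult) auto

context
  fixes d m :: nat and a :: "nat \<Rightarrow> nat \<Rightarrow> real" and b :: "nat \<Rightarrow> real" and \<Lambda>1 \<Lambda>2 :: real
  assumes m: "m > 0"
    and up1: "\<And>v. (\<Sum>i<m. (evec_inner d (a i) v)\<^sup>2) / real m \<le> \<Lambda>1 * evec_inner d v v"
    and up2: "\<And>v. (\<Sum>i<m. (evec_inner d (a i) v)\<^sup>2) / real m \<le> \<Lambda>2 * evec_inner d v v"
    and \<Lambda>: "\<Lambda>1 > 0" "\<Lambda>2 > 0"
begin

text \<open>Along a segment a square equals its linear interpolation minus t (1 - t) times the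
  squared increment. After the absolute value this defect is the only loss per term, and its mean is
  a second moment. The point \<open>y\<close> is described by its inner products, which is all that
  the loss depends on.\<close>

lemma phase_loss_weakly_convex:
  assumes t: "0 \<le> t" "t \<le> 1"
    and y: "\<And>u. evec_inner d u y = (1 - t) * evec_inner d u x + t * evec_inner d u z"
  shows "phase_loss d m a b y \<le> (1 - t) * phase_loss d m a b x + t * phase_loss d m a b z
    + t * (1 - t) * (\<Lambda>2 * evec_inner d (evec_diff d z x) (evec_diff d z x))"
proof -
  let ?p = "\<lambda>i. evec_inner d (a i) x" and ?q = "\<lambda>i. evec_inner d (a i) z"
  have "\<bar>(evec_inner d (a i) y)\<^sup>2 - b i\<bar> \<le>
      (1 - t) * \<bar>(?p i)\<^sup>2 - b i\<bar> + t * \<bar>(?q i)\<^sup>2 - b i\<bar> + t * (1 - t) * (?q i - ?p i)\<^sup>2" for i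
  proof -
    define A where "A = (?p i)\<^sup>2 - b i"
    define B where "B = (?q i)\<^sup>2 - b i"
    define C where "C = (?q i - ?p i)\<^sup>2"
    have 1: "(evec_inner d (a i) y)\<^sup>2 - b i = (1 - t) * A + t * B - t * (1 - t) * C"
      unfolding y A_def B_def C_def by (simp add: power2_eq_square algebra_simps)
    have tri: "\<bar>X + Y - Z\<bar> \<le> \<bar>X\<bar> + \<bar>Y\<bar> + \<bar>Z\<bar>" for X Y Z :: real by linarith
    have 2: "\<bar>(1 - t) * A\<bar> = (1 - t) * \<bar>A\<bar>" "\<bar>t * B\<bar> = t * \<bar>B\<bar>" "\<bar>t * (1 - t) * C\<bar> = t * (1 - t) * C"
      using t by (simp_all add: abs_mult C_def)
    have "\<bar>(evec_inner d (a i) y)\<^sup>2 - b i\<bar> \<le> (1 - t) * \<bar>A\<bar> + t * \<bar>B\<bar> + t * (1 - t) * C"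
      using tri[of "(1 - t) * A" "t * B" "t * (1 - t) * C"] unfolding 1 2 .
    then show ?thesis unfolding A_def B_def C_def .
  qed
  then have "(\<Sum>i<m. \<bar>(evec_inner d (a i) y)\<^sup>2 - b i\<bar>) \<le>
      (\<Sum>i<m. (1 - t) * \<bar>(?p i)\<^sup>2 - b i\<bar> + t * \<bar>(?q i)\<^sup>2 - b i\<bar> + t * (1 - t) * (?q i - ?p i)\<^sup>2)"
    by (intro sum_mono)
  then have "phase_loss d m a b y \<le> 1 / real m *
      (\<Sum>i<m. (1 - t) * \<bar>(?p i)\<^sup>2 - b i\<bar> + t * \<bar>(?q i)\<^sup>2 - b i\<bar> + t * (1 - t) * (?q i - ?p i)\<^sup>2)"
    unfolding phase_loss_def by (intro mult_left_mono) auto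
  also have "\<dots> = (1 - t) * phase_loss d m a b x + t * phase_loss d m a b z
      + t * (1 - t) * ((\<Sum>i<m. (?q i - ?p i)\<^sup>2) / real m)"
    by (simp add: phase_loss_def sum.distrib sum_distrib_left add_divide_distrib sum_divide_distrib)
  also have "(\<Sum>i<m. (?q i - ?p i)\<^sup>2) / real m \<le> \<Lambda>2 * evec_inner d (evec_diff d z x) (evec_diff d z x)"
    using up2[of "evec_diff d z x"] by simp
  finally show ?thesis using t by (simp add: mult_left_mono)
qed

text \<open>The defining inequality is only local. It is applied at a point a fraction t of the way
  to z, where weak convexity bounds the loss from above by its values at x and z; then t divides out
  and the error e tends to 0.\<close>

lemma frechet_subdiff_global:
  assumes v: "v \<in> frechet_subdiff d (phase_loss d m a b) x" and z: "z \<in> evec d"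
  shows "phase_loss d m a b x + evec_inner d v (evec_diff d z x)
    - \<Lambda>2 * evec_inner d (evec_diff d z x) (evec_diff d z x) \<le> phase_loss d m a b z"
proof -
  let ?F = "phase_loss d m a b" and ?w = "evec_diff d z x"
  define n where "n = evec_norm d ?w"
  have n: "n \<ge> 0" by (simp add: n_def)
  have eps: "?F x + evec_inner d v ?w - \<Lambda>2 * evec_inner d ?w ?w \<le> ?F z + e * n" if e: "e > 0" for e
  proof -
    from v e obtain \<delta> where \<delta>: "\<delta> > 0" "\<And>y. y \<in> evec d \<Longrightarrow> evec_norm d (evec_diff d y x) < \<delta> \<Longrightarrow>
        ?F y \<ge> ?F x + evec_inner d v (evec_diff d y x) - e * evec_norm d (evec_diff d y x)"
      unfolding frechet_subdiff_def by blast
    \<comment> \<open>Small enough to bring \<open>y\<close> within \<delta> of \<open>x\<close>;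
      the denominator n + 1 also covers z = x. Afterwards 1 - t is just estimated by 1.\<close>
    define t where "t = min 1 (\<delta> / (2 * (n + 1)))"
    have t: "0 < t" "t \<le> 1" using \<delta>(1) n by (auto simp: t_def)
    have "t * n \<le> \<delta> / (2 * (n + 1)) * n" using n by (intro mult_right_mono) (auto simp: t_def)
    also have "\<dots> = \<delta> * (n / (2 * (n + 1)))" by simp
    also have "\<dots> < \<delta> * 1" using \<delta>(1) n by (intro mult_strict_left_mono) auto
    also have "\<dots> = \<delta>" by simp
    finally have tn: "t * n < \<delta>" .
    define y where "y = evec_add d (evec_scale d (1 - t) x) (evec_scale d t z)"
    have y: "y \<in> evec d" "\<And>u. evec_inner d u y = (1 - t) * evec_inner d u x + t * evec_inner d u z"
      by (simp_all add: y_def)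
    have yx: "evec_inner d u (evec_diff d y x) = t * evec_inner d u ?w" for u
      by (simp add: y(2) algebra_simps)
    have "evec_inner d (evec_diff d y x) (evec_diff d y x) = t * t * evec_inner d ?w ?w"
      by (subst yx, subst evec_inner_commute, subst yx) (simp add: evec_inner_commute)
    then have ny: "evec_norm d (evec_diff d y x) = t * n"
      using t by (simp add: evec_norm_eq_sqrt n_def real_sqrt_mult)
    have "?F x + t * evec_inner d v ?w - e * (t * n) \<le> ?F y"
      using \<delta>(2)[OF y(1)] tn by (simp only: ny yx)
    also have "\<dots> \<le> (1 - t) * ?F x + t * ?F z + t * (1 - t) * (\<Lambda>2 * evec_inner d ?w ?w)"
      using t by (intro phase_loss_weakly_convex y(2)) auto
    also have "t * (1 - t) * (\<Lambda>2 * evec_inner d ?w ?w) \<le> t * (\<Lambda>2 * evec_inner d ?w ?w)"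
      using t \<Lambda> evec_inner_self_nonneg[of d ?w] by (intro mult_right_mono) auto
    finally have "t * (?F x + evec_inner d v ?w - \<Lambda>2 * evec_inner d ?w ?w) \<le> t * (?F z + e * n)"
      by (simp add: algebra_simps)
    then show ?thesis using t by simp
  qed
  show ?thesis
  proof (rule field_le_epsilon)
    fix e :: real assume e: "e > 0"
    have "e / (n + 1) * n \<le> e" using e n by (simp add: field_simps)
    then show "?F x + evec_inner d v ?w - \<Lambda>2 * evec_inner d ?w ?w \<le> ?F z + e"
      using eps[of "e / (n + 1)"] e n by (smt (verit) divide_pos_pos)
  qed
qed

lemma sum_abs_inner_le:
  "(\<Sum>i<m. \<bar>evec_inner d (a i) u * evec_inner d (a i) v\<bar>) / real m \<le> \<Lambda>1 * (evec_norm d u * evec_norm d v)"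
proof (rule power2_le_imp_le)
  have "(\<Sum>i<m. \<bar>evec_inner d (a i) u * evec_inner d (a i) v\<bar>)\<^sup>2
      \<le> (\<Sum>i<m. (evec_inner d (a i) u)\<^sup>2) * (\<Sum>i<m. (evec_inner d (a i) v)\<^sup>2)"
    using Cauchy_Schwarz_ineq_sum[of "\<lambda>i. \<bar>evec_inner d (a i) u\<bar>" "\<lambda>i. \<bar>evec_inner d (a i) v\<bar>" "{..<m}"]
    by (simp add: abs_mult)
  then have "((\<Sum>i<m. \<bar>evec_inner d (a i) u * evec_inner d (a i) v\<bar>) / real m)\<^sup>2
      \<le> (\<Sum>i<m. (evec_inner d (a i) u)\<^sup>2) / real m * ((\<Sum>i<m. (evec_inner d (a i) v)\<^sup>2) / real m)"
    using m by (simp add: power_divide divide_right_mono power2_eq_square)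
  also have "\<dots> \<le> (\<Lambda>1 * evec_inner d u u) * (\<Lambda>1 * evec_inner d v v)"
    using up1 \<Lambda> evec_inner_self_nonneg by (intro mult_mono divide_nonneg_nonneg sum_nonneg) auto
  finally show "((\<Sum>i<m. \<bar>evec_inner d (a i) u * evec_inner d (a i) v\<bar>) / real m)\<^sup>2
      \<le> (\<Lambda>1 * (evec_norm d u * evec_norm d v))\<^sup>2"
    by (simp add: power_mult_distrib evec_norm_square power2_eq_square[of \<Lambda>1] mult_ac)
qed (use \<Lambda> in auto)

text \<open>The subgradient inequality is tested in the direction of v itself. The loss at x + t v
  grows by at most 2 t \<Lambda>1 |x| |v| plus a term of order t^2, whereas the subgradient predicts
  growth t |v|^2; dividing by t and letting it tend to 0 compares the two.\<close>

lemma frechet_subdiff_norm_le: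
  assumes v: "v \<in> frechet_subdiff d (phase_loss d m a b) x"
  shows "evec_norm d v \<le> 2 * \<Lambda>1 * evec_norm d x"
proof -
  let ?F = "phase_loss d m a b"
  have tri: "\<bar>A + (B + C)\<bar> \<le> \<bar>A\<bar> + (\<bar>B\<bar> + \<bar>C\<bar>)" for A B C :: real by linarith
  have lim: "evec_inner d v v \<le> 2 * \<Lambda>1 * (evec_norm d x * evec_norm d v) + t * ((\<Lambda>1 + \<Lambda>2) * evec_inner d v v)"
    if t: "t > 0" for t
  proof -
    define z where "z = evec_add d x (evec_scale d t v)"
    have zx: "evec_inner d u (evec_diff d z x) = t * evec_inner d u v" for u by (simp add: z_def)
    have "evec_inner d (evec_diff d z x) (evec_diff d z x) = t * t * evec_inner d v v"
      by (subst zx, subst evec_inner_commute, subst zx) simp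
    with frechet_subdiff_global[OF v, of z]
    have 1: "?F x + t * evec_inner d v v - \<Lambda>2 * (t * t * evec_inner d v v) \<le> ?F z"
      unfolding zx by (simp add: z_def)
    have "\<bar>(evec_inner d (a i) z)\<^sup>2 - b i\<bar> \<le> \<bar>(evec_inner d (a i) x)\<^sup>2 - b i\<bar>
        + (2 * t * \<bar>evec_inner d (a i) x * evec_inner d (a i) v\<bar> + t * t * (evec_inner d (a i) v)\<^sup>2)" for i
    proof -
      define A where "A = (evec_inner d (a i) x)\<^sup>2 - b i"
      define p where "p = evec_inner d (a i) x * evec_inner d (a i) v"
      define q where "q = (evec_inner d (a i) v)\<^sup>2"
      have "(evec_inner d (a i) z)\<^sup>2 - b i = A + (2 * t * p + t * t * q)"
        by (simp add: A_def p_def q_def z_def power2_eq_square algebra_simps)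
      moreover have "\<bar>A + (2 * t * p + t * t * q)\<bar> \<le> \<bar>A\<bar> + (\<bar>2 * t * p\<bar> + \<bar>t * t * q\<bar>)"
        by (rule tri)
      moreover have "\<bar>2 * t * p\<bar> = 2 * t * \<bar>p\<bar>" "\<bar>t * t * q\<bar> = t * t * q"
        using t by (simp_all add: abs_mult q_def)
      ultimately show ?thesis unfolding A_def p_def q_def by linarith
    qed
    then have "(\<Sum>i<m. \<bar>(evec_inner d (a i) z)\<^sup>2 - b i\<bar>) \<le> (\<Sum>i<m. \<bar>(evec_inner d (a i) x)\<^sup>2 - b i\<bar>
        + (2 * t * \<bar>evec_inner d (a i) x * evec_inner d (a i) v\<bar> + t * t * (evec_inner d (a i) v)\<^sup>2))"
      by (intro sum_mono)
    then have "?F z \<le> 1 / real m * (\<Sum>i<m. \<bar>(evec_inner d (a i) x)\<^sup>2 - b i\<bar>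
        + (2 * t * \<bar>evec_inner d (a i) x * evec_inner d (a i) v\<bar> + t * t * (evec_inner d (a i) v)\<^sup>2))"
      unfolding phase_loss_def by (intro mult_left_mono) auto
    also have "\<dots> = ?F x + 2 * t * ((\<Sum>i<m. \<bar>evec_inner d (a i) x * evec_inner d (a i) v\<bar>) / real m)
        + t * t * ((\<Sum>i<m. (evec_inner d (a i) v)\<^sup>2) / real m)"
      by (simp add: phase_loss_def sum.distrib sum_distrib_left add_divide_distrib sum_divide_distrib)
    also have "\<dots> \<le> ?F x + 2 * t * (\<Lambda>1 * (evec_norm d x * evec_norm d v)) + t * t * (\<Lambda>1 * evec_inner d v v)"
      using t sum_abs_inner_le up1 by (intro add_mono mult_left_mono) auto
    finally have "t * evec_inner d v v
      \<le> t * (2 * \<Lambda>1 * (evec_norm d x * evec_norm d v) + t * ((\<Lambda>1 + \<Lambda>2) * evec_inner d v v))"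
      using 1 by (simp add: algebra_simps)
    then show ?thesis using t by simp
  qed
  have "evec_inner d v v \<le> 2 * \<Lambda>1 * (evec_norm d x * evec_norm d v)"
  proof (rule field_le_epsilon)
    fix e :: real assume e: "e > 0"
    define c where "c = (\<Lambda>1 + \<Lambda>2) * evec_inner d v v"
    have c: "c \<ge> 0" using \<Lambda> evec_inner_self_nonneg by (simp add: c_def)
    have "e / (c + 1) * c \<le> e" "e / (c + 1) > 0" using e c by (auto simp: field_simps)
    with lim[of "e / (c + 1)", folded c_def] show "evec_inner d v v \<le> 2 * \<Lambda>1 * (evec_norm d x * evec_norm d v) + e"
      by linarith
  qed
  then have "evec_norm d v * evec_norm d v \<le> (2 * \<Lambda>1 * evec_norm d x) * evec_norm d v"
    unfolding evec_norm_square[symmetric] power2_eq_square by (simp only: mult_ac)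
  moreover have "0 \<le> 2 * \<Lambda>1 * evec_norm d x" using \<Lambda> by simp
  ultimately show ?thesis
    using evec_norm_nonneg[of d v] by (cases "evec_norm d v = 0") (auto simp: mult_le_cancel_right)
qed

text \<open>For Frechet subgradients both inequalities hold globally, with constants independent of
  the base point. They are closed conditions in the point, the loss value and the subgradient, so
  they survive the limit.\<close>

lemma limiting_subdiff_bounds:
  assumes \<zeta>: "\<zeta> \<in> limiting_subdiff d (phase_loss d m a b) x" and z: "z \<in> evec d"
  shows "phase_loss d m a b x + evec_inner d \<zeta> (evec_diff d z x)
    - \<Lambda>2 * evec_inner d (evec_diff d z x) (evec_diff d z x) \<le> phase_loss d m a b z"
    and "evec_norm d \<zeta> \<le> 2 * \<Lambda>1 * evec_norm d x"
proof -
  let ?F = "phase_loss d m a b"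
  from \<zeta> obtain xs vs where xs: "\<And>n. vs n \<in> frechet_subdiff d ?F (xs n)"
    "(\<lambda>n. evec_norm d (evec_diff d (xs n) x)) \<longlonglongrightarrow> 0" "(\<lambda>n. ?F (xs n)) \<longlonglongrightarrow> ?F x"
    "(\<lambda>n. evec_norm d (evec_diff d (vs n) \<zeta>)) \<longlonglongrightarrow> 0"
    unfolding limiting_subdiff_def by blast
  note cx = evec_norm_diff_tendsto_coord[OF xs(2)] and cv = evec_norm_diff_tendsto_coord[OF xs(4)]
  have cw: "(\<lambda>n. evec_diff d z (xs n) i) \<longlonglongrightarrow> evec_diff d z x i" if "i < d" for i
    using cx[OF that] that by (auto simp: evec_diff_def intro!: tendsto_intros)
  have "(\<lambda>n. ?F (xs n) + evec_inner d (vs n) (evec_diff d z (xs n))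
      - \<Lambda>2 * evec_inner d (evec_diff d z (xs n)) (evec_diff d z (xs n)))
    \<longlonglongrightarrow> ?F x + evec_inner d \<zeta> (evec_diff d z x) - \<Lambda>2 * evec_inner d (evec_diff d z x) (evec_diff d z x)"
    by (intro tendsto_intros xs(3) evec_inner_tendsto cw cv)
  then show "?F x + evec_inner d \<zeta> (evec_diff d z x)
      - \<Lambda>2 * evec_inner d (evec_diff d z x) (evec_diff d z x) \<le> ?F z"
    by (rule LIMSEQ_le_const2) (use frechet_subdiff_global[OF xs(1) z] in blast)
  show "evec_norm d \<zeta> \<le> 2 * \<Lambda>1 * evec_norm d x"
  proof (rule LIMSEQ_le)
    show "(\<lambda>n. evec_norm d (vs n)) \<longlonglongrightarrow> evec_norm d \<zeta>"
      unfolding evec_norm_eq_sqrt by (intro tendsto_intros evec_inner_tendsto cv)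
    show "(\<lambda>n. 2 * \<Lambda>1 * evec_norm d (xs n)) \<longlonglongrightarrow> 2 * \<Lambda>1 * evec_norm d x"
      unfolding evec_norm_eq_sqrt by (intro tendsto_intros evec_inner_tendsto cx)
  qed (use frechet_subdiff_norm_le[OF xs(1)] in blast)
qed

end

section \<open>Linear convergence of the subgradient iteration\<close>

lemma evec_norm_le_norm_add_diff:
  "evec_norm d x \<le> evec_norm d s + evec_norm d (evec_diff d x s)"
  by (rule evec_norm_le_add) simp

lemma phase_loss_eq_product:
  assumes "\<And>i. i < m \<Longrightarrow> b i = (evec_inner d (a i) s)\<^sup>2"
  shows "phase_loss d m a b x =
    (\<Sum>i<m. \<bar>evec_inner d (a i) (evec_diff d x s) * evec_inner d (a i) (evec_add d x s)\<bar>) / real m"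
proof -
  have "(\<Sum>i<m. \<bar>(evec_inner d (a i) x)\<^sup>2 - b i\<bar>) =
      (\<Sum>i<m. \<bar>evec_inner d (a i) (evec_diff d x s) * evec_inner d (a i) (evec_add d x s)\<bar>)"
  proof (rule sum.cong)
    fix i assume "i \<in> {..<m}"
    then have "b i = (evec_inner d (a i) s)\<^sup>2" using assms by simp
    then have "(evec_inner d (a i) x)\<^sup>2 - b i
        = evec_inner d (a i) (evec_diff d x s) * evec_inner d (a i) (evec_add d x s)"
      by (simp add: power2_eq_square algebra_simps)
    then show "\<bar>(evec_inner d (a i) x)\<^sup>2 - b i\<bar> =
        \<bar>evec_inner d (a i) (evec_diff d x s) * evec_inner d (a i) (evec_add d x s)\<bar>" by (simp only:)
  qed simp
  then show ?thesis by (simp only: phase_loss_def mult.commute[of "1 / real m"] times_divide_eq_right mult_1_right)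
qed

text \<open>Triangle inequality for 2 s = (x + s) + (s - x), with 31/16 = 2 - 1/16.\<close>

lemma near_solution_norm_sum:
  assumes "evec_norm d (evec_diff d x s) \<le> r * evec_norm d s" "r \<le> 1 / 16"
  shows "31 / 16 * evec_norm d s \<le> evec_norm d (evec_add d x s)"
proof -
  have "evec_norm d (evec_scale d 2 s) \<le> evec_norm d (evec_add d x s) + evec_norm d (evec_diff d s x)"
    by (rule evec_norm_le_add) simp
  moreover have "evec_norm d (evec_scale d 2 s) = 2 * evec_norm d s"
    by (simp add: evec_norm_eq_sqrt real_sqrt_mult)
  moreover have "r * evec_norm d s \<le> 1 / 16 * evec_norm d s" using assms(2) by (intro mult_right_mono) auto
  ultimately show ?thesis using assms(1) evec_norm_diff_commute[of d s x] by linarith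
qed

context
  fixes d m :: nat and a :: "nat \<Rightarrow> nat \<Rightarrow> real" and b :: "nat \<Rightarrow> real" and \<Lambda>1 \<Lambda>2 g r :: real
    and s :: "nat \<Rightarrow> real"
  assumes m: "m > 0"
    and up1: "\<And>v. (\<Sum>i<m. (evec_inner d (a i) v)\<^sup>2) / real m \<le> \<Lambda>1 * evec_inner d v v"
    and up2: "\<And>v. (\<Sum>i<m. (evec_inner d (a i) v)\<^sup>2) / real m \<le> \<Lambda>2 * evec_inner d v v"
    and low: "\<And>u v. 3 / 8 * g * (evec_norm d u * evec_norm d v) \<le>
      (\<Sum>i<m. \<bar>evec_inner d (a i) u * evec_inner d (a i) v\<bar>) / real m"
    and pos: "\<Lambda>1 > 0" "\<Lambda>2 > 0" "g > 0"
    and r: "0 \<le> r" "r \<le> 1 / 16" "2 * \<Lambda>2 * r \<le> g / 4"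
    and s: "s \<in> evec d" "s \<noteq> evec_zero d" and b: "\<And>i. i < m \<Longrightarrow> b i = (evec_inner d (a i) s)\<^sup>2"
begin

lemma phase_loss_at_solution: "phase_loss d m a b s = 0"
  using b by (simp add: phase_loss_def)

lemma phase_loss_infimum: "(INF y\<in>evec d. phase_loss d m a b y) = 0"
proof (rule cInf_eq_minimum)
  show "0 \<in> phase_loss d m a b ` evec d"
    by (rule image_eqI[where x = s]) (use s(1) phase_loss_at_solution in auto)
  show "0 \<le> y" if "y \<in> phase_loss d m a b ` evec d" for y
    using that by (auto simp: phase_loss_def sum_nonneg)
qed

text \<open>The Polyak step length makes the squared length of the step equal to \<tau> f, so the
  squared distance changes by - 2 \<tau> <\<zeta>, x - s> + \<tau> f. Weak convexity bounds the
  inner product below by f - \<Lambda>2 D^2. Near the solution sharpness dominates the quadratic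
  error, so a fixed multiple of (f / |\<zeta>|)^2 is gained.\<close>

lemma polyak_step_contracts:
  assumes \<zeta>: "\<zeta> \<in> limiting_subdiff d (phase_loss d m a b) x" "\<zeta> \<noteq> evec_zero d"
    and near: "evec_norm d (evec_diff d x s) \<le> r * evec_norm d s"
  defines "x' \<equiv> evec_diff d x (evec_scale d (phase_loss d m a b x / (evec_norm d \<zeta>)\<^sup>2) \<zeta>)"
  shows "(evec_norm d (evec_diff d x' s))\<^sup>2 \<le>
    (1 - (g / (sqrt 32 * \<Lambda>1 * (1 + r)))\<^sup>2) * (evec_norm d (evec_diff d x s))\<^sup>2"
proof -
  define f where "f = phase_loss d m a b x"
  define D where "D = evec_norm d (evec_diff d x s)"
  define S where "S = evec_norm d (evec_add d x s)"
  define n where "n = evec_norm d s"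
  define z where "z = evec_norm d \<zeta>"
  define \<tau> where "\<tau> = f / z\<^sup>2"
  have \<zeta>d: "\<zeta> \<in> evec d" using \<zeta>(1) by (simp add: limiting_subdiff_def)
  have zpos: "z > 0" unfolding z_def by (rule evec_norm_pos[OF \<zeta>d \<zeta>(2)])
  have n: "n > 0" unfolding n_def by (rule evec_norm_pos[OF s])
  have D: "0 \<le> D" "D \<le> r * n" using near by (simp_all add: D_def n_def)
  have S: "31 / 16 * n \<le> S" using near_solution_norm_sum[OF near r(2)] by (simp add: S_def n_def)
  have fl: "3 / 8 * g * (D * S) \<le> f"
  proof -
    have "f = (\<Sum>i<m. \<bar>evec_inner d (a i) (evec_diff d x s) * evec_inner d (a i) (evec_add d x s)\<bar>) / real m"
      unfolding f_def by (rule phase_loss_eq_product) (rule b)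
    then show ?thesis unfolding D_def S_def by (simp only: low)
  qed
  have f0: "f \<ge> 0" unfolding f_def by (simp add: phase_loss_def sum_nonneg)
  have \<tau>0: "\<tau> \<ge> 0" using f0 by (simp add: \<tau>_def)
  have xn: "evec_norm d x \<le> (1 + r) * n"
    using evec_norm_le_norm_add_diff[of d x s] near by (simp add: n_def distrib_right)
  have zb: "z \<le> 2 * \<Lambda>1 * ((1 + r) * n)"
  proof -
    have "z \<le> 2 * \<Lambda>1 * evec_norm d x"
      unfolding z_def by (rule limiting_subdiff_bounds(2)[OF m up1 up2 pos(1,2) \<zeta>(1) s(1)])
    also have "\<dots> \<le> 2 * \<Lambda>1 * ((1 + r) * n)" using xn pos by (intro mult_left_mono) auto
    finally show ?thesis .
  qed
  have DD: "evec_inner d (evec_diff d x s) (evec_diff d x s) = D\<^sup>2" by (simp add: D_def evec_norm_square)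
  have inner: "f - \<Lambda>2 * D\<^sup>2 \<le> evec_inner d \<zeta> x - evec_inner d \<zeta> s"
  proof -
    have "evec_inner d (evec_diff d s x) (evec_diff d s x) = D\<^sup>2"
      unfolding evec_norm_square[symmetric] D_def by (simp add: evec_norm_diff_commute)
    with limiting_subdiff_bounds(1)[OF m up1 up2 pos(1,2) \<zeta>(1) s(1)]
    show ?thesis by (simp add: phase_loss_at_solution f_def)
  qed
  have expand: "(evec_norm d (evec_diff d x' s))\<^sup>2
      = D\<^sup>2 - 2 * \<tau> * (evec_inner d \<zeta> x - evec_inner d \<zeta> s) + \<tau> * f"
  proof -
    have x': "evec_inner d u (evec_diff d x' s) = evec_inner d u (evec_diff d x s) - \<tau> * evec_inner d u \<zeta>" for u
      by (simp add: x'_def \<tau>_def f_def z_def)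
    have "evec_inner d (evec_diff d x' s) (evec_diff d x' s)
       = evec_inner d (evec_diff d x s) (evec_diff d x s)
         - 2 * \<tau> * evec_inner d \<zeta> (evec_diff d x s) + \<tau> * \<tau> * evec_inner d \<zeta> \<zeta>"
      unfolding x' evec_inner_commute[of d "evec_diff d x' s"]
      by (simp only: evec_inner_commute[of d "evec_diff d x s" \<zeta>] algebra_simps)
    moreover have "\<tau> * evec_inner d \<zeta> \<zeta> = f"
      using zpos by (simp add: \<tau>_def z_def evec_norm_square[symmetric])
    then have "\<tau> * \<tau> * evec_inner d \<zeta> \<zeta> = \<tau> * f" by (simp only: mult.assoc)
    ultimately show ?thesis by (simp only: evec_norm_square DD[symmetric] evec_inner_diff)
  qed
  \<comment> \<open>The condition on the radius gives 2 \<Lambda>2 r \<le> g / 4, and 1/4 is just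
    below (7/20) (3/8) (31/16). Thus weak convexity consumes at most the fraction 7/20 of
    \<open>f\<close>, and 13/20 is left.\<close>
  have wc: "2 * (\<Lambda>2 * D\<^sup>2) \<le> 7 / 20 * f"
  proof -
    have "2 * \<Lambda>2 * D \<le> 2 * \<Lambda>2 * (r * n)" using D pos by (intro mult_left_mono) auto
    also have "\<dots> = (2 * \<Lambda>2 * r) * n" by simp
    also have "\<dots> \<le> g / 4 * n" using r n by (intro mult_right_mono) auto
    also have "\<dots> \<le> 7 / 20 * (3 / 8 * g * (31 / 16 * n))" using pos n by simp
    also have "\<dots> \<le> 7 / 20 * (3 / 8 * g * S)" using S pos by (intro mult_left_mono) auto
    finally have "(2 * \<Lambda>2 * D) * D \<le> (7 / 20 * (3 / 8 * g * S)) * D" using D by (intro mult_right_mono) auto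
    also have "\<dots> = 7 / 20 * (3 / 8 * g * (D * S))" by simp
    also have "\<dots> \<le> 7 / 20 * f" using fl by (intro mult_left_mono) auto
    finally show ?thesis by (simp add: power2_eq_square mult.assoc)
  qed
  have "(evec_norm d (evec_diff d x' s))\<^sup>2 \<le> D\<^sup>2 - 2 * \<tau> * (f - \<Lambda>2 * D\<^sup>2) + \<tau> * f"
    unfolding expand using mult_left_mono[OF inner, of "2 * \<tau>"] \<tau>0 by simp
  also have "\<dots> = D\<^sup>2 - \<tau> * (f - 2 * (\<Lambda>2 * D\<^sup>2))" by (simp add: algebra_simps)
  also have "\<dots> \<le> D\<^sup>2 - \<tau> * (13 / 20 * f)"
    using wc \<tau>0 by (intro diff_left_mono mult_left_mono) auto
  also have "\<tau> * (13 / 20 * f) = 13 / 20 * (f / z)\<^sup>2" by (simp add: \<tau>_def power_divide power2_eq_square)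
  also have "D\<^sup>2 - 13 / 20 * (f / z)\<^sup>2 \<le> D\<^sup>2 - (g / (sqrt 32 * \<Lambda>1 * (1 + r)))\<^sup>2 * D\<^sup>2"
  proof (rule diff_left_mono)
    define q where "q = g / (\<Lambda>1 * (1 + r))"
    have q: "q \<ge> 0" using pos r by (simp add: q_def)
    have den: "2 * \<Lambda>1 * ((1 + r) * n) > 0" using pos r n by simp
    \<comment> \<open>93/256 is half of (3/8) (31/16), the half coming from the factor 2 in the
      subgradient bound. Its square times 13/20 exceeds the required 1/32.\<close>
    have "93 / 256 * q * D = (3 / 8 * g * (D * (31 / 16 * n))) / (2 * \<Lambda>1 * ((1 + r) * n))"
    proof -
      define L where "L = \<Lambda>1 * (1 + r)"
      have "L > 0" using pos r by (simp add: L_def)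
      moreover have "2 * \<Lambda>1 * ((1 + r) * n) = 2 * (L * n)" by (simp add: L_def)
      ultimately show ?thesis using n by (simp add: q_def field_simps flip: L_def)
    qed
    also have "\<dots> \<le> f / (2 * \<Lambda>1 * ((1 + r) * n))"
    proof (rule divide_right_mono)
      have "3 / 8 * g * (D * (31 / 16 * n)) \<le> 3 / 8 * g * (D * S)"
        using S D pos by (intro mult_left_mono) auto
      then show "3 / 8 * g * (D * (31 / 16 * n)) \<le> f" using fl by linarith
    qed (use den in simp)
    also have "\<dots> \<le> f / z" using zb zpos f0 den by (intro divide_left_mono) auto
    finally have "(93 / 256 * q * D)\<^sup>2 \<le> (f / z)\<^sup>2" using q D by (intro power_mono) auto
    moreover have "1 / 32 * (q * D)\<^sup>2 \<le> 13 / 20 * (93 / 256 * q * D)\<^sup>2"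
      using q D by (simp add: power_mult_distrib power2_eq_square)
    ultimately have "1 / 32 * (q * D)\<^sup>2 \<le> 13 / 20 * (f / z)\<^sup>2" by linarith
    moreover have "(g / (sqrt 32 * \<Lambda>1 * (1 + r)))\<^sup>2 * D\<^sup>2 = 1 / 32 * (q * D)\<^sup>2"
      by (simp add: q_def power_mult_distrib power_divide)
    ultimately show "(g / (sqrt 32 * \<Lambda>1 * (1 + r)))\<^sup>2 * D\<^sup>2 \<le> 13 / 20 * (f / z)\<^sup>2" by simp
  qed
  also have "\<dots> = (1 - (g / (sqrt 32 * \<Lambda>1 * (1 + r)))\<^sup>2) * D\<^sup>2" by (simp add: algebra_simps)
  finally show ?thesis by (simp only: D_def)
qed

lemma polyak_iterates_contract:
  assumes it: "polyak_iterates d (phase_loss d m a b) x0 N x"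
    and near: "evec_norm d (evec_diff d x0 s) \<le> r * evec_norm d s"
  shows "enat k \<le> N \<Longrightarrow> evec_norm d (evec_diff d (x k) s) \<le> r * evec_norm d s"
    and "enat k < N \<Longrightarrow> (evec_norm d (evec_diff d (x (Suc k)) s))\<^sup>2 \<le>
      (1 - (g / (sqrt 32 * \<Lambda>1 * (1 + r)))\<^sup>2) * (evec_norm d (evec_diff d (x k) s))\<^sup>2"
proof -
  have step: "(evec_norm d (evec_diff d (x (Suc k)) s))\<^sup>2 \<le>
      (1 - (g / (sqrt 32 * \<Lambda>1 * (1 + r)))\<^sup>2) * (evec_norm d (evec_diff d (x k) s))\<^sup>2"
    if k: "enat k < N" and nk: "evec_norm d (evec_diff d (x k) s) \<le> r * evec_norm d s" for k
  proof -
    from it k obtain \<zeta> where \<zeta>: "\<zeta> \<in> limiting_subdiff d (phase_loss d m a b) (x k)" "\<zeta> \<noteq> evec_zero d"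
      "x (Suc k) = evec_diff d (x k) (evec_scale d
        ((phase_loss d m a b (x k) - (INF y\<in>evec d. phase_loss d m a b y)) / (evec_norm d \<zeta>)\<^sup>2) \<zeta>)"
      unfolding polyak_iterates_def by blast
    show ?thesis using polyak_step_contracts[OF \<zeta>(1,2) nk] \<zeta>(3) by (simp add: phase_loss_infimum)
  qed
  \<comment> \<open>Contraction keeps the iterates in the initial ball, which in turn permits the
    next step. Nearness is claimed up to and including \<open>N\<close>, the rate only for steps
    actually performed.\<close>
  have all: "enat k \<le> N \<Longrightarrow> evec_norm d (evec_diff d (x k) s) \<le> r * evec_norm d s" for k
  proof (induction k)
    case 0
    then show ?case using it near by (simp add: polyak_iterates_def)
  next
    case (Suc k)
    have k: "enat k < N" using Suc.prems by (metis Suc_ile_eq)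
    have ih: "evec_norm d (evec_diff d (x k) s) \<le> r * evec_norm d s" using Suc.IH k by simp
    have sq: "(evec_norm d (evec_diff d (x (Suc k)) s))\<^sup>2 \<le> 1 * (evec_norm d (evec_diff d (x k) s))\<^sup>2"
      using step[OF k ih] by (rule order_trans) (intro mult_right_mono, auto)
    have "evec_norm d (evec_diff d (x (Suc k)) s) \<le> evec_norm d (evec_diff d (x k) s)"
      by (rule power2_le_imp_le) (use sq in simp_all)
    then show ?case using ih by linarith
  qed
  show "enat k \<le> N \<Longrightarrow> evec_norm d (evec_diff d (x k) s) \<le> r * evec_norm d s" by (rule all)
  show "enat k < N \<Longrightarrow> (evec_norm d (evec_diff d (x (Suc k)) s))\<^sup>2 \<le>
      (1 - (g / (sqrt 32 * \<Lambda>1 * (1 + r)))\<^sup>2) * (evec_norm d (evec_diff d (x k) s))\<^sup>2"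
  proof -
    assume "enat k < N"
    then show ?thesis using all by (intro step) auto
  qed
qed

end

lemma geometric_square_tendsto_zero:
  fixes D :: "nat \<Rightarrow> real"
  assumes "\<And>k. (D (Suc k))\<^sup>2 \<le> (1 - q) * (D k)\<^sup>2" "0 < q" "q \<le> 1"
  shows "D \<longlonglongrightarrow> 0"
proof -
  have le: "(D k)\<^sup>2 \<le> (1 - q) ^ k * (D 0)\<^sup>2" for k
  proof (induction k)
    case (Suc k)
    have "(D (Suc k))\<^sup>2 \<le> (1 - q) * (D k)\<^sup>2" by (rule assms(1))
    also have "\<dots> \<le> (1 - q) * ((1 - q) ^ k * (D 0)\<^sup>2)" using Suc assms(3) by (intro mult_left_mono) auto
    finally show ?case by simp
  qed simp
  have "(\<lambda>k. (1 - q) ^ k * (D 0)\<^sup>2) \<longlonglongrightarrow> 0 * (D 0)\<^sup>2"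
    using assms by (intro tendsto_intros LIMSEQ_realpow_zero) auto
  then have "(\<lambda>k. (1 - q) ^ k * (D 0)\<^sup>2) \<longlonglongrightarrow> 0" by simp
  then have "(\<lambda>k. (D k)\<^sup>2) \<longlonglongrightarrow> 0"
    by (rule tendsto_sandwich[OF _ _ tendsto_const, rotated 2]) (use le in auto)
  from tendsto_real_sqrt[OF this] have "(\<lambda>k. \<bar>D k\<bar>) \<longlonglongrightarrow> 0" by simp
  then show ?thesis by (rule tendsto_rabs_zero_cancel)
qed

section \<open>Uniform lower bound for products\<close>

text \<open>The base e (1 + 8 r^2) is at most e (3 r)^2, and 3 r \<le> exp (2 sqrt r) turns this
  into exp (5 sqrt r). The square root is a deliberately weak substitute for the logarithm, chosen
  to be compared with p sqrt r. The factor 2 m counts sample and ghost points together.\<close>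

lemma exponents_card_le_exp:
  fixes r :: real
  assumes d: "d > 0" and r: "r = real m / real d" "r \<ge> 1" and M: "real M \<le> 4 * r"
  shows "real (card (exponents d (M * (2 * m)))) \<le> exp (5 * real d * sqrt r)"
proof -
  have sr: "sqrt r \<ge> 1" "sqrt r * sqrt r = r" using r(2) by auto
  have "real (card (exponents d (M * (2 * m)))) \<le> (exp 1 * (1 + real (M * (2 * m)) / real d)) ^ d"
    by (rule card_exponents_le[OF d])
  also have "real (M * (2 * m)) / real d = 2 * real M * r" by (simp add: r(1))
  also have "(exp 1 * (1 + 2 * real M * r)) ^ d \<le> exp (5 * sqrt r) ^ d"
  proof (rule power_mono)
    have "2 * real M * r \<le> 2 * (4 * r) * r" using M r(2) by (intro mult_right_mono mult_left_mono) auto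
    then have "2 * real M * r \<le> 8 * (r * r)" by simp
    moreover have "1 * 1 \<le> r * r" using r(2) by (intro mult_mono) auto
    ultimately have "1 + 2 * real M * r \<le> 9 * (r * r)" by linarith
    then have "1 + 2 * real M * r \<le> (3 * r) * (3 * r)" by simp
    also have "\<dots> = (9 * (sqrt r * sqrt r)) * (sqrt r * sqrt r)" unfolding sr(2) by simp
    also have "\<dots> = (3 * (sqrt r * sqrt r)) * (3 * (sqrt r * sqrt r))" by simp
    also have "\<dots> \<le> exp (2 * sqrt r) * exp (2 * sqrt r)"
    proof -
      have "1 + sqrt r + (sqrt r)\<^sup>2 / 2 \<le> exp (sqrt r)" using sr by (intro exp_lower_Taylor_quadratic) auto
      moreover have "2 * sqrt r \<le> 1 + sqrt r + (sqrt r)\<^sup>2 / 2"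
        using zero_le_power2[of "sqrt r - 1"] unfolding power2_diff by simp
      ultimately have "2 * sqrt r \<le> exp (sqrt r)" by linarith
      then have "(2 * sqrt r) * (2 * sqrt r) \<le> exp (sqrt r) * exp (sqrt r)" using sr by (intro mult_mono) auto
      also have "\<dots> = exp (2 * sqrt r)" by (simp flip: exp_add)
      finally have "4 * (sqrt r * sqrt r) \<le> exp (2 * sqrt r)" by (simp only: mult_ac)
      then have "4 * r \<le> exp (2 * sqrt r)" unfolding sr(2) .
      then have "3 * (sqrt r * sqrt r) \<le> exp (2 * sqrt r)" unfolding sr(2) using r(2) by linarith
      then show ?thesis using sr by (intro mult_mono) auto
    qed
    also have "\<dots> = exp (4 * sqrt r)" by (simp flip: exp_add)
    finally have "exp 1 * (1 + 2 * real M * r) \<le> exp (sqrt r) * exp (4 * sqrt r)"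
      using sr r by (intro mult_mono) auto
    then show "exp 1 * (1 + 2 * real M * r) \<le> exp (5 * sqrt r)" by (simp flip: exp_add)
  qed (use r in auto)
  also have "\<dots> = exp (5 * real d * sqrt r)" by (simp add: mult_ac flip: exp_of_nat_mult)
  finally show ?thesis .
qed

lemma rational_evec_approx:
  "\<exists>w. (\<forall>n. w n \<in> {..<d} \<rightarrow>\<^sub>E \<rat>) \<and> (\<forall>i<d. (\<lambda>n. w n i) \<longlonglongrightarrow> (u i :: real))"
proof -
  have "\<forall>n i. \<exists>q\<in>\<rat>. u i < q \<and> q < u i + 1 / real (Suc n)"
    by (intro allI Rats_dense_in_real) simp
  then obtain q where q: "\<And>n i. q n i \<in> \<rat>" "\<And>n i. u i < q n i" "\<And>n i. q n i < u i + 1 / real (Suc n)"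
    by metis
  define w where "w = (\<lambda>n. restrict (q n) {..<d})"
  have "(\<lambda>n. w n i) \<longlonglongrightarrow> u i" if i: "i < d" for i
  proof (rule tendsto_sandwich[where f = "\<lambda>_. u i" and h = "\<lambda>n. u i + 1 / real (Suc n)"])
    show "(\<lambda>n. u i + 1 / real (Suc n)) \<longlonglongrightarrow> u i"
      using tendsto_add[OF tendsto_const LIMSEQ_inverse_real_of_nat, of "u i"] by (simp add: inverse_eq_divide)
    show "\<forall>\<^sub>F n in sequentially. u i \<le> w n i" "\<forall>\<^sub>F n in sequentially. w n i \<le> u i + 1 / real (Suc n)"
      using i q(2,3) by (auto simp: w_def intro!: always_eventually less_imp_le)
  qed auto
  then show ?thesis using q(1) by (intro exI[of _ w]) (auto simp: w_def)
qed

text \<open>Both sides are continuous in \<open>(u, v)\<close>, so the bound passes from rational to real vectors;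
  only countably many events then have to be controlled.\<close>

lemma inner_product_lower_bound_dense:
  assumes "\<And>u v. u \<in> {..<d} \<rightarrow>\<^sub>E \<rat> \<Longrightarrow> v \<in> {..<d} \<rightarrow>\<^sub>E \<rat> \<Longrightarrow> t * (evec_norm d u * evec_norm d v) \<le>
      (\<Sum>i<m. \<bar>evec_inner d (a i) u * evec_inner d (a i) v\<bar>) / real m"
  shows "t * (evec_norm d u * evec_norm d v) \<le>
      (\<Sum>i<m. \<bar>evec_inner d (a i) u * evec_inner d (a i) v\<bar>) / real m"
proof -
  obtain u' where u': "\<And>n. u' n \<in> {..<d} \<rightarrow>\<^sub>E \<rat>" "\<And>i. i < d \<Longrightarrow> (\<lambda>n. u' n i) \<longlonglongrightarrow> u i"
    using rational_evec_approx[of d u] by blast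
  obtain v' where v': "\<And>n. v' n \<in> {..<d} \<rightarrow>\<^sub>E \<rat>" "\<And>i. i < d \<Longrightarrow> (\<lambda>n. v' n i) \<longlonglongrightarrow> v i"
    using rational_evec_approx[of d v] by blast
  show ?thesis
  proof (rule LIMSEQ_le)
    show "(\<lambda>n. t * (evec_norm d (u' n) * evec_norm d (v' n))) \<longlonglongrightarrow> t * (evec_norm d u * evec_norm d v)"
      unfolding evec_norm_eq_sqrt by (intro tendsto_intros evec_inner_tendsto u' v')
    show "(\<lambda>n. (\<Sum>i<m. \<bar>evec_inner d (a i) (u' n) * evec_inner d (a i) (v' n)\<bar>) / real m)
      \<longlonglongrightarrow> (\<Sum>i<m. \<bar>evec_inner d (a i) u * evec_inner d (a i) v\<bar>) / real m"
      unfolding divide_inverse by (intro tendsto_intros evec_inner_tendsto u' v')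
    show "\<exists>n0. \<forall>n\<ge>n0. t * (evec_norm d (u' n) * evec_norm d (v' n)) \<le>
        (\<Sum>i<m. \<bar>evec_inner d (a i) (u' n) * evec_inner d (a i) (v' n)\<bar>) / real m"
      using assms[OF u'(1) v'(1)] by (intro exI[of _ 0]) simp
  qed
qed

text \<open>All parameters of the pattern count are fixed here, and each requirement reduces to a
  multiple of d sqrt r. The factor 3/8 is the level 3/4 times the guaranteed fraction p / 2 of
  sample points.\<close>

lemma inner_products_uniform_lower_bound:
  fixes m :: nat and \<kappa> p :: real
  assumes law: "vector_law d P" and d: "d > 0" and \<kappa>: "\<kappa> > 0" and p: "0 < p" "p \<le> 1"
    and small_ball: "\<And>u v. u \<in> evec_sphere d \<Longrightarrow> v \<in> evec_sphere d \<Longrightarrow>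
      measure P {a \<in> space P. \<kappa> \<le> \<bar>evec_inner d a v * evec_inner d a u\<bar>} \<ge> p"
    and m: "10 ^ 8 / p\<^sup>2 \<le> real m / real d"
  defines "M \<equiv> PiM {..<m} (\<lambda>_. P)"
  shows "\<exists>B\<in>sets M. measure M B \<le> exp (- (p * real m / 200)) \<and>
    (\<forall>a\<in>space M - B. \<forall>u v. 3 / 8 * (p * \<kappa>) * (evec_norm d u * evec_norm d v) \<le>
      (\<Sum>i<m. \<bar>evec_inner d (a i) u * evec_inner d (a i) v\<bar>) / real m)"
proof -
  have P: "prob_space P" using law by (simp add: vector_law_def)
  define r where "r = real m / real d"
  have p2: "0 < p\<^sup>2" "p\<^sup>2 \<le> 1" using p by (auto simp: power_le_one)
  have rp: "10 ^ 8 \<le> r * p\<^sup>2" using m p2 by (simp add: r_def field_simps)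
  have "r * p\<^sup>2 \<le> r * 1" using p2 by (intro mult_left_mono) (auto simp: r_def)
  then have r1: "10 ^ 8 \<le> r" using rp by simp
  have md: "real m = r * real d" using d by (simp add: r_def)
  have sr: "sqrt r * sqrt r = r" "1 \<le> sqrt r" using r1 by auto
  have psr: "10 ^ 4 \<le> p * sqrt r"
  proof (rule power2_le_imp_le)
    show "(10 ^ 4)\<^sup>2 \<le> (p * sqrt r)\<^sup>2" using rp r1 by (simp add: power_mult_distrib mult.commute)
  qed (use p r1 in auto)
  have pm: "10000 * (real d * sqrt r) \<le> p * real m"
  proof -
    have "10000 * (real d * sqrt r) \<le> (p * sqrt r) * (real d * sqrt r)"
      using psr r1 by (intro mult_right_mono) auto
    also have "\<dots> = p * (sqrt r * sqrt r * real d)" by simp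
    finally show ?thesis unfolding sr md .
  qed
  have ds: "1 \<le> real d * sqrt r" using mult_mono[of 1 "real d" 1 "sqrt r"] d sr(2) by simp
  \<comment> \<open>The symmetric difference allowed is h = p m / 10. There are 2 m points, and 2 m
    / K must not exceed h / 2 = p m / 20, hence K is at least 40 / p; the upper bound 41 / p limits
    the loss from rounding.\<close>
  define K where "K = nat \<lceil>40 / p\<rceil>"
  have K: "40 / p \<le> real K" "real K \<le> 41 / p"
  proof -
    have "0 < 40 / p" using p by simp
    then show "40 / p \<le> real K" unfolding K_def by linarith
    have "1 \<le> 1 / p" using p by simp
    then have "40 / p + 1 \<le> 41 / p" by (simp add: field_simps)
    then show "real K \<le> 41 / p" using \<open>0 < 40 / p\<close> unfolding K_def by linarith
  qed
  have Kpos: "K > 0" using K(1) p by (intro Nat.gr0I) (auto simp: field_simps)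
  \<comment> \<open>The exponent M, of size 2 r to 4 r and even so that absolute values disappear
    from the powers.\<close>
  define L where "L = 2 * nat \<lceil>r\<rceil>"
  have "real (nat \<lceil>r\<rceil>) = real_of_int \<lceil>r\<rceil>" using r1 by simp
  moreover have "1 \<le> r" using r1 by simp
  ultimately have "r \<le> real (nat \<lceil>r\<rceil>)" "real (nat \<lceil>r\<rceil>) \<le> 2 * r"
    using of_int_ceiling_le_add_one[of r] le_of_int_ceiling[of r] by linarith+
  then have L: "2 * r \<le> real L" "real L \<le> 4 * r" unfolding L_def of_nat_mult by linarith+
  define E where "E = card (exponents d (L * (2 * m)))"
  have "real E \<le> exp (5 * real d * sqrt r)"
    unfolding E_def using L r1 by (intro exponents_card_le_exp d r_def) auto
  then have "(real E)\<^sup>2 \<le> (exp (5 * real d * sqrt r))\<^sup>2" by (intro power_mono) auto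
  also have "\<dots> = exp (10 * (real d * sqrt r))" by (simp add: mult_ac flip: exp_double)
  finally have E2: "(real E)\<^sup>2 \<le> exp (10 * (real d * sqrt r))" .
  define h where "h = p * real m / 10"
  let ?J = "{..<m} \<times> (UNIV :: bool set)"
  have cJ: "card ?J = 2 * m" by (simp add: card_cartesian_product)
  have Kh: "real (card ?J) / real K \<le> h / 2"
  proof -
    have "real (card ?J) / real K \<le> 2 * real m / (40 / p)"
      unfolding cJ of_nat_mult of_nat_numeral using K p by (intro frac_le) auto
    then show ?thesis by (simp add: h_def)
  qed
  have small: "(real (card (exponents d (L * card ?J))))\<^sup>2 * (1 - 1 / (8 * real K)) powr (real L * h / 2) < 1"
  proof -
    have K1: "1 / (8 * real K) \<le> 1 / 8" "1 / (8 * real K) > 0" using Kpos by (auto simp: field_simps)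
    have g0: "0 < 1 - 1 / (8 * real K)" using K1 by linarith
    have h0: "0 \<le> real L * h / 2" using p by (simp add: h_def)
    have "(1 - 1 / (8 * real K)) powr (real L * h / 2) \<le> exp (- (1 / (8 * real K))) powr (real L * h / 2)"
      using exp_ge_add_one_self[of "- (1 / (8 * real K))"] g0 h0 by (intro powr_mono2) auto
    also have "\<dots> = exp (- (real L * h / 2 / (8 * real K)))" by (simp add: powr_def)
    also have "\<dots> \<le> exp (- (11 * (real d * sqrt r)))"
    proof -
      \<comment> \<open>Inserting the lower bound 2 r for the exponent and 41 / p for K gives r p^2
        m / 3280, where 3280 = 8 * 41 * 10. Here r p^2 is at least 10^8 and m = r d is at least d
        sqrt r; only 11 d sqrt r is needed, against 10 d sqrt r for the squared dimension.\<close>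
      have "11 * (real d * sqrt r) \<le> r * real d * (10 ^ 8 / 3280)"
      proof -
        have "sqrt r * 1 \<le> sqrt r * sqrt r" using sr by (intro mult_left_mono) auto
        then have "real d * sqrt r \<le> real d * r" using sr by (intro mult_left_mono) auto
        moreover have "0 \<le> real d * r" using r1 by simp
        ultimately show ?thesis by (simp add: mult.commute)
      qed
      also have "\<dots> \<le> r * real d * (r * p\<^sup>2 / 3280)"
        using rp r1 by (intro mult_left_mono divide_right_mono) auto
      also have "\<dots> = r * p\<^sup>2 * real m / 3280" by (simp add: md)
      also have "\<dots> = (2 * r) * (p * real m / 10) / 2 / (8 * (41 / p)) "
        using p by (simp add: field_simps power2_eq_square)
      also have "\<dots> \<le> real L * h / 2 / (8 * (41 / p))"
        unfolding h_def using L p by (intro divide_right_mono mult_right_mono) auto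
      also have "\<dots> \<le> real L * h / 2 / (8 * real K)"
        using K Kpos h0 p by (intro divide_left_mono) auto
      finally show ?thesis by simp
    qed
    finally have "(real E)\<^sup>2 * (1 - 1 / (8 * real K)) powr (real L * h / 2)
      \<le> exp (10 * (real d * sqrt r)) * exp (- (11 * (real d * sqrt r)))"
      using E2 by (intro mult_mono) auto
    also have "\<dots> = exp (- (real d * sqrt r))" by (simp flip: exp_add)
    also have "\<dots> < 1" using ds by simp
    finally show ?thesis by (simp only: E_def cJ)
  qed

  define RV where "RV = {..<d} \<rightarrow>\<^sub>E (\<rat> :: real set)"
  define Z where "Z = {(u, v). u \<in> RV \<and> v \<in> RV \<and> evec_norm d u > 0 \<and> evec_norm d v > 0}"
  have "countable RV" unfolding RV_def by (intro countable_PiE) (auto simp: countable_rat)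
  then have Z: "countable Z" by (intro countable_subset[of Z "RV \<times> RV"]) (auto simp: Z_def)
  \<comment> \<open>The factor \<kappa> and both norms are absorbed into the first vector, which
    normalizes the threshold to 1. So \<kappa> never reaches the count.\<close>
  define u' where "u' = (\<lambda>(u, v) i. 1 / (\<kappa> * (evec_norm d u * evec_norm d v)) * u i :: real)"
  define H where "H = (\<lambda>z a. \<bar>evec_inner d a (u' z) * evec_inner d a (snd z)\<bar>)"
  have H_eq: "H (u, v) a = \<bar>evec_inner d a u * evec_inner d a v\<bar> / (\<kappa> * (evec_norm d u * evec_norm d v))"
    if "(u, v) \<in> Z" for u v a
  proof -
    have "evec_inner d a (u' (u, v)) = 1 / (\<kappa> * (evec_norm d u * evec_norm d v)) * evec_inner d a u"
      unfolding u'_def prod.case by (rule evec_inner_scale_right)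
    then show ?thesis using that \<kappa> by (simp add: H_def abs_mult Z_def)
  qed
  define B where "B = {a \<in> space M. \<exists>z\<in>Z. real (card {i \<in> {..<m}. H z (a i) \<ge> 3 / 4}) < p * real m / 2}"
  have ghost: "B \<in> sets M" "measure M B \<le> 2 * (real E)\<^sup>2 * exp (- (p * real m / 160))"
    unfolding B_def M_def
  proof (atomize (full), intro conjI)
    note [measurable] = evec_inner_measurable[OF law]
    have meas: "H z \<in> borel_measurable P" for z unfolding H_def by measurable
    have pm200: "p * real m \<ge> 200" using pm ds by linarith
    have sb: "measure P {a \<in> space P. H z a \<ge> 1} \<ge> p" if z: "z \<in> Z" for z
    proof -
      obtain u v where uv: "z = (u, v)" by (cases z)
      have pos: "evec_norm d u > 0" "evec_norm d v > 0" using z by (auto simp: uv Z_def)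
      then have pos': "evec_inner d u u > 0" "evec_inner d v v > 0" by (auto simp: evec_norm_eq_sqrt)
      define e where "e = (\<lambda>w. \<lambda>i\<in>{..<d}. w i / sqrt (evec_inner d w w))"
      have e: "e u \<in> evec_sphere d" "e v \<in> evec_sphere d"
        unfolding e_def by (rule unit_evec(1)[OF pos'(1)], rule unit_evec(1)[OF pos'(2)])
      have inner: "evec_inner d a (e u) = evec_inner d a u / evec_norm d u"
        "evec_inner d a (e v) = evec_inner d a v / evec_norm d v" for a
        unfolding e_def evec_norm_eq_sqrt by (rule unit_evec(2)[OF pos'(1)], rule unit_evec(2)[OF pos'(2)])
      have "{a \<in> space P. H z a \<ge> 1} = {a \<in> space P. \<kappa> \<le> \<bar>evec_inner d a (e v) * evec_inner d a (e u)\<bar>}"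
        using pos \<kappa> z unfolding uv inner by (simp add: H_eq abs_mult field_simps)
      then show ?thesis using small_ball[OF e] by simp
    qed
    have cover: "\<exists>F. F \<subseteq> Pow ?J \<and> real (card F) \<le> (real E)\<^sup>2 \<and> (\<forall>z\<in>Z. \<exists>T\<in>F. \<exists>S. {j \<in> ?J. H z (b j) \<ge> 1} \<subseteq> S \<and>
        S \<subseteq> {j \<in> ?J. H z (b j) \<ge> 3 / 4} \<and> real (card ((S - T) \<union> (T - S))) \<le> p * real m / 10)"
      for b :: "nat \<times> bool \<Rightarrow> nat \<Rightarrow> real"
    proof -
      have "finite ?J" "even L" by (simp_all add: L_def)
      from bilinear_pattern_cover[OF this Kpos Kh small, of b] obtain F where
        F: "F \<subseteq> Pow ?J" "card F \<le> E\<^sup>2"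
        "\<And>u v. \<exists>T\<in>F. \<exists>S. {j \<in> ?J. \<bar>evec_inner d (b j) u * evec_inner d (b j) v\<bar> \<ge> 1} \<subseteq> S \<and>
          S \<subseteq> {j \<in> ?J. \<bar>evec_inner d (b j) u * evec_inner d (b j) v\<bar> \<ge> 3 / 4} \<and>
          real (card ((S - T) \<union> (T - S))) \<le> h"
        unfolding cJ E_def by blast
      have "real (card F) \<le> real (E\<^sup>2)" using F(2) by (rule of_nat_mono)
      then have "real (card F) \<le> (real E)\<^sup>2" by simp
      then show ?thesis using F(1) F(3)[of "u' z" "snd z" for z] unfolding H_def h_def by blast
    qed
    note * = uniform_count_lower_bound[OF P Z meas p(1) pm200 sb cover]
    show "{a \<in> space (Pi\<^sub>M {..<m} (\<lambda>_. P)). \<exists>z\<in>Z. real (card {i \<in> {..<m}. 3 / 4 \<le> H z (a i)}) < p * real m / 2}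
      \<in> sets (Pi\<^sub>M {..<m} (\<lambda>_. P))" by (rule *(1))
    show "measure (Pi\<^sub>M {..<m} (\<lambda>_. P)) {a \<in> space (Pi\<^sub>M {..<m} (\<lambda>_. P)). \<exists>z\<in>Z.
      real (card {i \<in> {..<m}. 3 / 4 \<le> H z (a i)}) < p * real m / 2} \<le> 2 * (real E)\<^sup>2 * exp (- (p * real m / 160))"
      by (rule *(2))
  qed
  \<comment> \<open>The difference of the exponents p m / 160 and p m / 200 is p m / 800, at least
    12.5 d sqrt r, which covers 1 + 10 d sqrt r because d sqrt r is at least 1.\<close>
  have "2 * (real E)\<^sup>2 * exp (- (p * real m / 160)) \<le> exp 1 * exp (10 * (real d * sqrt r)) * exp (- (p * real m / 160))"
    using E2 exp_ge_add_one_self[of 1] by (intro mult_mono) auto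
  also have "\<dots> = exp (1 + 10 * (real d * sqrt r) - p * real m / 160)" by (simp flip: exp_add)
  also have "\<dots> \<le> exp (- (p * real m / 200))" using pm ds by simp
  finally have Ble: "measure M B \<le> exp (- (p * real m / 200))" using ghost(2) by linarith
  have "3 / 8 * (p * \<kappa>) * (evec_norm d u * evec_norm d v) \<le>
      (\<Sum>i<m. \<bar>evec_inner d (a i) u * evec_inner d (a i) v\<bar>) / real m"
    if a: "a \<in> space M - B" for a u v
  proof (rule inner_product_lower_bound_dense)
    fix u v :: "nat \<Rightarrow> real" assume uv: "u \<in> {..<d} \<rightarrow>\<^sub>E \<rat>" "v \<in> {..<d} \<rightarrow>\<^sub>E \<rat>"
    define t where "t = \<kappa> * (evec_norm d u * evec_norm d v)"
    show "3 / 8 * (p * \<kappa>) * (evec_norm d u * evec_norm d v) \<le>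
      (\<Sum>i<m. \<bar>evec_inner d (a i) u * evec_inner d (a i) v\<bar>) / real m"
    proof (cases "evec_norm d u = 0 \<or> evec_norm d v = 0")
      case True
      then show ?thesis by (auto intro!: divide_nonneg_nonneg sum_nonneg)
    next
      case False
      then have pos: "evec_norm d u > 0" "evec_norm d v > 0"
        using evec_norm_nonneg[of d u] evec_norm_nonneg[of d v] by linarith+
      then have z: "(u, v) \<in> Z" using uv by (simp add: Z_def RV_def)
      have t: "t > 0" using pos \<kappa> by (simp add: t_def)
      let ?C = "{i \<in> {..<m}. H (u, v) (a i) \<ge> 3 / 4}"
      have C: "p * real m / 2 \<le> real (card ?C)" using a z by (force simp: B_def)
      have "3 / 4 * t * (p * real m / 2) \<le> 3 / 4 * t * real (card ?C)"
        using C t by (intro mult_left_mono) auto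
      also have "\<dots> = (\<Sum>i\<in>?C. 3 / 4 * t)" by simp
      also have "\<dots> \<le> (\<Sum>i\<in>?C. \<bar>evec_inner d (a i) u * evec_inner d (a i) v\<bar>)"
      proof (rule sum_mono)
        fix i assume "i \<in> ?C"
        then show "3 / 4 * t \<le> \<bar>evec_inner d (a i) u * evec_inner d (a i) v\<bar>"
          using t by (simp add: H_eq[OF z] t_def[symmetric] pos_le_divide_eq)
      qed
      also have "\<dots> \<le> (\<Sum>i<m. \<bar>evec_inner d (a i) u * evec_inner d (a i) v\<bar>)"
        by (intro sum_mono2) auto
      finally have "3 / 8 * (p * \<kappa>) * (evec_norm d u * evec_norm d v) * real m
        \<le> (\<Sum>i<m. \<bar>evec_inner d (a i) u * evec_inner d (a i) v\<bar>)"
        by (simp add: t_def mult_ac)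
      moreover have "real m > 0" using md r1 d by simp
      ultimately show ?thesis by (simp only: pos_le_divide_eq)
    qed
  qed
  then show ?thesis using ghost(1) Ble by blast
qed

section \<open>The rate holds with high probability\<close>

lemma sign_dist_symmetric_solution:
  assumes "s = xbar \<or> s = evec_scale d (- 1) xbar"
  shows "sign_dist d x xbar = min (evec_norm d (evec_diff d x s)) (evec_norm d (evec_add d x s))"
proof -
  have "evec_norm d (evec_diff d x (evec_scale d (- 1) xbar)) = evec_norm d (evec_add d x xbar)"
    "evec_norm d (evec_add d x (evec_scale d (- 1) xbar)) = evec_norm d (evec_diff d x xbar)"
    by (simp_all add: evec_norm_eq_sqrt)
  then show ?thesis using assms by (auto simp: sign_dist_def min.commute)
qed

text \<open>The sign is chosen once, from \<open>x0\<close>. Iterates stay within r |s| of this s,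
  hence at least (31/16) |s| away from - s, so the minimum in \<open>sign_dist\<close> is always
  attained at the same s and the one-sided contraction carries over.\<close>

lemma polyak_sign_dist_rate:
  fixes d m :: nat and \<Lambda>1 \<Lambda>2 g r :: real
  defines "q \<equiv> (g / (sqrt 32 * \<Lambda>1 * (1 + r)))\<^sup>2"
  assumes m: "m > 0"
    and up: "\<And>v. (\<Sum>i<m. (evec_inner d (a i) v)\<^sup>2) / real m \<le> \<Lambda>1 * evec_inner d v v"
      "\<And>v. (\<Sum>i<m. (evec_inner d (a i) v)\<^sup>2) / real m \<le> \<Lambda>2 * evec_inner d v v"
    and low: "\<And>u v. 3 / 8 * g * (evec_norm d u * evec_norm d v) \<le>
      (\<Sum>i<m. \<bar>evec_inner d (a i) u * evec_inner d (a i) v\<bar>) / real m"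
    and pos: "\<Lambda>1 \<ge> 1" "\<Lambda>2 > 0" "g > 0" "g \<le> 1"
    and r: "0 \<le> r" "r \<le> 1 / 16" "2 * \<Lambda>2 * r \<le> g / 4"
    and xbar: "xbar \<in> evec d" "xbar \<noteq> evec_zero d"
    and near: "sign_dist d x0 xbar \<le> r * evec_norm d xbar"
    and it: "polyak_iterates d (phase_loss d m a (\<lambda>i. (evec_inner d (a i) xbar)\<^sup>2)) x0 N x"
  shows "N = \<infinity> \<Longrightarrow> (\<lambda>k. sign_dist d (x k) xbar) \<longlonglongrightarrow> 0"
    and "enat k < N \<Longrightarrow> (sign_dist d (x (Suc k)) xbar)\<^sup>2 \<le> (1 - q) * (sign_dist d (x k) xbar)\<^sup>2"
proof -
  have neg: "evec_norm d (evec_diff d x0 (evec_scale d (- 1) xbar)) = evec_norm d (evec_add d x0 xbar)"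
    "evec_norm d (evec_scale d (- 1) xbar) = evec_norm d xbar"
    by (simp_all add: evec_norm_eq_sqrt)
  obtain s where s: "s = xbar \<or> s = evec_scale d (- 1) xbar"
    and s0: "evec_norm d (evec_diff d x0 s) \<le> r * evec_norm d s"
    using near neg unfolding sign_dist_def min_le_iff_disj by metis
  have ns: "evec_norm d s > 0" using s neg(2) evec_norm_pos[OF xbar] by auto
  have s1: "s \<in> evec d" "s \<noteq> evec_zero d"
  proof -
    show "s \<in> evec d" using s xbar by auto
    have "evec_norm d (evec_zero d) = 0" by (simp add: evec_zero_def evec_norm_def L2_set_def)
    then show "s \<noteq> evec_zero d" using ns by auto
  qed
  have b: "(evec_inner d (a i) xbar)\<^sup>2 = (evec_inner d (a i) s)\<^sup>2" for i using s by auto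
  have \<Lambda>1: "\<Lambda>1 > 0" using pos by simp
  note contract = polyak_iterates_contract[OF m up low \<Lambda>1 pos(2,3) r s1 b it s0, folded q_def]
  have eq: "sign_dist d (x k) xbar = evec_norm d (evec_diff d (x k) s)" if "enat k \<le> N" for k
  proof -
    have "evec_norm d (evec_diff d (x k) s) \<le> r * evec_norm d s" by (rule contract(1)[OF that])
    also have "\<dots> \<le> 31 / 16 * evec_norm d s" using r ns by (intro mult_right_mono) auto
    also have "\<dots> \<le> evec_norm d (evec_add d (x k) s)"
      by (rule near_solution_norm_sum[OF contract(1)[OF that] r(2)])
    finally show ?thesis unfolding sign_dist_symmetric_solution[OF s] by simp
  qed
  show rate: "enat k < N \<Longrightarrow> (sign_dist d (x (Suc k)) xbar)\<^sup>2 \<le> (1 - q) * (sign_dist d (x k) xbar)\<^sup>2" for k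
  proof -
    assume k: "enat k < N"
    then have "enat (Suc k) \<le> N" "enat k \<le> N" by (auto simp: Suc_ile_eq)
    then show ?thesis using contract(2)[OF k] eq by simp
  qed
  have q: "0 < q" "q \<le> 1"
  proof -
    have "1 * 1 * 1 \<le> sqrt 32 * \<Lambda>1 * (1 + r)" using pos r by (intro mult_mono) auto
    then have "g / (sqrt 32 * \<Lambda>1 * (1 + r)) \<le> 1" "0 < g / (sqrt 32 * \<Lambda>1 * (1 + r))"
      using pos by (auto simp: divide_le_eq_1)
    then show "0 < q" "q \<le> 1" unfolding q_def by (auto simp: power_le_one)
  qed
  show "N = \<infinity> \<Longrightarrow> (\<lambda>k. sign_dist d (x k) xbar) \<longlonglongrightarrow> 0"
    using rate q by (intro geometric_square_tendsto_zero[of _ q]) auto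
qed

text \<open>Markov's inequality for <a, u>^2 at level \<kappa>: taking both vectors in the small
  ball condition equal produces the square, whose mean is 1 by isotropy.\<close>

lemma small_ball_product_le_one:
  assumes law: "vector_law d P" and iso: "isotropic d P" and u: "u \<in> evec_sphere d" and \<kappa>: "\<kappa> > 0"
    and p: "measure P {a \<in> space P. \<kappa> \<le> \<bar>evec_inner d a u * evec_inner d a u\<bar>} \<ge> p"
  shows "p * \<kappa> \<le> 1"
proof -
  interpret prob_space P using law by (simp add: vector_law_def)
  note [measurable] = evec_inner_measurable[OF law]
  let ?A = "{a \<in> space P. \<kappa> \<le> \<bar>evec_inner d a u * evec_inner d a u\<bar>}"
  have uu: "evec_inner d u u = 1"
    using u by (simp add: evec_sphere_def evec_norm_square[symmetric])
  have A: "?A \<in> sets P" by measurable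
  have "p * \<kappa> \<le> measure P ?A * \<kappa>" using p \<kappa> by (intro mult_right_mono) auto
  also have "\<dots> = (\<integral>a. \<kappa> * indicator ?A a \<partial>P)" using A by simp
  also have "\<dots> \<le> (\<integral>a. (evec_inner d a u)\<^sup>2 \<partial>P)"
  proof (rule integral_mono)
    show "integrable P (\<lambda>a. \<kappa> * indicator ?A a)"
      using A by (intro integrable_mult_right integrable_real_indicator) (auto simp: emeasure_eq_measure)
    show "integrable P (\<lambda>a. (evec_inner d a u)\<^sup>2)" by (rule isotropic_second_moment(1)[OF iso])
    show "\<kappa> * indicator ?A a \<le> (evec_inner d a u)\<^sup>2" if "a \<in> space P" for a
      using \<kappa> by (auto simp: indicator_def power2_eq_square)
  qed
  also have "\<dots> = 1" using isotropic_second_moment(2)[OF iso] uu by simp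
  finally show ?thesis .
qed

text \<open>Since m p^2 is at least 10^8 d, the cardinality exp (33 d) of the net is absorbed by a
  small part of each exponent. Four exponentials remain, within the six allowed.\<close>

lemma failure_probability_le:
  fixes d m :: nat and p :: real
  assumes p: "0 < p" "p \<le> 1" and d: "d > 0" and m: "10 ^ 8 / p\<^sup>2 \<le> real m / real d"
  shows "exp (33 * real d) * (2 * exp (- (real m * p\<^sup>2 / 15)) + exp (- (real m / 10))) + exp (- (p * real m / 200))
    \<le> 6 * exp (- (real m * Min {p\<^sup>2 / 32, inverse (10 ^ 8), 1}))"
proof -
  define \<mu> where "\<mu> = Min {p\<^sup>2 / 32, inverse (10 ^ 8), 1 :: real}"
  have \<mu>: "\<mu> \<le> p\<^sup>2 / 32" "\<mu> \<le> 1 / 100000000" by (auto simp: \<mu>_def inverse_eq_divide)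
  have p2: "0 < p\<^sup>2" "p\<^sup>2 \<le> 1" using p by (auto simp: power_le_one)
  have dm: "100000000 * real d \<le> real m * p\<^sup>2" using m p2 d by (simp add: field_simps)
  have mm: "real m * p\<^sup>2 \<le> real m * 1" using p2 by (intro mult_left_mono) auto
  have 1: "exp (33 * real d) * exp (- (real m * p\<^sup>2 / 15)) \<le> exp (- (real m * \<mu>))"
  proof -
    have "real m * \<mu> \<le> real m * (p\<^sup>2 / 32)" using \<mu> by (intro mult_left_mono) auto
    then show ?thesis using dm by (simp flip: exp_add)
  qed
  have 2: "exp (33 * real d) * exp (- (real m / 10)) \<le> exp (- (real m * \<mu>))"
  proof -
    have "real m * \<mu> \<le> real m * (1 / 100000000)" using \<mu> by (intro mult_left_mono) auto
    then show ?thesis using dm mm by (simp flip: exp_add)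
  qed
  have 3: "exp (- (p * real m / 200)) \<le> exp (- (real m * \<mu>))"
  proof -
    \<comment> \<open>For p up to 1/10 the bound p^2 / 32 suffices; for larger p the constant
      10^(-8) does.\<close>
    have "\<mu> \<le> p / 200"
    proof (cases "p \<le> 1 / 10")
      case True
      then have "p * p \<le> 1 / 10 * p" using p by (intro mult_right_mono) auto
      then have "p\<^sup>2 \<le> 1 / 10 * p" by (simp add: power2_eq_square)
      then show ?thesis using \<mu>(1) p by linarith
    qed (use \<mu>(2) in simp)
    then have "real m * \<mu> \<le> real m * (p / 200)" by (intro mult_left_mono) auto
    then show ?thesis by (simp add: mult.commute)
  qed
  have "exp (33 * real d) * (2 * exp (- (real m * p\<^sup>2 / 15)) + exp (- (real m / 10))) + exp (- (p * real m / 200))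
      = 2 * (exp (33 * real d) * exp (- (real m * p\<^sup>2 / 15))) + exp (33 * real d) * exp (- (real m / 10))
        + exp (- (p * real m / 200))" by (simp add: algebra_simps)
  also have "\<dots> \<le> 6 * exp (- (real m * \<mu>))"
    using 1 2 3 exp_ge_zero[of "- (real m * \<mu>)"] by linarith
  finally show ?thesis by (simp only: \<mu>_def)
qed

lemma polyak_phase_retrieval_with_high_probability:
  fixes d m :: nat and \<sigma> \<kappa> p0 :: real
  defines "r \<equiv> \<kappa> * p0 / (16 * \<sigma>\<^sup>2)"
    and "L \<equiv> 1 + 70000 * \<sigma>\<^sup>2 * (sqrt (p0\<^sup>2 / 10 ^ 8) + p0\<^sup>2 / 10 ^ 8)"
  assumes \<sigma>: "\<sigma> > 0" and xbar: "xbar \<in> evec d" "xbar \<noteq> evec_zero d"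
    and law: "vector_law d P" and \<kappa>: "\<kappa> > 0" and p0: "p0 > 0"
    and small_ball: "\<And>u v. u \<in> evec_sphere d \<Longrightarrow> v \<in> evec_sphere d \<Longrightarrow>
      measure P {a \<in> space P. \<kappa> \<le> \<bar>evec_inner d a v * evec_inner d a u\<bar>} \<ge> p0"
    and sg: "sub_gaussian d \<sigma> P" and iso: "isotropic d P"
    and md: "10 ^ 8 / p0\<^sup>2 \<le> real m / real d"
    and near: "min (evec_norm d (evec_diff d x0 xbar) / evec_norm d xbar)
      (evec_norm d (evec_add d x0 xbar) / evec_norm d xbar) \<le> r"
  shows "\<exists>E\<in>sets (PiM {..<m} (\<lambda>_. P)).
    measure (PiM {..<m} (\<lambda>_. P)) E \<ge> 1 - 6 * exp (- (real m * Min {p0\<^sup>2 / 32, inverse (10 ^ 8), 1})) \<and>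
    (\<forall>a\<in>E. \<forall>N x. polyak_iterates d (phase_loss d m a (\<lambda>i. (evec_inner d (a i) xbar)\<^sup>2)) x0 N x \<longrightarrow>
      (N = \<infinity> \<longrightarrow> (\<lambda>k. sign_dist d (x k) xbar) \<longlonglongrightarrow> 0) \<and>
      (\<forall>k. enat k < N \<longrightarrow> (sign_dist d (x (Suc k)) xbar)\<^sup>2 \<le>
        (1 - (p0 * \<kappa> / (sqrt 32 * L * (1 + r)))\<^sup>2) * (sign_dist d (x k) xbar)\<^sup>2))"
proof -
  have P: "prob_space P" using law by (simp add: vector_law_def)
  interpret P: prob_space P by (rule P)
  define M where "M = PiM {..<m} (\<lambda>_. P)"
  interpret M: prob_space M unfolding M_def by (intro prob_space_PiM P)
  have nx: "evec_norm d xbar > 0" by (rule evec_norm_pos[OF xbar])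
  have d: "d > 0"
  proof (rule Nat.gr0I)
    assume "d = 0"
    then show False using nx by (simp add: evec_norm_def)
  qed
  \<comment> \<open>The direction of \<open>xbar\<close> supplies a unit vector, at which the
    conditions over the sphere yield \<open>p0 \<le> 1\<close> and
    \<open>p0 * \<kappa> \<le> 1\<close>.\<close>
  define e where "e = (\<lambda>i\<in>{..<d}. xbar i / sqrt (evec_inner d xbar xbar))"
  have e: "e \<in> evec_sphere d"
    unfolding e_def using nx by (intro unit_evec(1)) (simp add: evec_norm_eq_sqrt)
  have p1: "p0 \<le> 1" using small_ball[OF e e] P.prob_le_1 by (rule order_trans)
  have g1: "p0 * \<kappa> \<le> 1" by (rule small_ball_product_le_one[OF law iso e \<kappa> small_ball[OF e e]])
  have \<sigma>1: "\<sigma>\<^sup>2 \<ge> 1" by (rule sub_gaussian_isotropic_ge_one[OF law sg iso \<sigma> d])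
  have m: "m > 0"
  proof (rule Nat.gr0I)
    assume "m = 0"
    then show False using md p0 by (simp add: divide_le_0_iff not_le)
  qed
  obtain A where A: "A \<in> sets M"
    "measure M A \<le> exp (33 * real d) * (2 * exp (- (real m * p0\<^sup>2 / 15)) + exp (- (real m / 10)))"
    "\<And>a v. a \<in> space M - A \<Longrightarrow>
      (\<Sum>i<m. (evec_inner d (a i) v)\<^sup>2) / real m \<le> (1 + 63 / 10 * \<sigma>\<^sup>2 * p0) * evec_inner d v v"
    "\<And>a v. a \<in> space M - A \<Longrightarrow> (\<Sum>i<m. (evec_inner d (a i) v)\<^sup>2) / real m \<le> 2 * \<sigma>\<^sup>2 * evec_inner d v v"
    using second_moment_uniform[OF law sg iso \<sigma> d p0 p1 m, folded M_def] by blast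
  obtain B where B: "B \<in> sets M" "measure M B \<le> exp (- (p0 * real m / 200))"
    "\<And>a u v. a \<in> space M - B \<Longrightarrow> 3 / 8 * (p0 * \<kappa>) * (evec_norm d u * evec_norm d v) \<le>
      (\<Sum>i<m. \<bar>evec_inner d (a i) u * evec_inner d (a i) v\<bar>) / real m"
    using inner_products_uniform_lower_bound[OF law d \<kappa> p0 p1 small_ball md, folded M_def] by blast
  define E where "E = space M - (A \<union> B)"
  have E: "E \<in> sets M" using A(1) B(1) by (auto simp: E_def)
  have "measure M (A \<union> B) \<le> measure M A + measure M B" using A(1) B(1) by (rule measure_Un_le)
  also have "\<dots> \<le> 6 * exp (- (real m * Min {p0\<^sup>2 / 32, inverse (10 ^ 8), 1}))"
    using A(2) B(2) failure_probability_le[OF p0 p1 d md] by linarith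
  finally have prob: "measure M E \<ge> 1 - 6 * exp (- (real m * Min {p0\<^sup>2 / 32, inverse (10 ^ 8), 1}))"
    unfolding E_def using A(1) B(1) by (subst M.prob_compl) auto
  have L: "1 + 63 / 10 * \<sigma>\<^sup>2 * p0 \<le> L" "L \<ge> 1"
  proof -
    \<comment> \<open>With c = 10^8 the root is p0 / 10^4, so the coefficient 70000 becomes 7 and
      dominates the 63/10 of the second moment bound.\<close>
    have "sqrt (p0\<^sup>2 / 10 ^ 8) = p0 / 10000" using p0 by (simp add: real_sqrt_divide real_sqrt_eq_iff real_sqrt_unique)
    then have "1 + 70000 * \<sigma>\<^sup>2 * (p0 / 10000 + 0) \<le> L"
      unfolding L_def by (intro add_left_mono mult_left_mono) auto
    moreover have "63 / 10 * (\<sigma>\<^sup>2 * p0) \<le> 7 * (\<sigma>\<^sup>2 * p0)" "0 \<le> \<sigma>\<^sup>2 * p0"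
      using p0 by (auto intro!: mult_right_mono)
    moreover have "70000 * \<sigma>\<^sup>2 * (p0 / 10000 + 0) = 7 * (\<sigma>\<^sup>2 * p0)" "63 / 10 * \<sigma>\<^sup>2 * p0 = 63 / 10 * (\<sigma>\<^sup>2 * p0)"
      by simp_all
    ultimately show "1 + 63 / 10 * \<sigma>\<^sup>2 * p0 \<le> L" "L \<ge> 1" by linarith+
  qed
  \<comment> \<open>For \<Lambda>2 = 2 \<sigma>^2 the last condition is an equality: the 16 in the
    initial radius is exactly what weak convexity admits.\<close>
  have r: "0 \<le> r" "r \<le> 1 / 16" "2 * (2 * \<sigma>\<^sup>2) * r \<le> p0 * \<kappa> / 4"
  proof -
    show "0 \<le> r" using \<kappa> p0 by (simp add: r_def)
    have "\<kappa> * p0 / (16 * \<sigma>\<^sup>2) \<le> 1 / (16 * 1)" using g1 \<sigma>1 p0 \<kappa> by (intro frac_le) (auto simp: mult.commute)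
    then show "r \<le> 1 / 16" by (simp add: r_def)
    show "2 * (2 * \<sigma>\<^sup>2) * r \<le> p0 * \<kappa> / 4" using \<sigma> by (simp add: r_def mult.commute)
  qed
  have near': "sign_dist d x0 xbar \<le> r * evec_norm d xbar"
    using near nx by (simp add: sign_dist_def min_le_iff_disj pos_divide_le_eq)
  have g0: "p0 * \<kappa> > 0" using p0 \<kappa> by simp
  have rate: "(N = \<infinity> \<longrightarrow> (\<lambda>k. sign_dist d (x k) xbar) \<longlonglongrightarrow> 0) \<and>
      (\<forall>k. enat k < N \<longrightarrow> (sign_dist d (x (Suc k)) xbar)\<^sup>2 \<le>
        (1 - (p0 * \<kappa> / (sqrt 32 * L * (1 + r)))\<^sup>2) * (sign_dist d (x k) xbar)\<^sup>2)"
    if a: "a \<in> E" and it: "polyak_iterates d (phase_loss d m a (\<lambda>i. (evec_inner d (a i) xbar)\<^sup>2)) x0 N x" for a N x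
  proof -
    have aA: "a \<in> space M - A" and aB: "a \<in> space M - B" using a by (auto simp: E_def)
    have up1: "(\<Sum>i<m. (evec_inner d (a i) v)\<^sup>2) / real m \<le> L * evec_inner d v v" for v
      using A(3)[OF aA, of v] mult_right_mono[OF L(1) evec_inner_self_nonneg[of d v]] by linarith
    have \<Lambda>2: "2 * \<sigma>\<^sup>2 > 0" using \<sigma> by simp
    note rates = polyak_sign_dist_rate[OF m up1 A(4)[OF aA] B(3)[OF aB] L(2) \<Lambda>2 g0 g1 r xbar near' it]
    show ?thesis using rates by blast
  qed
  show ?thesis
    by (intro bexI[of _ E] conjI ballI allI impI; (fold M_def)?) (use E prob rate in blast)+
qed

theorem corollary3p9:
  "\<exists>c::real. c > 0 \<and>
    (\<forall>\<sigma>::real. \<sigma> > 0 \<longrightarrow>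
      (\<exists>ctilde::real. \<exists>chat::real. ctilde > 0 \<and> chat > 0 \<and>
        (\<forall>(d::nat) (m::nat) (P::(nat \<Rightarrow> real) measure) (xbar::nat \<Rightarrow> real) (x0::nat \<Rightarrow> real)
            (\<kappa>::real) (p0::real).
          xbar \<in> evec d \<longrightarrow> xbar \<noteq> evec_zero d \<longrightarrow>
          vector_law d P \<longrightarrow>
          \<kappa> > 0 \<longrightarrow> p0 > 0 \<longrightarrow>
          (\<forall>u\<in>evec_sphere d. \<forall>v\<in>evec_sphere d.
            \<P>(a in P. \<bar>evec_inner d a v * evec_inner d a u\<bar> \<ge> \<kappa>) \<ge> p0) \<longrightarrow>
          sub_gaussian d \<sigma> P \<longrightarrow>
          isotropic d P \<longrightarrow>
          c / p0\<^sup>2 \<le> real m / real d \<longrightarrow> real m / real d \<le> real d \<longrightarrow>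
          x0 \<in> evec d \<longrightarrow>
          min (evec_norm d (evec_diff d x0 xbar) / evec_norm d xbar)
              (evec_norm d (evec_add d x0 xbar) / evec_norm d xbar) \<le> \<kappa> * p0 / (16 * \<sigma>\<^sup>2) \<longrightarrow>
          (\<exists>E\<in>sets (PiM {..<m} (\<lambda>_. P)).
            measure (PiM {..<m} (\<lambda>_. P)) E
              \<ge> 1 - 6 * exp (- (real m * Min {p0\<^sup>2 / 32, inverse c, ctilde})) \<and>
            (\<forall>a\<in>E. \<forall>N x.
              polyak_iterates d (phase_loss d m a (\<lambda>i. (evec_inner d (a i) xbar)\<^sup>2)) x0 N x \<longrightarrow>
              (N = \<infinity> \<longrightarrow> (\<lambda>k. sign_dist d (x k) xbar) \<longlonglongrightarrow> 0) \<and>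
              (\<forall>k. enat k < N \<longrightarrow>
                (sign_dist d (x (Suc k)) xbar)\<^sup>2 \<le>
                  (1 - (p0 * \<kappa> /
                         (sqrt 32 * (1 + chat * (sqrt (p0\<^sup>2 / c) + p0\<^sup>2 / c))
                           * (1 + \<kappa> * p0 / (16 * \<sigma>\<^sup>2))))\<^sup>2)
                  * (sign_dist d (x k) xbar)\<^sup>2))))))"
proof (rule exI[of _ "10 ^ 8"], intro conjI allI impI, goal_cases)
  case 1
  show ?case by simp
next
  case (2 \<sigma>)
  then show ?case
    \<comment> \<open>The witnesses are \<open>ctilde = 1\<close>, which never attains the minimum,
      and \<open>chat = 70000 * \<sigma>\<^sup>2\<close>; \<sigma> enters the constants only through
      the latter.\<close>
    by (intro exI[of _ 1] exI[of _ "70000 * \<sigma>\<^sup>2"] conjI allI impI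
        polyak_phase_retrieval_with_high_probability) auto
qed

end
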